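(* Let $\pi(\boldsymbol{p})$ be a prior density for $\boldsymbol{p}\in D$. Then, for every $\boldsymbol{p}\in D$, the Kullback--Leibler risk of the Bayesian predictive mass $\hat g^{(\pi)}(\cdot;\boldsymbol{X})$ is expressed as $$R(\boldsymbol{p},\hat g^{(\pi)})=\int_0^1\Big\{\sum_{\nu=1}^nt_\nu'(\tau)\sum_{k=1}^\infty\frac1k\sum_{(w_i)_{i=1}^{m_\nu}\in\mathcal{W}_{\nu,k}}\frac{k!}{\prod_{i=1}^{m_\nu}w_i!}\,E\Big[L^{\rm KL}\Big(E_\pi\Big[\prod_{i=1}^{m_\nu}p_{i,\nu}^{w_i}\Big|\boldsymbol{Z}(\tau)\Big],\ \prod_{i=1}^{m_\nu}p_{i,\nu}^{w_i}\Big)\Big]\Big\}d\tau.$$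
   Context: Notation: $\mathbb{N}=\{1,2,\dots\}$, $\mathbb{N}_0=\{0,1,2,\dots\}$. Let $N\in\mathbb{N}$, $n\in\{1,\dots,N\}$, $m_1,\dots,m_N\in\mathbb{N}$, $r_1,\dots,r_N>0$, $s_1,\dots,s_n>0$. For $\nu=1,\dots,N$, $\boldsymbol{p}_\nu=(p_{i,\nu})_{i=1}^{m_\nu}\in D_{m_\nu}=\{(q_1,\dots,q_{m_\nu}) : q_i>0\ \forall i,\ \sum_iq_i<1\}$ and $p_{0,\nu}=1-\sum_{i=1}^{m_\nu}p_{i,\nu}$; $\boldsymbol{p}=(\boldsymbol{p}_\nu)_{\nu=1}^N\in D=D_{m_1}\times\dots\times D_{m_N}$. For $r>0$, the negative multinomial distribution with parameters $(r,\boldsymbol{p}_\nu)$ has mass function $$\frac{\Gamma(r+\sum_{i=1}^{m_\nu}x_i)}{\Gamma(r)\prod_{i=1}^{m_\nu}x_i!}\,p_{0,\nu}^{r}\prod_{i=1}^{m_\nu}p_{i,\nu}^{x_i},\qquad(x_i)_{i=1}^{m_\nu}\in\mathbb{N}_0^{m_\nu}.$$ $\boldsymbol{X}=(\boldsymbol{X}_\nu)_{\nu=1}^N$ is observed, with $\boldsymbol{X}_\nu$ independent negative multinomial with parameters $(r_\nu,\boldsymbol{p}_\nu)$. $\boldsymbol{Y}=(\boldsymbol{Y}_\nu)_{\nu=1}^n$ is to be predicted, with $\boldsymbol{Y}_\nu$ independent negative multinomial with parameters $(s_\nu,\boldsymbol{p}_\nu)$, independent of $\boldsymbol{X}$; $g(\boldsymbol{y}|\boldsymbol{p})$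 denotes the joint mass function of $\boldsymbol{Y}$. For a prior density $\pi$ (with the posterior given $\boldsymbol{X}=\boldsymbol{x}$ well defined, i.e. $0<\int_D\pi(\boldsymbol{p})\prod_{\nu=1}^N(p_{0,\nu}^{r_\nu}\prod_ip_{i,\nu}^{x_{i,\nu}})\,d\boldsymbol{p}<\infty$ for all $\boldsymbol{x}$), the Bayesian predictive mass is the posterior expectation $\hat g^{(\pi)}(\boldsymbol{y};\boldsymbol{X})=E_\pi[g(\boldsymbol{y}|\boldsymbol{p})|\boldsymbol{X}]$, and its risk is $R(\boldsymbol{p},\hat g^{(\pi)})=E[\log\{g(\boldsymbol{Y}|\boldsymbol{p})/\hat g^{(\pi)}(\boldsymbol{Y};\boldsymbol{X})\}]$, the expectation being taken over $(\boldsymbol{X},\boldsymbol{Y})$ given $\boldsymbol{p}$. $t_1,\dots,t_N\colon[0,1]\to(0,\infty)$ are smooth nondecreasing functions with $t_\nu(0)=r_\nu$ for all $\nu$, $t_\nu(1)=r_\nu+s_\nu$ if $\nu\le n$, and $t_\nu(1)=r_\nu$ if $\nu\ge n+1$. For each $\tau\in[0,1]$, $\boldsymbol{Z}(\tau)=(\boldsymbol{Z}_\nu(\tau))_{\nu=1}^N$, where $\boldsymbol{Z}_\nu(\tau)$, $\nu=1,\dots,N$, are independent negative multinomial with parameters $(t_\nu(\tau),\boldsymbol{p}_\nu)$. $E_\pi[\,\cdot\,|\boldsymbol{Z}(\tau)]$ denotes posterior expectation of a function of the parameter under prior $\pi$ given the observation $\boldsymbol{Z}(\tau)$; the outer $E$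 is over $\boldsymbol{Z}(\tau)$ given the true $\boldsymbol{p}$. $\mathcal{W}_{\nu,k}=\{(w_i)_{i=1}^{m_\nu}\in\mathbb{N}_0^{m_\nu} : \sum_{i=1}^{m_\nu}w_i=k\}$. $L^{\rm KL}(\tilde d,\theta)=\tilde d-\theta-\theta\log(\tilde d/\theta)$ for $\tilde d,\theta\in(0,\infty)$. *)

theory Defs
  imports "HOL-Probability.Probability"
begin

(* Coordinates are indexed from 1, as in {1..N} and {1..m \<nu>}. A real parameter is a function
   in the extensional (PiE) sense, so that it lives in a product measure space; a vector of counts
   in N_0^m is a function nat => nat that vanishes outside {1..m}, which is the convention
   of Pi_pmf. *)

section \<open>Parameters and counts\<close>

definition open_simplex :: "nat \<Rightarrow> (nat \<Rightarrow> real) set" where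
  "open_simplex m = {q \<in> {1..m} \<rightarrow>\<^sub>E UNIV. (\<forall>i\<in>{1..m}. q i > 0) \<and> (\<Sum>i=1..m. q i) < 1}"

definition param_set :: "nat \<Rightarrow> (nat \<Rightarrow> nat) \<Rightarrow> (nat \<Rightarrow> nat \<Rightarrow> real) set" where
  "param_set N m = PiE {1..N} (\<lambda>\<nu>. open_simplex (m \<nu>))"

text \<open>Lebesgue measure on \<open>\<real>\<close> to the power \<open>m 1 + \<dots> + m N\<close>, the reference measure \<open>dp\<close>.\<close>

definition param_measure :: "nat \<Rightarrow> (nat \<Rightarrow> nat) \<Rightarrow> (nat \<Rightarrow> nat \<Rightarrow> real) measure" where
  "param_measure N m = PiM {1..N} (\<lambda>\<nu>. PiM {1..m \<nu>} (\<lambda>_. lborel))"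

definition p0 :: "nat \<Rightarrow> (nat \<Rightarrow> real) \<Rightarrow> real" where
  "p0 m q = 1 - (\<Sum>i=1..m. q i)"

definition count_vectors :: "nat \<Rightarrow> (nat \<Rightarrow> nat) set" where
  "count_vectors m = {x. \<forall>i. i \<notin> {1..m} \<longrightarrow> x i = 0}"

definition \<W> :: "nat \<Rightarrow> nat \<Rightarrow> (nat \<Rightarrow> nat) set" where
  "\<W> m k = {w \<in> count_vectors m. (\<Sum>i=1..m. w i) = k}"


section \<open>The negative multinomial distribution\<close>

definition neg_multinomial_mass :: "nat \<Rightarrow> real \<Rightarrow> (nat \<Rightarrow> real) \<Rightarrow> (nat \<Rightarrow> nat) \<Rightarrow> real" where
  "neg_multinomial_mass m r q x =
     Gamma (r + real (\<Sum>i=1..m. x i)) / (Gamma r * (\<Prod>i=1..m. fact (x i)))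
       * p0 m q powr r * (\<Prod>i=1..m. q i ^ x i)"

definition neg_multinomial_pmf :: "nat \<Rightarrow> real \<Rightarrow> (nat \<Rightarrow> real) \<Rightarrow> (nat \<Rightarrow> nat) pmf" where
  "neg_multinomial_pmf m r q =
     embed_pmf (\<lambda>x. if x \<in> count_vectors m then neg_multinomial_mass m r q x else 0)"

text \<open>Joint law of \<open>K\<close> independent negative multinomial vectors with sizes \<open>a 1, \<dots>, a K\<close>.\<close>

definition neg_multinomials_pmf ::
  "nat \<Rightarrow> (nat \<Rightarrow> nat) \<Rightarrow> (nat \<Rightarrow> real) \<Rightarrow> (nat \<Rightarrow> nat \<Rightarrow> real) \<Rightarrow> (nat \<Rightarrow> nat \<Rightarrow> nat) pmf" where
  "neg_multinomials_pmf K m a p =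
     Pi_pmf {1..K} (\<lambda>_. 0) (\<lambda>\<nu>. neg_multinomial_pmf (m \<nu>) (a \<nu>) (p \<nu>))"

text \<open>
  The use of \<open>embed_pmf\<close> is justified by \<open>pmf_neg_multinomial\<close> below: for parameters in the open simplex
  and positive size, the masses sum to 1.
\<close>

lemma W_0: "\<W> 0 k = (if k = 0 then {\<lambda>_. 0} else {})"
  by (auto simp: \<W>_def count_vectors_def)

lemma W_Suc: "\<W> (Suc m) k = (\<lambda>(j, w). w(Suc m := j)) ` (SIGMA j:{..k}. \<W> m (k - j))"
proof (intro equalityI subsetI)
  fix w assume w: "w \<in> \<W> (Suc m) k"
  have s: "(\<Sum>i=1..m. (w(Suc m := 0)) i) = (\<Sum>i=1..m. w i)"
    by (intro sum.cong) auto
  have "w = (w(Suc m := 0))(Suc m := w (Suc m))"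
    by simp
  moreover have "w(Suc m := 0) \<in> \<W> m (k - w (Suc m))" "w (Suc m) \<le> k"
    using w s by (auto simp: \<W>_def count_vectors_def)
  ultimately show "w \<in> (\<lambda>(j, w). w(Suc m := j)) ` (SIGMA j:{..k}. \<W> m (k - j))"
    by (intro image_eqI[of _ _ "(w (Suc m), w(Suc m := 0))"]) auto
next
  fix v assume "v \<in> (\<lambda>(j, w). w(Suc m := j)) ` (SIGMA j:{..k}. \<W> m (k - j))"
  then obtain j w where v: "v = w(Suc m := j)" "j \<le> k" "w \<in> \<W> m (k - j)"
    by auto
  have "(\<Sum>i=1..m. (w(Suc m := j)) i) = (\<Sum>i=1..m. w i)"
    by (intro sum.cong) auto
  then show "v \<in> \<W> (Suc m) k"
    using v by (auto simp: \<W>_def count_vectors_def)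
qed

lemma inj_W_Suc: "inj_on (\<lambda>(j, w). w(Suc m := j)) (SIGMA j:{..k}. \<W> m (k - j))"
proof (rule inj_onI, clarify)
  fix j w j' w'
  assume "w \<in> \<W> m (k - j)" "w' \<in> \<W> m (k - j')" and eq: "w(Suc m := j) = w'(Suc m := j')"
  then have z: "w (Suc m) = 0" "w' (Suc m) = 0"
    by (auto simp: \<W>_def count_vectors_def)
  have "j = j'"
    using fun_cong[OF eq, of "Suc m"] by simp
  moreover have "w = w'"
  proof
    fix i show "w i = w' i"
      using fun_cong[OF eq, of i] z by (cases "i = Suc m") auto
  qed
  ultimately show "j = j' \<and> w = w'" by simp
qed

lemma finite_W: "finite (\<W> m k)"
  by (induction m arbitrary: k) (auto simp: W_0 W_Suc)

lemma multinomial_exp_form: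
  fixes q :: "nat \<Rightarrow> real"
  shows "(\<Sum>w\<in>\<W> m k. \<Prod>i=1..m. q i ^ w i / fact (w i)) = (\<Sum>i=1..m. q i) ^ k / fact k"
proof (induction m arbitrary: k)
  case 0
  show ?case by (simp add: W_0)
next
  case (Suc m)
  have p: "(\<Prod>i=1..m. q i ^ (w(Suc m := j)) i / fact ((w(Suc m := j)) i))
         = (\<Prod>i=1..m. q i ^ w i / fact (w i))" for w j
    by (intro prod.cong) auto
  have "(\<Sum>w\<in>\<W> (Suc m) k. \<Prod>i=1..Suc m. q i ^ w i / fact (w i))
      = (\<Sum>(j, w)\<in>(SIGMA j:{..k}. \<W> m (k - j)).
           (\<Prod>i=1..m. q i ^ w i / fact (w i)) * (q (Suc m) ^ j / fact j))"
    unfolding W_Suc by (subst sum.reindex[OF inj_W_Suc]) (auto intro!: sum.cong simp: p)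
  also have "\<dots> = (\<Sum>j\<le>k. (\<Sum>w\<in>\<W> m (k - j).
           (\<Prod>i=1..m. q i ^ w i / fact (w i)) * (q (Suc m) ^ j / fact j)))"
    by (subst sum.Sigma) (auto simp: finite_W)
  also have "\<dots> = (\<Sum>j\<le>k. (\<Sum>i=1..m. q i) ^ (k - j) / fact (k - j) * (q (Suc m) ^ j / fact j))"
    by (simp only: sum_distrib_right[symmetric] Suc)
  also have "\<dots> = (\<Sum>j\<le>k. of_nat (k choose j) * q (Suc m) ^ j * (\<Sum>i=1..m. q i) ^ (k - j)) / fact k"
    unfolding sum_divide_distrib
    by (intro sum.cong refl) (simp add: binomial_fact field_simps)
  also have "\<dots> = (q (Suc m) + (\<Sum>i=1..m. q i)) ^ k / fact k"
    by (simp add: binomial_ring)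
  finally show ?case by (simp add: add.commute)
qed

lemma neg_multinomial_mass_nonneg:
  assumes "r > 0" "q \<in> open_simplex m"
  shows "neg_multinomial_mass m r q x \<ge> 0"
proof -
  have "Gamma (r + real (\<Sum>i=1..m. x i)) > 0" "Gamma r > 0"
    using assms by (auto intro!: Gamma_real_pos add_pos_nonneg simp del: of_nat_sum)
  moreover have "(\<Prod>i=1..m. q i ^ x i) \<ge> 0" "(\<Prod>i=1..m. fact (x i) :: real) \<ge> 0"
    using assms(2) by (auto intro!: prod_nonneg zero_le_power simp: open_simplex_def less_imp_le)
  ultimately show ?thesis
    unfolding neg_multinomial_mass_def
    by (intro mult_nonneg_nonneg divide_nonneg_nonneg) auto
qed

lemma sum_W_neg_multinomial_mass:
  assumes "r > 0"
  shows "(\<Sum>x\<in>\<W> m k. neg_multinomial_mass m r q x)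
       = p0 m q powr r * ((- r gchoose k) * (- (\<Sum>i=1..m. q i)) ^ k)"
proof -
  have "r \<notin> \<int>\<^sub>\<le>\<^sub>0"
    using assms by (auto elim!: nonpos_Ints_cases)
  then have G: "Gamma (r + real k) / Gamma r = pochhammer r k"
    by (simp add: pochhammer_Gamma)
  have "(\<Sum>x\<in>\<W> m k. neg_multinomial_mass m r q x)
      = (\<Sum>x\<in>\<W> m k. pochhammer r k * p0 m q powr r * (\<Prod>i=1..m. q i ^ x i / fact (x i)))"
    by (intro sum.cong refl)
       (auto simp: neg_multinomial_mass_def \<W>_def G[symmetric] prod_dividef simp del: of_nat_sum)
  also have "\<dots> = pochhammer r k * p0 m q powr r * ((\<Sum>i=1..m. q i) ^ k / fact k)"
    by (simp only: sum_distrib_left[symmetric] multinomial_exp_form)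
  also have "\<dots> = p0 m q powr r * ((- r gchoose k) * (- (\<Sum>i=1..m. q i)) ^ k)"
  proof -
    have "(- r gchoose k) * (- S) ^ k = pochhammer r k * (S ^ k / fact k)" for S
    proof -
      have "(- 1) ^ k * (- S) ^ k = (- 1 * - S) ^ k"
        by (rule power_mult_distrib[symmetric])
      then have "(- 1) ^ k * (- S) ^ k = S ^ k"
        by simp
      moreover have "(- r gchoose k) * (- S) ^ k = pochhammer r k * ((- 1) ^ k * (- S) ^ k / fact k)"
        unfolding gbinomial_pochhammer by simp
      ultimately show ?thesis
        by (simp only:)
    qed
    then show ?thesis by simp
  qed
  finally show ?thesis .
qed

lemma pmf_neg_multinomial:
  assumes r: "r > 0" and q: "q \<in> open_simplex m"
  shows "pmf (neg_multinomial_pmf m r q) x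
       = (if x \<in> count_vectors m then neg_multinomial_mass m r q x else 0)"
  unfolding neg_multinomial_pmf_def
proof (rule pmf_embed_pmf)
  let ?f = "\<lambda>x. if x \<in> count_vectors m then neg_multinomial_mass m r q x else 0"
  let ?S = "\<Sum>i=1..m. q i"
  show nn: "0 \<le> ?f x" for x
    using neg_multinomial_mass_nonneg[OF r q] by simp
  have S: "0 \<le> ?S" "?S < 1"
    using q by (auto simp: open_simplex_def less_imp_le intro!: sum_nonneg)
  have "(\<lambda>k. (- r gchoose k) * (- ?S) ^ k) sums (1 + - ?S) powr (- r)"
    using S by (intro gen_binomial_real) auto
  then have "(\<lambda>k. p0 m q powr r * ((- r gchoose k) * (- ?S) ^ k))
               sums (p0 m q powr r * p0 m q powr (- r))"
    unfolding p0_def by (intro sums_mult) simp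
  moreover have "p0 m q powr r * p0 m q powr (- r) = 1"
    using S by (simp add: p0_def powr_minus)
  ultimately have sums: "(\<lambda>k. \<Sum>x\<in>\<W> m k. neg_multinomial_mass m r q x) sums 1"
    by (simp only: sum_W_neg_multinomial_mass[OF r])
  have ind: "ennreal (?f x) = (\<Sum>k. ennreal (?f x) * indicator (\<W> m k) x)" for x
  proof (cases "x \<in> count_vectors m")
    case True
    have "(\<lambda>k. ennreal (?f x) * indicator (\<W> m k) x)
        = (\<lambda>k. if k = (\<Sum>i=1..m. x i) then ennreal (?f x) else 0)"
      using True by (auto simp: \<W>_def indicator_def fun_eq_iff)
    then show ?thesis
      using sums_single[of "\<Sum>i=1..m. x i" "\<lambda>_. ennreal (?f x)"] by (simp add: sums_iff)
  qed simp
  have fin: "(\<integral>\<^sup>+x. ennreal (?f x) * indicator (\<W> m k) x \<partial>count_space UNIV)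
      = ennreal (\<Sum>x\<in>\<W> m k. neg_multinomial_mass m r q x)" for k
  proof -
    have "(\<integral>\<^sup>+x. ennreal (?f x) * indicator (\<W> m k) x \<partial>count_space UNIV)
        = (\<integral>\<^sup>+x. ennreal (?f x) \<partial>count_space (\<W> m k))"
      by (simp add: nn_integral_count_space_indicator)
    also have "\<dots> = (\<Sum>x\<in>\<W> m k. ennreal (?f x))"
      by (rule nn_integral_count_space_finite[OF finite_W])
    also have "\<dots> = (\<Sum>x\<in>\<W> m k. ennreal (neg_multinomial_mass m r q x))"
      by (intro sum.cong) (auto simp: \<W>_def)
    finally show ?thesis
      using neg_multinomial_mass_nonneg[OF r q] by (simp add: sum_ennreal)
  qed
  have "(\<integral>\<^sup>+x. ennreal (?f x) \<partial>count_space UNIV)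
      = (\<Sum>k. \<integral>\<^sup>+x. ennreal (?f x) * indicator (\<W> m k) x \<partial>count_space UNIV)"
    by (subst ind, subst nn_integral_suminf) auto
  also have "\<dots> = ennreal 1"
    unfolding fin using sums neg_multinomial_mass_nonneg[OF r q]
    by (subst suminf_ennreal2) (auto simp: sums_iff intro!: sum_nonneg)
  finally show "(\<integral>\<^sup>+x. ennreal (?f x) \<partial>count_space UNIV) = 1"
    by simp
qed


section \<open>Bayesian prediction\<close>

text \<open>
  Posterior expectation of \<open>h\<close> under the (possibly improper) prior density, when \<open>z\<close> is observed
  from the product of \<open>N\<close> negative multinomial laws with sizes \<open>a\<close>.
\<close>

definition posterior_expectation ::
  "nat \<Rightarrow> (nat \<Rightarrow> nat) \<Rightarrow> ((nat \<Rightarrow> nat \<Rightarrow> real) \<Rightarrow> real) \<Rightarrow> (nat \<Rightarrow> real) \<Rightarrow> (nat \<Rightarrow> nat \<Rightarrow> nat)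
     \<Rightarrow> ((nat \<Rightarrow> nat \<Rightarrow> real) \<Rightarrow> real) \<Rightarrow> real" where
  "posterior_expectation N m prior a z h =
     (LINT p:param_set N m|param_measure N m. h p * (prior p * pmf (neg_multinomials_pmf N m a p) z))
     / (LINT p:param_set N m|param_measure N m. prior p * pmf (neg_multinomials_pmf N m a p) z)"

definition predictive_mass ::
  "nat \<Rightarrow> nat \<Rightarrow> (nat \<Rightarrow> nat) \<Rightarrow> ((nat \<Rightarrow> nat \<Rightarrow> real) \<Rightarrow> real) \<Rightarrow> (nat \<Rightarrow> real) \<Rightarrow> (nat \<Rightarrow> real)
     \<Rightarrow> (nat \<Rightarrow> nat \<Rightarrow> nat) \<Rightarrow> (nat \<Rightarrow> nat \<Rightarrow> nat) \<Rightarrow> real" where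
  "predictive_mass N n m prior r s y x =
     posterior_expectation N m prior r x (\<lambda>p. pmf (neg_multinomials_pmf n m s p) y)"

definition XY_pmf ::
  "nat \<Rightarrow> nat \<Rightarrow> (nat \<Rightarrow> nat) \<Rightarrow> (nat \<Rightarrow> real) \<Rightarrow> (nat \<Rightarrow> real) \<Rightarrow> (nat \<Rightarrow> nat \<Rightarrow> real)
     \<Rightarrow> ((nat \<Rightarrow> nat \<Rightarrow> nat) \<times> (nat \<Rightarrow> nat \<Rightarrow> nat)) pmf" where
  "XY_pmf N n m r s p = pair_pmf (neg_multinomials_pmf N m r p) (neg_multinomials_pmf n m s p)"

definition log_ratio ::
  "nat \<Rightarrow> nat \<Rightarrow> (nat \<Rightarrow> nat) \<Rightarrow> ((nat \<Rightarrow> nat \<Rightarrow> real) \<Rightarrow> real) \<Rightarrow> (nat \<Rightarrow> real) \<Rightarrow> (nat \<Rightarrow> real)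
     \<Rightarrow> (nat \<Rightarrow> nat \<Rightarrow> real) \<Rightarrow> (nat \<Rightarrow> nat \<Rightarrow> nat) \<times> (nat \<Rightarrow> nat \<Rightarrow> nat) \<Rightarrow> real" where
  "log_ratio N n m prior r s p =
     (\<lambda>(x, y). ln (pmf (neg_multinomials_pmf n m s p) y / predictive_mass N n m prior r s y x))"

definition risk ::
  "nat \<Rightarrow> nat \<Rightarrow> (nat \<Rightarrow> nat) \<Rightarrow> ((nat \<Rightarrow> nat \<Rightarrow> real) \<Rightarrow> real) \<Rightarrow> (nat \<Rightarrow> real) \<Rightarrow> (nat \<Rightarrow> real)
     \<Rightarrow> (nat \<Rightarrow> nat \<Rightarrow> real) \<Rightarrow> real" where
  "risk N n m prior r s p =
     measure_pmf.expectation (XY_pmf N n m r s p) (log_ratio N n m prior r s p)"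

text \<open>
  Nonnegative on \<open>(0, \<infinity>)\<^sup>2\<close>, so that an expected loss can be taken as a nonnegative integral
  of \<open>ennreal (L_KL d \<theta>)\<close>, without any integrability side condition.
\<close>

definition L_KL :: "real \<Rightarrow> real \<Rightarrow> real" where
  "L_KL d \<theta> = d - \<theta> - \<theta> * ln (d / \<theta>)"


section \<open>Smooth functions on an interval\<close>

text \<open>Derivative relative to \<open>S\<close>: one-sided at the end points of an interval.\<close>

definition deriv_within :: "real set \<Rightarrow> (real \<Rightarrow> real) \<Rightarrow> real \<Rightarrow> real" where
  "deriv_within S f \<tau> = vector_derivative f (at \<tau> within S)"

definition smooth_on :: "real set \<Rightarrow> (real \<Rightarrow> real) \<Rightarrow> bool" where
  "smooth_on S f \<longleftrightarrow> (\<forall>k. (deriv_within S ^^ k) f differentiable_on S)"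

end

theory Submission
  imports Defs "HOL-Library.Function_Algebras"
begin

text \<open>
  For a prior density \<open>\<pi>\<close> write \<open>\<Psi>\<^sub>\<tau>(z)\<close> for the integral of \<open>\<pi>\<close> against the parameter-dependent part
  \<open>\<Prod>\<^sub>\<nu> p\<^sub>0\<^sub>,\<^sub>\<nu>\<^bsup>t\<^sub>\<nu>(\<tau>)\<^esup> p\<^sub>\<nu>\<^bsup>z\<^sub>\<nu>\<^esup>\<close> of the likelihood of \<open>Z(\<tau>) = z\<close>. The remaining factors of the likelihood are
  free of the parameter, so everything in sight is a ratio of such integrals: the posterior
  expectation of \<open>p\<^sub>\<nu>\<^bsup>w\<^esup>\<close> given \<open>Z(\<tau>) = z\<close> is \<open>\<Psi>\<^sub>\<tau>(z + w) / \<Psi>\<^sub>\<tau>(z)\<close>, where \<open>w\<close> is added in block \<open>\<nu>\<close>,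
  and \<open>g(y|p)\<close> divided by the predictive mass is
  \<open>\<Prod>\<^sub>\<nu> p\<^sub>0\<^sub>,\<^sub>\<nu>\<^bsup>s\<^sub>\<nu>\<^esup> p\<^sub>\<nu>\<^bsup>y\<^sub>\<nu>\<^esup> \<Psi>\<^sub>0(x) / \<Psi>\<^sub>1(x + y)\<close>. Since \<open>X + Y\<close> has the law of \<open>Z(1)\<close>
  (\<open>neg_multinomials_convolution\<close>), the risk is the increment from \<open>\<tau> = 0\<close> to \<open>\<tau> = 1\<close> of the expectation
  of \<open>- ln \<Psi>\<^sub>\<tau>(Z(\<tau>))\<close>, corrected by the expectation of an affine function of \<open>Y\<close>.

  The increment is computed by regarding a negative multinomial vector of size \<open>a\<close> as the value at
  time \<open>a\<close> of a compound Poisson process, which jumps by \<open>w \<noteq> 0\<close> at rate \<open>c(w) p\<^bsup>w\<^esup>\<close> with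
  \<open>c(w) = (|w| - 1)! / \<Prod>\<^sub>i w\<^sub>i!\<close>; the total rate is \<open>- ln p\<^sub>0\<close> (\<open>levy_total_mass\<close>). Along the path the
  expectation changes for two reasons. The function changes: as \<open>- ln q\<^sub>0\<close> is the sum of \<open>c(w) q\<^bsup>w\<^esup>\<close>
  also for the parameter \<open>q\<close> averaged by the posterior, this contributes the sum of \<open>c(w)\<close> times the
  expectation of \<open>d = \<Psi>\<^sub>\<tau>(Z + w) / \<Psi>\<^sub>\<tau>(Z)\<close>. And the process jumps: this contributes the sum of
  \<open>- c(w) \<theta> ln d\<close> with \<open>\<theta> = p\<^bsup>w\<^esup>\<close>. But \<open>d - \<theta> ln d\<close> is the Kullback--Leibler loss \<open>L(d, \<theta>)\<close> plus
  \<open>\<theta> - \<theta> ln \<theta>\<close>, and the sum of \<open>c(w) (\<theta> - \<theta> ln \<theta>)\<close> is exactly what the affine function of \<open>Y\<close>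
  accounts for. The weight \<open>c(w)\<close> equals \<open>1/k\<close> times the multinomial coefficient for \<open>|w| = k\<close>, which
  is the weight in the theorem.

  All interchanges of sums, integrals and expectations are done with nonnegative terms. To this end
  \<open>log_marginal\<close> is \<open>- ln (\<Psi>\<^sub>\<tau>(z) / \<Psi>\<^sub>0(0)) \<ge> 0\<close>, and both Dynkin's formula (\<open>dynkin\<close>) and the balance
  above (\<open>loss_balance\<close>) are written with nonnegative terms on either side; only the finite outflow
  term common to the two is cancelled (\<open>posterior_loss_integral\<close>). Finiteness comes from a linear
  bound in the total count (\<open>log_marginal_upper_bound\<close>). The one delicate point is differentiating
  \<open>\<Psi>\<^sub>\<tau>\<close>: the prior is only known to integrate \<open>\<Prod>\<^sub>\<nu> p\<^sub>0\<^sub>,\<^sub>\<nu>\<^bsup>r\<^sub>\<nu>\<^esup>\<close>, so \<open>ln p\<^sub>0\<^sub>,\<^sub>\<nu>\<close> is controlled only at times when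
  \<open>t\<^sub>\<nu>(\<tau>) > r\<^sub>\<nu>\<close>. This excludes at most one time per block, because a block at which \<open>t\<^sub>\<nu>\<close> is still
  locally constant does not contribute.
\<close>

section \<open>Vectors of counts\<close>

lemma count_vectors_downward_closed:
  assumes "x \<in> count_vectors m" "w \<le> x"
  shows "w \<in> count_vectors m"
  unfolding count_vectors_def
proof (intro CollectI allI impI)
  fix i assume "i \<notin> {1..m}"
  then have "x i = 0"
    using assms(1) by (auto simp: count_vectors_def)
  then show "w i = 0"
    using le_funD[OF assms(2), of i] by simp
qed

lemma zero_count_vectors [simp]: "0 \<in> count_vectors m"
  by (simp add: count_vectors_def)

lemma count_vectors_add:
  "x \<in> count_vectors m \<Longrightarrow> w \<in> count_vectors m \<Longrightarrow> x + w \<in> count_vectors m"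
  by (simp add: count_vectors_def)

lemma atMost_fun_upd:
  fixes x :: "nat \<Rightarrow> nat"
  shows "{..x} = (\<lambda>(j, w). w(k := j)) ` ({..x k} \<times> {..x(k := 0)})"
proof (intro equalityI subsetI)
  fix w assume "w \<in> {..x}"
  then show "w \<in> (\<lambda>(j, w). w(k := j)) ` ({..x k} \<times> {..x(k := 0)})"
    by (intro image_eqI[of _ _ "(w k, w(k := 0))"]) (auto simp: le_fun_def)
next
  fix w assume "w \<in> (\<lambda>(j, w). w(k := j)) ` ({..x k} \<times> {..x(k := 0)})"
  then obtain j v where "w = v(k := j)" "j \<le> x k" and v: "v \<le> x(k := 0)"
    by auto
  moreover have "v i \<le> x i" if "i \<noteq> k" for i
    using le_funD[OF v, of i] that by simp
  ultimately show "w \<in> {..x}"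
    by (auto simp: le_fun_def)
qed

lemma inj_on_atMost_fun_upd:
  fixes x :: "nat \<Rightarrow> nat"
  shows "inj_on (\<lambda>(j, w). w(k := j)) ({..x k} \<times> {..x(k := 0)})"
proof (rule inj_onI, clarify)
  fix j j' :: nat and w w' :: "nat \<Rightarrow> nat"
  assume w: "w \<le> x(k := 0)" "w' \<le> x(k := 0)" and eq: "w(k := j) = w'(k := j')"
  have "w k = 0" "w' k = 0"
    using w by (auto simp: le_fun_def dest!: spec[of _ k])
  with eq show "j = j' \<and> w = w'"
    by (metis fun_upd_same fun_upd_triv fun_upd_upd)
qed

lemma finite_atMost_count_vector:
  assumes "x \<in> count_vectors m"
  shows "finite {..x}"
  using assms
proof (induction m arbitrary: x)
  case 0
  then have "{..x} = {x}" by (auto simp: count_vectors_def le_fun_def fun_eq_iff)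
  then show ?case by simp
next
  case (Suc m)
  have "x(Suc m := 0) \<in> count_vectors m"
    using Suc.prems by (auto simp: count_vectors_def)
  from Suc.IH[OF this] show ?case
    by (subst atMost_fun_upd[of x "Suc m"]) (intro finite_imageI finite_cartesian_product finite_atMost)
qed

lemma countable_count_vectors: "countable (count_vectors m)"
proof -
  have "count_vectors m = (\<Union>k. \<W> m k)" by (auto simp: \<W>_def)
  then show ?thesis by (simp add: countable_finite finite_W)
qed

definition deg :: "nat \<Rightarrow> (nat \<Rightarrow> nat) \<Rightarrow> nat" where
  "deg m x = (\<Sum>i=1..m. x i)"

lemma deg_add: "deg m (x + y) = deg m x + deg m y"
  by (simp add: deg_def sum.distrib)

lemma deg_zero [simp]: "deg m 0 = 0"
  by (simp add: deg_def)

lemma deg_diff: "w \<le> x \<Longrightarrow> deg m (x - w) = deg m x - deg m w"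
  by (simp add: deg_def le_fun_def sum_subtractf_nat)

lemma deg_mono: "w \<le> x \<Longrightarrow> deg m w \<le> deg m x"
  by (simp add: deg_def le_fun_def sum_mono)

lemma deg_pos_iff: "w \<in> count_vectors m \<Longrightarrow> deg m w > 0 \<longleftrightarrow> w \<noteq> 0"
proof -
  assume w: "w \<in> count_vectors m"
  have "deg m w = 0 \<longleftrightarrow> (\<forall>i\<in>{1..m}. w i = 0)"
    by (simp add: deg_def)
  also have "\<dots> \<longleftrightarrow> (\<forall>i. w i = 0)"
    using w unfolding count_vectors_def by blast
  finally show ?thesis
    unfolding neq0_conv[symmetric] by (simp add: fun_eq_iff del: neq0_conv)
qed

section \<open>Negative multinomial coefficients and jump rates\<close>

text \<open>
  The Chu--Vandermonde identity in several variables. Splitting off one variable reduces it to the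
  one-variable identity, because \<open>(a)\<^sub>k\<^sub>+\<^sub>l = (a)\<^sub>k (a + k)\<^sub>l\<close>.
\<close>

lemma pochhammer_add_count_vectors:
  fixes a b :: real
  assumes "x \<in> count_vectors m"
  shows "pochhammer (a + b) (deg m x)
       = (\<Sum>w\<in>{..x}. (\<Prod>i=1..m. real (x i choose w i))
            * (pochhammer a (deg m (x - w)) * pochhammer b (deg m w)))"
  using assms
proof (induction m arbitrary: x)
  case 0
  then have "{..x} = {x}" by (auto simp: count_vectors_def le_fun_def fun_eq_iff)
  then show ?case by (simp add: deg_def)
next
  case (Suc m)
  let ?k = "x (Suc m)" and ?x = "x(Suc m := 0)"
  have x': "?x \<in> count_vectors m"
    using Suc.prems by (auto simp: count_vectors_def)
  have d: "deg (Suc m) (w(Suc m := j)) = deg m w + j" for w j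
    by (simp add: deg_def)
  have dd: "deg (Suc m) (x - w(Suc m := j)) = deg m (?x - w) + (?k - j)" for w j
    by (simp add: deg_def)
  have pr: "(\<Prod>i=1..Suc m. real (x i choose (w(Suc m := j)) i))
     = (\<Prod>i=1..m. real (?x i choose w i)) * real (?k choose j)" for w j
    by simp
  have dm: "deg (Suc m) x = deg m ?x + ?k" by (simp add: deg_def)
  have "(\<Sum>w\<in>{..x}. (\<Prod>i=1..Suc m. real (x i choose w i))
            * (pochhammer a (deg (Suc m) (x - w)) * pochhammer b (deg (Suc m) w)))
      = (\<Sum>(j, w)\<in>{..?k} \<times> {..?x}. (\<Prod>i=1..m. real (?x i choose w i)) * real (?k choose j)
            * (pochhammer a (deg m (?x - w) + (?k - j)) * pochhammer b (deg m w + j)))"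
    unfolding atMost_fun_upd[of x "Suc m"]
    by (subst sum.reindex[OF inj_on_atMost_fun_upd])
       (intro sum.cong refl, clarify, simp only: o_def prod.case d dd pr)
  also have "\<dots> = (\<Sum>w\<in>{..?x}. \<Sum>j\<le>?k. (\<Prod>i=1..m. real (?x i choose w i)) * real (?k choose j)
            * (pochhammer a (deg m (?x - w) + (?k - j)) * pochhammer b (deg m w + j)))"
    by (subst sum.cartesian_product[symmetric], rule sum.swap)
  also have "\<dots> = (\<Sum>w\<in>{..?x}. (\<Prod>i=1..m. real (?x i choose w i))
            * (pochhammer a (deg m (?x - w)) * pochhammer b (deg m w))
            * pochhammer (a + b + of_nat (deg m ?x)) ?k)"
  proof (intro sum.cong refl)
    fix w assume w: "w \<in> {..?x}"
    have "deg m (?x - w) + deg m w = deg m ?x"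
      using w by (simp add: deg_diff deg_mono del: fun_upd_apply)
    then have e: "a + b + of_nat (deg m ?x) = (b + of_nat (deg m w)) + (a + of_nat (deg m (?x - w)))"
      by (simp flip: of_nat_add)
    show "(\<Sum>j\<le>?k. (\<Prod>i=1..m. real (?x i choose w i)) * real (?k choose j)
            * (pochhammer a (deg m (?x - w) + (?k - j)) * pochhammer b (deg m w + j)))
        = (\<Prod>i=1..m. real (?x i choose w i))
            * (pochhammer a (deg m (?x - w)) * pochhammer b (deg m w))
            * pochhammer (a + b + of_nat (deg m ?x)) ?k"
      unfolding e pochhammer_binomial_sum[of "b + of_nat (deg m w)"] pochhammer_product' sum_distrib_left
      by (intro sum.cong refl) (simp only: ac_simps)
  qed
  also have "\<dots> = pochhammer (a + b) (deg m ?x) * pochhammer (a + b + of_nat (deg m ?x)) ?k"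
    by (subst Suc.IH[OF x']) (simp add: sum_distrib_right)
  also have "\<dots> = pochhammer (a + b) (deg (Suc m) x)"
    unfolding dm pochhammer_product' ..
  finally show ?case ..
qed

definition nm_coeff :: "nat \<Rightarrow> real \<Rightarrow> (nat \<Rightarrow> nat) \<Rightarrow> real" where
  "nm_coeff m a x = pochhammer a (deg m x) / (\<Prod>i=1..m. fact (x i))"

text \<open>
  The factor \<open>c(w)\<close> of the jump rate \<open>c(w) q\<^bsup>w\<^esup>\<close>. Without the separate case, truncated subtraction would
  give the value 1 at \<open>w = 0\<close>, where there is no jump.
\<close>

definition levy_coeff :: "nat \<Rightarrow> (nat \<Rightarrow> nat) \<Rightarrow> real" where
  "levy_coeff m w = (if w = 0 then 0 else fact (deg m w - 1) / (\<Prod>i=1..m. fact (w i)))"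

definition mpow :: "nat \<Rightarrow> (nat \<Rightarrow> real) \<Rightarrow> (nat \<Rightarrow> nat) \<Rightarrow> real" where
  "mpow m q x = (\<Prod>i=1..m. q i ^ x i)"

lemma mpow_add: "mpow m q (x + w) = mpow m q x * mpow m q w"
  by (simp add: mpow_def power_add prod.distrib)

lemma mpow_0 [simp]: "mpow m q 0 = 1"
  by (simp add: mpow_def)

lemma le_imp_diff_add: "w \<le> x \<Longrightarrow> (x - w) + w = (x::nat \<Rightarrow> nat)"
  by (auto simp: le_fun_def fun_eq_iff)

lemma nm_coeff_zero [simp]: "nm_coeff m a 0 = 1"
  by (simp add: nm_coeff_def)

text \<open>
  The convolution property of negative multinomial laws, freed of the powers of the parameter. It holds
  for all real sizes, so it can be differentiated at size 0.
\<close>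

lemma nm_coeff_add:
  assumes "x \<in> count_vectors m"
  shows "nm_coeff m (a + b) x = (\<Sum>w\<in>{..x}. nm_coeff m a (x - w) * nm_coeff m b w)"
proof -
  have f: "(\<Prod>i=1..m. real (x i choose w i)) / (\<Prod>i=1..m. fact (x i))
      = 1 / (\<Prod>i=1..m. fact ((x - w) i)) * (1 / (\<Prod>i=1..m. fact (w i)))" if "w \<le> x" for w
  proof -
    have "(\<Prod>i=1..m. real (x i choose w i)) / (\<Prod>i=1..m. fact (x i))
        = (\<Prod>i=1..m. 1 / fact ((x - w) i) * (1 / fact (w i)))"
      unfolding prod_dividef[symmetric]
      using that by (intro prod.cong refl) (simp add: binomial_fact le_fun_def)
    then show ?thesis
      by (simp add: prod.distrib prod_dividef)
  qed
  show ?thesis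
    unfolding nm_coeff_def pochhammer_add_count_vectors[OF assms] sum_divide_distrib
  proof (intro sum.cong refl)
    fix w assume "w \<in> {..x}"
    then have w: "w \<le> x" by simp
    have "(\<Prod>i=1..m. real (x i choose w i)) * (pochhammer a (deg m (x - w)) * pochhammer b (deg m w)) / (\<Prod>i=1..m. fact (x i))
      = ((\<Prod>i=1..m. real (x i choose w i)) / (\<Prod>i=1..m. fact (x i))) * (pochhammer a (deg m (x - w)) * pochhammer b (deg m w))"
      by simp
    also have "\<dots> = pochhammer a (deg m (x - w)) / (\<Prod>i=1..m. fact ((x - w) i)) *
         (pochhammer b (deg m w) / (\<Prod>i=1..m. fact (w i)))"
      unfolding f[OF w] by simp
    finally show "(\<Prod>i=1..m. real (x i choose w i)) * (pochhammer a (deg m (x - w)) * pochhammer b (deg m w)) / (\<Prod>i=1..m. fact (x i))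
       = pochhammer a (deg m (x - w)) / (\<Prod>i=1..m. fact ((x - w) i)) *
         (pochhammer b (deg m w) / (\<Prod>i=1..m. fact (w i)))" .
  qed
qed

text \<open>
  As \<open>(h)\<^sub>k = h (1 + h) \<dots> (k - 1 + h)\<close> vanishes to first order at \<open>h = 0\<close> for \<open>k > 0\<close>, the coefficient
  \<open>c(w)\<close> is the rate at which a negative multinomial vector of vanishing size leaves 0 towards \<open>w\<close>.
\<close>

lemma nm_coeff_has_derivative_at_0:
  assumes "w \<in> count_vectors m"
  shows "((\<lambda>h. nm_coeff m h w) has_real_derivative levy_coeff m w) (at 0)"
proof (cases "w = 0")
  case True
  then show ?thesis by (simp add: levy_coeff_def)
next
  case False
  then obtain k where k: "deg m w = Suc k"
    using deg_pos_iff[OF assms] by (metis gr0_implies_Suc)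
  let ?P = "\<Prod>i=1..m. fact (w i) :: real"
  have P: "?P \<noteq> 0" by simp
  have "((\<lambda>h. pochhammer (h + 1) k) has_real_derivative D) (at 0) \<Longrightarrow>
        ((\<lambda>h. h * pochhammer (h + 1) k / ?P) has_real_derivative fact k / ?P) (at (0::real))" for D
    using P by (auto intro!: derivative_eq_intros simp: pochhammer_fact simp del: prod_zero_iff)
  moreover have "\<exists>D. ((\<lambda>h::real. pochhammer (h + 1) k) has_real_derivative D) (at 0)"
    unfolding pochhammer_prod
    by (rule exI, rule has_field_derivative_prod) (auto intro!: derivative_eq_intros)
  ultimately show ?thesis
    using False k by (auto simp: nm_coeff_def levy_coeff_def pochhammer_rec)
qed

text \<open>
  The convolution property with a second summand of size \<open>h\<close>, differentiated at \<open>h = 0\<close>.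
\<close>

lemma nm_coeff_has_derivative:
  assumes x: "x \<in> count_vectors m"
  shows "((\<lambda>a. nm_coeff m a x) has_real_derivative
           (\<Sum>w\<in>{..x}. nm_coeff m a (x - w) * levy_coeff m w)) (at a)"
proof -
  have "((\<lambda>h. \<Sum>w\<in>{..x}. nm_coeff m a (x - w) * nm_coeff m h w) has_real_derivative
           (\<Sum>w\<in>{..x}. nm_coeff m a (x - w) * levy_coeff m w)) (at 0)"
    using x by (intro DERIV_sum DERIV_cmult nm_coeff_has_derivative_at_0)
      (auto dest: count_vectors_downward_closed)
  then have "((\<lambda>h. nm_coeff m (a + h) x) has_real_derivative
           (\<Sum>w\<in>{..x}. nm_coeff m a (x - w) * levy_coeff m w)) (at 0)"
    by (simp only: nm_coeff_add[OF x])
  then show ?thesis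
    using DERIV_shift[of "\<lambda>a. nm_coeff m a x" _ 0 a] by (simp add: add.commute)
qed

lemma levy_coeff_nonneg: "levy_coeff m w \<ge> 0"
  by (auto simp: levy_coeff_def intro!: divide_nonneg_nonneg prod_nonneg)

lemma nm_coeff_pos: "a > 0 \<Longrightarrow> nm_coeff m a x > 0"
  by (auto simp: nm_coeff_def intro!: divide_pos_pos prod_pos pochhammer_pos)

lemma neg_multinomial_mass_eq:
  assumes "a > 0"
  shows "neg_multinomial_mass m a q x = nm_coeff m a x * p0 m q powr a * mpow m q x"
proof -
  have "a \<notin> \<int>\<^sub>\<le>\<^sub>0"
    using assms by (auto elim!: nonpos_Ints_cases)
  then show ?thesis
    unfolding neg_multinomial_mass_def nm_coeff_def mpow_def deg_def
    by (simp add: pochhammer_Gamma field_simps del: of_nat_sum)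
qed

section \<open>Logarithmic series and means\<close>

lemma nn_integral_count_vectors_by_degree:
  "(\<integral>\<^sup>+x. F x \<partial>count_space (count_vectors m)) = (\<Sum>k. \<Sum>x\<in>\<W> m k. F x)"
proof -
  let ?W = "count_space (count_vectors m)"
  have ind: "F x = (\<Sum>k. F x * indicator (\<W> m k) x)" if "x \<in> count_vectors m" for x
  proof -
    have "(\<lambda>k. F x * indicator (\<W> m k) x) = (\<lambda>k. if k = deg m x then F x else 0)"
      using that by (auto simp: \<W>_def deg_def indicator_def fun_eq_iff)
    then show ?thesis
      using sums_single[of "deg m x" "\<lambda>_. F x"] by (simp add: sums_iff)
  qed
  have W: "\<W> m k \<subseteq> count_vectors m" for k
    by (auto simp: \<W>_def)
  have "(\<integral>\<^sup>+x. F x \<partial>?W)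
      = (\<integral>\<^sup>+x. (\<Sum>k. F x * indicator (\<W> m k) x) \<partial>?W)"
    by (intro nn_integral_cong ind) simp
  also have "\<dots> = (\<Sum>k. \<integral>\<^sup>+x. F x * indicator (\<W> m k) x \<partial>?W)"
    by (rule nn_integral_suminf) simp
  also have "\<dots> = (\<Sum>k. \<Sum>x\<in>\<W> m k. F x)"
  proof (intro suminf_cong)
    fix k
    have "(\<integral>\<^sup>+x. F x * indicator (\<W> m k) x \<partial>?W)
        = (\<Sum>x\<in>\<W> m k. F x * indicator (\<W> m k) x)"
      by (intro nn_integral_count_space' finite_W W) (auto simp: indicator_def)
    then show "(\<integral>\<^sup>+x. F x * indicator (\<W> m k) x \<partial>?W) = (\<Sum>x\<in>\<W> m k. F x)"
      by simp
  qed
  finally show ?thesis .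
qed

lemma W_zero: "\<W> m 0 = {0}"
proof -
  have "\<W> m 0 = {w \<in> count_vectors m. deg m w = 0}"
    by (auto simp: \<W>_def deg_def)
  also have "\<dots> = {0}"
    using deg_pos_iff[of _ m] by force
  finally show ?thesis .
qed

text \<open>
  This identifies the weights \<open>1/k\<close> times a multinomial coefficient with the jump rates.
\<close>

lemma nn_integral_levy:
  "(\<integral>\<^sup>+w. ennreal (levy_coeff m w) * F w \<partial>count_space (count_vectors m))
   = (\<Sum>k. ennreal (1 / real (Suc k)) *
        (\<Sum>w\<in>\<W> m (Suc k). ennreal (fact (Suc k) / (\<Prod>i=1..m. fact (w i))) * F w))"
proof -
  let ?g = "\<lambda>k. \<Sum>w\<in>\<W> m k. ennreal (levy_coeff m w) * F w"
  have "?g (Suc k) = ennreal (1 / real (Suc k)) *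
        (\<Sum>w\<in>\<W> m (Suc k). ennreal (fact (Suc k) / (\<Prod>i=1..m. fact (w i))) * F w)" for k
    unfolding sum_distrib_left mult.assoc[symmetric]
  proof (intro sum.cong refl arg_cong2[where f="(*)"])
    fix w assume w: "w \<in> \<W> m (Suc k)"
    have "w \<noteq> 0" "deg m w = Suc k"
      using w by (auto simp: \<W>_def deg_def)
    then have "levy_coeff m w = 1 / real (Suc k) * (fact (Suc k) / (\<Prod>i=1..m. fact (w i)))"
      by (simp add: levy_coeff_def del: of_nat_Suc)
    then show "ennreal (levy_coeff m w)
        = ennreal (1 / real (Suc k)) * ennreal (fact (Suc k) / (\<Prod>i=1..m. fact (w i)))"
      by (simp only:) (intro ennreal_mult divide_nonneg_nonneg prod_nonneg, auto)
  qed
  moreover have "?g sums ((\<Sum>k. ?g (Suc k)) + ?g 0)"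
    by (intro sums_Suc summable_sums summableI)
  moreover have "?g 0 = 0"
    by (simp add: W_zero levy_coeff_def)
  ultimately show ?thesis
    unfolding nn_integral_count_vectors_by_degree by (simp add: sums_iff)
qed

lemma open_simplex_bounds:
  assumes "q \<in> open_simplex m"
  shows "0 < p0 m q" "p0 m q \<le> 1" "\<And>i. i \<in> {1..m} \<Longrightarrow> 0 < q i" "\<And>i. i \<in> {1..m} \<Longrightarrow> q i \<le> 1"
proof -
  have q: "\<And>i. i \<in> {1..m} \<Longrightarrow> 0 < q i" "sum q {1..m} < 1"
    using assms by (auto simp: open_simplex_def)
  then show "0 < p0 m q" "\<And>i. i \<in> {1..m} \<Longrightarrow> 0 < q i"
    by (auto simp: p0_def)
  show "p0 m q \<le> 1"
    using sum_nonneg[of "{1..m}" q] q(1) by (simp add: p0_def less_imp_le)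
  show "q i \<le> 1" if "i \<in> {1..m}" for i
  proof -
    have "q i \<le> sum q {1..m}"
      using that q(1) by (intro member_le_sum) (auto intro: less_imp_le)
    with q(2) show ?thesis by simp
  qed
qed

lemma mpow_pos: "q \<in> open_simplex m \<Longrightarrow> 0 < mpow m q x"
  by (auto simp: mpow_def intro!: prod_pos zero_less_power open_simplex_bounds)

lemma mpow_le_1: "q \<in> open_simplex m \<Longrightarrow> mpow m q x \<le> 1"
  unfolding mpow_def
  by (intro prod_le_1 conjI zero_le_power power_le_one less_imp_le[OF open_simplex_bounds(3)] open_simplex_bounds(4))

text \<open>
  By the multinomial theorem the jumps of degree \<open>k\<close> have total rate \<open>S\<^sup>k / k\<close>, where \<open>S\<close> is the sum of
  the \<open>q\<^sub>i\<close>; the logarithmic series then gives \<open>- ln (1 - S)\<close>.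
\<close>

lemma levy_total_mass:
  assumes q: "q \<in> open_simplex m"
  shows "(\<integral>\<^sup>+w. ennreal (levy_coeff m w) * ennreal (mpow m q w) \<partial>count_space (count_vectors m))
       = ennreal (- ln (p0 m q))"
proof -
  let ?S = "\<Sum>i=1..m. q i"
  have S: "0 \<le> ?S" "?S < 1"
    using q by (auto simp: open_simplex_def less_imp_le intro!: sum_nonneg)
  have W: "(\<Sum>w\<in>\<W> m (Suc k). ennreal (fact (Suc k) / (\<Prod>i=1..m. fact (w i))) * ennreal (mpow m q w))
      = ennreal (?S ^ Suc k)" for k
  proof -
    have "(\<Sum>w\<in>\<W> m (Suc k). ennreal (fact (Suc k) / (\<Prod>i=1..m. fact (w i))) * ennreal (mpow m q w))
       = (\<Sum>w\<in>\<W> m (Suc k). ennreal (fact (Suc k) * (\<Prod>i=1..m. q i ^ w i / fact (w i))))"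
    proof (intro sum.cong refl)
      fix w
      have "fact (Suc k) * (\<Prod>i=1..m. q i ^ w i / fact (w i)) = fact (Suc k) / (\<Prod>i=1..m. fact (w i)) * mpow m q w"
        by (simp add: mpow_def prod_dividef del: fact_Suc)
      moreover have "0 \<le> fact (Suc k) / (\<Prod>i=1..m. fact (w i) :: real)"
        by (intro divide_nonneg_nonneg prod_nonneg) auto
      ultimately show "ennreal (fact (Suc k) / (\<Prod>i=1..m. fact (w i))) * ennreal (mpow m q w)
        = ennreal (fact (Suc k) * (\<Prod>i=1..m. q i ^ w i / fact (w i)))"
        using mpow_pos[OF q, of w] by (simp only: ennreal_mult less_imp_le)
    qed
    also have "\<dots> = ennreal (\<Sum>w\<in>\<W> m (Suc k). fact (Suc k) * (\<Prod>i=1..m. q i ^ w i / fact (w i)))"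
      using open_simplex_bounds(3)[OF q]
      by (intro sum_ennreal mult_nonneg_nonneg prod_nonneg divide_nonneg_nonneg) (auto intro: less_imp_le)
    also have "(\<Sum>w\<in>\<W> m (Suc k). fact (Suc k) * (\<Prod>i=1..m. q i ^ w i / fact (w i))) = ?S ^ Suc k"
      by (simp only: sum_distrib_left[symmetric] multinomial_exp_form) simp
    finally show ?thesis .
  qed
  have "(\<lambda>k. - ((- (- ?S)) ^ k) / of_nat k) sums ln (1 + - ?S)"
    using S by (intro ln_series') auto
  then have "(\<lambda>k. ?S ^ k / real k) sums (- ln (p0 m q))"
    using sums_minus by (fastforce simp: p0_def)
  then have s: "(\<lambda>k. ?S ^ Suc k / real (Suc k)) sums (- ln (p0 m q))"
    by (subst sums_Suc_iff) simp
  have "(\<integral>\<^sup>+w. ennreal (levy_coeff m w) * ennreal (mpow m q w) \<partial>count_space (count_vectors m))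
     = (\<Sum>k. ennreal (?S ^ Suc k / real (Suc k)))"
    unfolding nn_integral_levy W using S
    by (intro suminf_cong) (simp add: ennreal_mult[symmetric] del: of_nat_Suc power_Suc)
  also have "\<dots> = ennreal (- ln (p0 m q))"
    using s S by (subst suminf_ennreal2) (auto simp: sums_iff simp del: of_nat_Suc power_Suc)
  finally show ?thesis .
qed

definition unit_count :: "nat \<Rightarrow> nat \<Rightarrow> nat" where
  "unit_count i = (\<lambda>j. if j = i then 1 else 0)"

lemma unit_count_simps: "unit_count i i = 1" "j \<noteq> i \<Longrightarrow> unit_count i j = 0"
  by (simp_all add: unit_count_def)

lemma fact_prod_add_unit:
  assumes "i \<in> {1..m}"
  shows "(\<Prod>j=1..m. fact ((y + unit_count i) j)) = (\<Prod>j=1..m. fact (y j)) * (real (y i) + 1)"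
proof -
  have "(\<Prod>j=1..m. fact ((y + unit_count i) j)) = (\<Prod>j=1..m. fact (y j) * (if j = i then real (y i) + 1 else 1))"
    by (intro prod.cong refl) (auto simp: unit_count_def)
  then show ?thesis
    using assms by (simp add: prod.distrib)
qed

lemma deg_unit: "i \<in> {1..m} \<Longrightarrow> deg m (unit_count i) = 1"
  by (simp add: deg_def unit_count_def)

lemma mpow_unit:
  assumes "i \<in> {1..m}"
  shows "mpow m q (unit_count i) = q i"
proof -
  have "mpow m q (unit_count i) = (\<Prod>j=1..m. if j = i then q i else 1)"
    unfolding mpow_def by (intro prod.cong) (auto simp: unit_count_def)
  then show ?thesis using assms by simp
qed

lemma nm_coeff_add_unit:
  assumes i: "i \<in> {1..m}"
  shows "nm_coeff m a (y + unit_count i) * real ((y + unit_count i) i) = a * nm_coeff m (a + 1) y"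
  unfolding nm_coeff_def fact_prod_add_unit[OF i] deg_add deg_unit[OF i]
  by (simp add: pochhammer_rec unit_count_simps add.commute[of 1 "real (y i)"])

lemma levy_coeff_add_unit:
  assumes i: "i \<in> {1..m}"
  shows "levy_coeff m (y + unit_count i) * real ((y + unit_count i) i) = nm_coeff m 1 y"
proof -
  have "(y + unit_count i) i \<noteq> 0"
    by (simp add: unit_count_simps)
  then have "y + unit_count i \<noteq> 0"
    by (metis zero_fun_apply)
  then show ?thesis
    unfolding nm_coeff_def levy_coeff_def fact_prod_add_unit[OF i] deg_add deg_unit[OF i]
    by (simp add: pochhammer_fact[symmetric] unit_count_simps add.commute[of 1 "real (y i)"] fun_eq_iff)
qed

text \<open>
  Means are computed by removing one unit of coordinate \<open>i\<close>. This turns the mass of size \<open>a\<close> into the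
  mass of size \<open>a + 1\<close>, and the jump rates, which are the limiting case \<open>a = 0\<close>, into the mass of size 1.
\<close>

lemma nn_integral_times_count:
  assumes i: "i \<in> {1..m}"
  shows "(\<integral>\<^sup>+x. F x * ennreal (real (x i)) \<partial>count_space (count_vectors m))
       = (\<integral>\<^sup>+y. F (y + unit_count i) * ennreal (real ((y + unit_count i) i)) \<partial>count_space (count_vectors m))"
proof -
  have "bij_betw (\<lambda>y. y + unit_count i) (count_vectors m) {x \<in> count_vectors m. x i > 0}"
  proof (rule bij_betw_byWitness[where f' = "\<lambda>x. x - unit_count i"])
    show "\<forall>y\<in>{x \<in> count_vectors m. x i > 0}. y - unit_count i + unit_count i = y"
      by (auto simp: unit_count_def fun_eq_iff)
  qed (use i in \<open>auto simp: unit_count_def fun_eq_iff count_vectors_def\<close>)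
  from nn_integral_bij_count_space[OF this, of "\<lambda>x. F x * ennreal (real (x i))"]
  show ?thesis
    by (subst nn_integral_count_space_eq[where B = "{x \<in> count_vectors m. x i > 0}"]) auto
qed

lemma nn_integral_neg_multinomial_mass:
  assumes r: "r > 0" and q: "q \<in> open_simplex m"
  shows "(\<integral>\<^sup>+x. ennreal (neg_multinomial_mass m r q x) \<partial>count_space (count_vectors m)) = 1"
proof -
  let ?W = "count_space (count_vectors m)"
  have "(\<integral>\<^sup>+x. ennreal (neg_multinomial_mass m r q x) \<partial>?W)
      = (\<integral>\<^sup>+x. ennreal (pmf (neg_multinomial_pmf m r q) x) \<partial>?W)"
    by (intro nn_integral_cong) (simp add: pmf_neg_multinomial[OF r q])
  also have "\<dots> = (\<integral>\<^sup>+x. ennreal (pmf (neg_multinomial_pmf m r q) x) \<partial>count_space UNIV)"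
    by (intro nn_integral_count_space_eq) (auto simp: pmf_neg_multinomial[OF r q])
  also have "\<dots> = 1"
    by (simp add: nn_integral_pmf measure_pmf.emeasure_space_1[simplified])
  finally show ?thesis .
qed

lemma neg_multinomial_mean:
  assumes r: "r > 0" and q: "q \<in> open_simplex m" and i: "i \<in> {1..m}"
  shows "(\<integral>\<^sup>+x. ennreal (neg_multinomial_mass m r q x) * ennreal (real (x i)) \<partial>count_space (count_vectors m))
       = ennreal (r * q i / p0 m q)"
proof -
  let ?W = "count_space (count_vectors m)"
  note pos = open_simplex_bounds(1)[OF q] open_simplex_bounds(3)[OF q i]
  have e: "neg_multinomial_mass m r q (y + unit_count i) * real ((y + unit_count i) i)
      = r * q i / p0 m q * neg_multinomial_mass m (r + 1) q y" for y
  proof -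
    have "neg_multinomial_mass m r q (y + unit_count i) * real ((y + unit_count i) i)
        = (nm_coeff m r (y + unit_count i) * real ((y + unit_count i) i)) * (p0 m q powr r * mpow m q y * q i)"
      using r by (simp add: neg_multinomial_mass_eq mpow_add mpow_unit[OF i])
    also have "\<dots> = r * q i / p0 m q * neg_multinomial_mass m (r + 1) q y"
      unfolding nm_coeff_add_unit[OF i] using r pos
      by (simp add: neg_multinomial_mass_eq powr_add)
    finally show ?thesis .
  qed
  have "(\<integral>\<^sup>+x. ennreal (neg_multinomial_mass m r q x) * ennreal (real (x i)) \<partial>?W)
     = (\<integral>\<^sup>+y. ennreal (r * q i / p0 m q) * ennreal (neg_multinomial_mass m (r + 1) q y) \<partial>?W)"
    unfolding nn_integral_times_count[OF i]
    using r pos q by (intro nn_integral_cong)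
      (simp only: ennreal_mult'[symmetric] ennreal_mult''[symmetric] e of_nat_0_le_iff
        neg_multinomial_mass_nonneg add_pos_pos zero_less_one)
  also have "\<dots> = ennreal (r * q i / p0 m q)"
    using r q by (subst nn_integral_cmult) (simp_all add: nn_integral_neg_multinomial_mass)
  finally show ?thesis .
qed

lemma levy_mean:
  assumes q: "q \<in> open_simplex m" and i: "i \<in> {1..m}"
  shows "(\<integral>\<^sup>+w. ennreal (levy_coeff m w) * ennreal (mpow m q w) * ennreal (real (w i)) \<partial>count_space (count_vectors m))
       = ennreal (q i / p0 m q)"
proof -
  let ?W = "count_space (count_vectors m)"
  note pos = open_simplex_bounds(1)[OF q] open_simplex_bounds(3)[OF q i]
  have e: "levy_coeff m (y + unit_count i) * mpow m q (y + unit_count i) * real ((y + unit_count i) i)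
      = q i / p0 m q * neg_multinomial_mass m 1 q y" for y
  proof -
    have "levy_coeff m (y + unit_count i) * mpow m q (y + unit_count i) * real ((y + unit_count i) i)
        = (levy_coeff m (y + unit_count i) * real ((y + unit_count i) i)) * (mpow m q y * q i)"
      by (simp add: mpow_add mpow_unit[OF i])
    then show ?thesis
      unfolding levy_coeff_add_unit[OF i] using pos
      by (simp add: neg_multinomial_mass_eq)
  qed
  have "(\<integral>\<^sup>+w. ennreal (levy_coeff m w) * ennreal (mpow m q w) * ennreal (real (w i)) \<partial>?W)
     = (\<integral>\<^sup>+y. ennreal (q i / p0 m q) * ennreal (neg_multinomial_mass m 1 q y) \<partial>?W)"
    unfolding nn_integral_times_count[OF i]
    using pos mpow_pos[OF q] by (intro nn_integral_cong)
      (simp only: ennreal_mult'[symmetric] ennreal_mult[symmetric] e of_nat_0_le_iff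
        levy_coeff_nonneg less_imp_le mult_nonneg_nonneg divide_pos_pos)
  also have "\<dots> = ennreal (q i / p0 m q)"
    using q by (subst nn_integral_cmult) (simp_all add: nn_integral_neg_multinomial_mass)
  finally show ?thesis .
qed

text \<open>
  Kolmogorov's forward equation for the compound Poisson process: \<open>x\<close> is entered from \<open>x - w\<close> by a
  jump \<open>w\<close>, and left at the total rate \<open>- ln p\<^sub>0\<close>.
\<close>

lemma neg_multinomial_mass_has_derivative:
  assumes x: "x \<in> count_vectors m" and q: "q \<in> open_simplex m" and a: "a > 0"
  shows "((\<lambda>a. neg_multinomial_mass m a q x) has_real_derivative
     (\<Sum>w\<in>{..x}. levy_coeff m w * mpow m q w * neg_multinomial_mass m a q (x - w))
       + ln (p0 m q) * neg_multinomial_mass m a q x) (at a)"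
proof -
  have pos: "p0 m q > 0" using open_simplex_bounds[OF q] by simp
  have D: "((\<lambda>a. nm_coeff m a x * p0 m q powr a * mpow m q x) has_real_derivative
     ((\<Sum>w\<in>{..x}. nm_coeff m a (x - w) * levy_coeff m w) * p0 m q powr a
       + p0 m q powr a * ln (p0 m q) * nm_coeff m a x) * mpow m q x) (at a)"
    using pos by (intro DERIV_cmult_right DERIV_mult nm_coeff_has_derivative[OF x] has_real_derivative_powr')
      (auto intro!: derivative_eq_intros)
  have s: "(\<Sum>w\<in>{..x}. nm_coeff m a (x - w) * levy_coeff m w) * (p0 m q powr a * mpow m q x)
     = (\<Sum>w\<in>{..x}. levy_coeff m w * mpow m q w * neg_multinomial_mass m a q (x - w))"
    unfolding sum_distrib_right
  proof (intro sum.cong refl)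
    fix w assume "w \<in> {..x}"
    then have "mpow m q x = mpow m q (x - w) * mpow m q w"
      by (simp add: mpow_add[symmetric] le_imp_diff_add)
    then show "nm_coeff m a (x - w) * levy_coeff m w * (p0 m q powr a * mpow m q x)
       = levy_coeff m w * mpow m q w * neg_multinomial_mass m a q (x - w)"
      using a by (simp add: neg_multinomial_mass_eq)
  qed
  have "((\<Sum>w\<in>{..x}. nm_coeff m a (x - w) * levy_coeff m w) * p0 m q powr a
       + p0 m q powr a * ln (p0 m q) * nm_coeff m a x) * mpow m q x
     = (\<Sum>w\<in>{..x}. levy_coeff m w * mpow m q w * neg_multinomial_mass m a q (x - w))
       + ln (p0 m q) * neg_multinomial_mass m a q x"
    unfolding s[symmetric] using a by (simp add: neg_multinomial_mass_eq algebra_simps)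
  note D[unfolded this]
  moreover have "eventually (\<lambda>a. nm_coeff m a x * p0 m q powr a * mpow m q x = neg_multinomial_mass m a q x) (nhds a)"
    using a by (auto simp: neg_multinomial_mass_eq eventually_nhds intro!: exI[of _ "{0<..}"])
  ultimately show ?thesis
    using a by (subst (asm) DERIV_cong_ev[OF refl _ refl]) 
qed

section \<open>Independent blocks\<close>

definition states :: "nat \<Rightarrow> (nat \<Rightarrow> nat) \<Rightarrow> (nat \<Rightarrow> nat \<Rightarrow> nat) set" where
  "states N m = {z. (\<forall>\<nu>\<in>{1..N}. z \<nu> \<in> count_vectors (m \<nu>)) \<and> (\<forall>\<nu>. \<nu> \<notin> {1..N} \<longrightarrow> z \<nu> = 0)}"

definition block :: "nat \<Rightarrow> (nat \<Rightarrow> nat) \<Rightarrow> nat \<Rightarrow> nat \<Rightarrow> nat" where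
  "block \<nu> w = (\<lambda>\<mu>. if \<mu> = \<nu> then w else 0)"

lemma block_simps: "block \<nu> w \<nu> = w" "\<mu> \<noteq> \<nu> \<Longrightarrow> block \<nu> w \<mu> = 0"
  by (simp_all add: block_def)

lemma countable_states: "countable (states N m)"
proof -
  have "countable (PiE {1..N} (\<lambda>\<nu>. count_vectors (m \<nu>)))"
    by (intro countable_PiE countable_count_vectors) simp
  moreover have "states N m \<subseteq> (\<lambda>z \<nu>. if \<nu> \<in> {1..N} then z \<nu> else 0) ` PiE {1..N} (\<lambda>\<nu>. count_vectors (m \<nu>))"
  proof
    fix z assume "z \<in> states N m"
    then show "z \<in> (\<lambda>z \<nu>. if \<nu> \<in> {1..N} then z \<nu> else 0) ` PiE {1..N} (\<lambda>\<nu>. count_vectors (m \<nu>))"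
      by (intro image_eqI[of _ _ "restrict z {1..N}"]) (auto simp: states_def fun_eq_iff)
  qed
  ultimately show ?thesis
    by (meson countable_image countable_subset)
qed

lemma states_add: "x \<in> states N m \<Longrightarrow> y \<in> states N m \<Longrightarrow> x + y \<in> states N m"
  by (auto simp: states_def count_vectors_add)

lemma block_states: "\<nu> \<in> {1..N} \<Longrightarrow> w \<in> count_vectors (m \<nu>) \<Longrightarrow> block \<nu> w \<in> states N m"
  by (auto simp: states_def block_def)

lemma nn_integral_states_shift:
  assumes \<nu>: "\<nu> \<in> {1..N}" and w: "w \<in> count_vectors (m \<nu>)"
  shows "(\<integral>\<^sup>+z. (if w \<le> z \<nu> then F z else 0) \<partial>count_space (states N m))
       = (\<integral>\<^sup>+z. F (z + block \<nu> w) \<partial>count_space (states N m))"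
proof -
  have "bij_betw (\<lambda>z. z + block \<nu> w) (states N m) {z \<in> states N m. w \<le> z \<nu>}"
  proof (rule bij_betw_byWitness[where f' = "\<lambda>z. z - block \<nu> w"])
    show "\<forall>z\<in>{z \<in> states N m. w \<le> z \<nu>}. z - block \<nu> w + block \<nu> w = z"
      by (auto simp: block_def fun_eq_iff le_fun_def)
    show "(\<lambda>z. z + block \<nu> w) ` states N m \<subseteq> {z \<in> states N m. w \<le> z \<nu>}"
      using states_add[OF _ block_states[of \<nu> N w m, OF assms]] by (auto simp: block_simps le_fun_def)
    show "(\<lambda>z. z - block \<nu> w) ` {z \<in> states N m. w \<le> z \<nu>} \<subseteq> states N m"
      using w by (auto simp: states_def block_def count_vectors_def)
  qed (auto simp: fun_eq_iff)
  from nn_integral_bij_count_space[OF this, of F]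
  show ?thesis
    by (subst nn_integral_count_space_eq[where B = "{z \<in> states N m. w \<le> z \<nu>}"])
      (auto cong: nn_integral_cong_simp)
qed

definition joint_mass ::
  "nat \<Rightarrow> (nat \<Rightarrow> nat) \<Rightarrow> (nat \<Rightarrow> real) \<Rightarrow> (nat \<Rightarrow> nat \<Rightarrow> real) \<Rightarrow> (nat \<Rightarrow> nat \<Rightarrow> nat) \<Rightarrow> real" where
  "joint_mass N m a p z = (\<Prod>\<nu>=1..N. neg_multinomial_mass (m \<nu>) (a \<nu>) (p \<nu>) (z \<nu>))"

lemma param_set_component: "p \<in> param_set N m \<Longrightarrow> \<nu> \<in> {1..N} \<Longrightarrow> p \<nu> \<in> open_simplex (m \<nu>)"
  by (auto simp: param_set_def)

lemma joint_mass_nonneg: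
  assumes "\<forall>\<nu>\<in>{1..N}. a \<nu> > 0" "p \<in> param_set N m"
  shows "joint_mass N m a p z \<ge> 0"
  unfolding joint_mass_def
  using assms by (intro prod_nonneg neg_multinomial_mass_nonneg) (auto intro: param_set_component)

lemma pmf_neg_multinomials:
  assumes "\<forall>\<nu>\<in>{1..N}. a \<nu> > 0" "p \<in> param_set N m"
  shows "pmf (neg_multinomials_pmf N m a p) z = (if z \<in> states N m then joint_mass N m a p z else 0)"
proof (cases "z \<in> states N m")
  case True
  then show ?thesis
    using assms unfolding neg_multinomials_pmf_def joint_mass_def
    by (subst pmf_Pi') (auto simp: states_def pmf_neg_multinomial param_set_component intro!: prod.cong)
next
  case False
  show ?thesis
  proof (cases "\<exists>\<nu>\<in>{1..N}. z \<nu> \<notin> count_vectors (m \<nu>)")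
    case True
    then have "(\<Prod>\<nu>=1..N. pmf (neg_multinomial_pmf (m \<nu>) (a \<nu>) (p \<nu>)) (z \<nu>)) = 0"
      using assms by (auto simp: pmf_neg_multinomial param_set_component intro!: prod_zero)
    then show ?thesis
      using \<open>z \<notin> states N m\<close> by (simp add: neg_multinomials_pmf_def pmf_Pi)
  next
    case outside: False
    have "\<exists>\<nu>. \<nu> \<notin> {1..N} \<and> z \<nu> \<noteq> (\<lambda>_. 0)"
      using False outside unfolding states_def zero_fun_def by auto
    then show ?thesis
      using False by (simp add: neg_multinomials_pmf_def pmf_Pi_outside)
  qed
qed

lemma nn_integral_neg_multinomials:
  assumes "\<forall>\<nu>\<in>{1..N}. a \<nu> > 0" "p \<in> param_set N m"
  shows "(\<integral>\<^sup>+z. F z \<partial>measure_pmf (neg_multinomials_pmf N m a p))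
       = (\<integral>\<^sup>+z. ennreal (joint_mass N m a p z) * F z \<partial>count_space (states N m))"
  unfolding nn_integral_measure_pmf pmf_neg_multinomials[OF assms]
  by (subst nn_integral_count_space_indicator) (auto intro!: nn_integral_cong simp: indicator_def)

lemma neg_multinomials_mean:
  assumes a: "\<forall>\<nu>\<in>{1..N}. a \<nu> > 0" and p: "p \<in> param_set N m" and \<nu>: "\<nu> \<in> {1..N}" and i: "i \<in> {1..m \<nu>}"
  shows "(\<integral>\<^sup>+z. ennreal (real (z \<nu> i)) \<partial>measure_pmf (neg_multinomials_pmf N m a p))
       = ennreal (a \<nu> * p \<nu> i / p0 (m \<nu>) (p \<nu>))"
proof -
  have a\<nu>: "a \<nu> > 0" and p\<nu>: "p \<nu> \<in> open_simplex (m \<nu>)"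
    using a p \<nu> by (auto intro: param_set_component)
  have "map_pmf (\<lambda>z. z \<nu>) (neg_multinomials_pmf N m a p) = neg_multinomial_pmf (m \<nu>) (a \<nu>) (p \<nu>)"
    unfolding neg_multinomials_pmf_def using \<nu> by (simp add: Pi_pmf_component)
  then have "(\<integral>\<^sup>+z. ennreal (real (z \<nu> i)) \<partial>measure_pmf (neg_multinomials_pmf N m a p))
      = (\<integral>\<^sup>+x. ennreal (real (x i)) \<partial>measure_pmf (neg_multinomial_pmf (m \<nu>) (a \<nu>) (p \<nu>)))"
    by (metis (no_types, lifting) nn_integral_cong nn_integral_map_pmf)
  also have "\<dots> = (\<integral>\<^sup>+x. ennreal (neg_multinomial_mass (m \<nu>) (a \<nu>) (p \<nu>) x) * ennreal (real (x i)) \<partial>count_space (count_vectors (m \<nu>)))"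
    unfolding nn_integral_measure_pmf pmf_neg_multinomial[OF a\<nu> p\<nu>]
    by (subst nn_integral_count_space_indicator) (auto intro!: nn_integral_cong simp: indicator_def)
  finally show ?thesis
    unfolding neg_multinomial_mean[OF a\<nu> p\<nu> i] .
qed

lemma neg_multinomial_convolution:
  assumes r: "r > 0" and s: "s > 0" and q: "q \<in> open_simplex m"
  shows "bind_pmf (neg_multinomial_pmf m r q) (\<lambda>x. map_pmf (\<lambda>y. x + y) (neg_multinomial_pmf m s q))
       = neg_multinomial_pmf m (r + s) q"
proof (rule pmf_eqI)
  fix z
  have shift: "pmf (map_pmf (\<lambda>y. x + y) (neg_multinomial_pmf m s q)) z
      = (if x \<le> z then pmf (neg_multinomial_pmf m s q) (z - x) else 0)" for x
  proof (cases "x \<le> z")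
    case True
    have "inj (\<lambda>y. x + y)" by (auto simp: inj_def fun_eq_iff)
    moreover have "z = x + (z - x)"
      using True by (auto simp: fun_eq_iff le_fun_def)
    ultimately show ?thesis
      using True pmf_map_inj'[of "\<lambda>y. x + y" "neg_multinomial_pmf m s q" "z - x"] by simp
  next
    case False
    then have "z \<notin> (\<lambda>y. x + y) ` set_pmf (neg_multinomial_pmf m s q)"
      by (auto simp: le_fun_def)
    then show ?thesis
      using False by (simp add: pmf_map_outside)
  qed
  have eq: "pmf (bind_pmf (neg_multinomial_pmf m r q) (\<lambda>x. map_pmf (\<lambda>y. x + y) (neg_multinomial_pmf m s q))) z
     = measure_pmf.expectation (neg_multinomial_pmf m r q)
         (\<lambda>x. if x \<le> z then pmf (neg_multinomial_pmf m s q) (z - x) else 0)"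
    unfolding pmf_bind shift ..
  show "pmf (bind_pmf (neg_multinomial_pmf m r q) (\<lambda>x. map_pmf (\<lambda>y. x + y) (neg_multinomial_pmf m s q))) z
     = pmf (neg_multinomial_pmf m (r + s) q) z"
  proof (cases "z \<in> count_vectors m")
    case z: True
    have pos: "p0 m q > 0" using open_simplex_bounds[OF q] by simp
    have "measure_pmf.expectation (neg_multinomial_pmf m r q)
         (\<lambda>x. if x \<le> z then pmf (neg_multinomial_pmf m s q) (z - x) else 0)
       = (\<Sum>x\<in>{..z}. (if x \<le> z then pmf (neg_multinomial_pmf m s q) (z - x) else 0) * pmf (neg_multinomial_pmf m r q) x)"
      by (intro integral_measure_pmf_real finite_atMost_count_vector[OF z]) (auto split: if_splits)
    also have "\<dots> = (\<Sum>x\<in>{..z}. nm_coeff m s (z - x) * nm_coeff m r x) * (p0 m q powr (r + s) * mpow m q z)"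
      unfolding sum_distrib_right
    proof (intro sum.cong refl)
      fix x assume "x \<in> {..z}"
      then have x: "x \<le> z" by simp
      then have cv: "x \<in> count_vectors m" "z - x \<in> count_vectors m"
        using z by (auto intro: count_vectors_downward_closed simp: le_fun_def)
      have "mpow m q z = mpow m q (z - x) * mpow m q x"
        using x by (simp add: mpow_add[symmetric] le_imp_diff_add)
      then show "(if x \<le> z then pmf (neg_multinomial_pmf m s q) (z - x) else 0) * pmf (neg_multinomial_pmf m r q) x
         = nm_coeff m s (z - x) * nm_coeff m r x * (p0 m q powr (r + s) * mpow m q z)"
        using x cv r s q by (simp add: pmf_neg_multinomial neg_multinomial_mass_eq powr_add)
    qed
    also have "\<dots> = pmf (neg_multinomial_pmf m (r + s) q) z"
      using r s q z by (simp add: nm_coeff_add[OF z, symmetric] pmf_neg_multinomial neg_multinomial_mass_eq add.commute)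
    finally show ?thesis unfolding eq .
  next
    case z: False
    have "pmf (neg_multinomial_pmf m s q) (z - x) = 0" if "x \<in> set_pmf (neg_multinomial_pmf m r q)" for x
    proof -
      have "x \<in> count_vectors m"
        using that by (auto simp: set_pmf_eq pmf_neg_multinomial[OF r q] split: if_splits)
      then have "z - x \<notin> count_vectors m"
        using z by (auto simp: count_vectors_def)
      then show ?thesis
        by (simp add: pmf_neg_multinomial[OF s q])
    qed
    then have "measure_pmf.expectation (neg_multinomial_pmf m r q)
         (\<lambda>x. if x \<le> z then pmf (neg_multinomial_pmf m s q) (z - x) else 0)
        = measure_pmf.expectation (neg_multinomial_pmf m r q) (\<lambda>x. 0)"
      by (intro integral_cong_AE) (auto simp: AE_measure_pmf_iff)
    then show ?thesis
      unfolding eq using z r s by (simp add: pmf_neg_multinomial[OF _ q])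
  qed
qed

lemma Pi_pmf_add:
  fixes F G :: "'i \<Rightarrow> ('j \<Rightarrow> nat) pmf"
  assumes A: "finite A"
  shows "Pi_pmf A 0 (\<lambda>\<nu>. bind_pmf (F \<nu>) (\<lambda>x. map_pmf (\<lambda>y. x + y) (G \<nu>)))
       = map_pmf (\<lambda>(f, g). f + g) (pair_pmf (Pi_pmf A 0 F) (Pi_pmf A 0 G))"
proof -
  have inner: "Pi_pmf A 0 (\<lambda>\<nu>. map_pmf (\<lambda>y. f \<nu> + y) (G \<nu>)) = map_pmf (\<lambda>g. f + g) (Pi_pmf A 0 G)"
    if f: "f \<in> set_pmf (Pi_pmf A 0 F)" for f
  proof -
    have f0: "\<nu> \<notin> A \<Longrightarrow> f \<nu> = 0" for \<nu>
      using set_Pi_pmf_subset[OF A, of 0 F] f by blast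
    have "Pi_pmf A 0 (\<lambda>\<nu>. map_pmf (\<lambda>y. f \<nu> + y) (G \<nu>))
        = bind_pmf (Pi_pmf A 0 G) (\<lambda>g. return_pmf (\<lambda>\<nu>. if \<nu> \<in> A then f \<nu> + g \<nu> else 0))"
      unfolding map_pmf_def using A by (subst Pi_pmf_bind[where d' = 0]) simp_all
    also have "\<dots> = bind_pmf (Pi_pmf A 0 G) (\<lambda>g. return_pmf (f + g))"
    proof (intro bind_pmf_cong refl arg_cong[where f = return_pmf])
      fix g assume "g \<in> set_pmf (Pi_pmf A 0 G)"
      then have "\<nu> \<notin> A \<Longrightarrow> g \<nu> = 0" for \<nu>
        using set_Pi_pmf_subset[OF A, of 0 G] by blast
      with f0 show "(\<lambda>\<nu>. if \<nu> \<in> A then f \<nu> + g \<nu> else 0) = f + g"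
        by (auto simp: fun_eq_iff)
    qed
    finally show ?thesis unfolding map_pmf_def .
  qed
  have "Pi_pmf A 0 (\<lambda>\<nu>. bind_pmf (F \<nu>) (\<lambda>x. map_pmf (\<lambda>y. x + y) (G \<nu>)))
      = bind_pmf (Pi_pmf A 0 F) (\<lambda>f. Pi_pmf A 0 (\<lambda>\<nu>. map_pmf (\<lambda>y. f \<nu> + y) (G \<nu>)))"
    using A by (rule Pi_pmf_bind)
  also have "\<dots> = bind_pmf (Pi_pmf A 0 F) (\<lambda>f. map_pmf (\<lambda>g. f + g) (Pi_pmf A 0 G))"
    by (intro bind_pmf_cong refl inner)
  also have "\<dots> = map_pmf (\<lambda>(f, g). f + g) (pair_pmf (Pi_pmf A 0 F) (Pi_pmf A 0 G))"
    by (simp add: pair_pmf_def map_bind_pmf map_pmf_def bind_assoc_pmf bind_return_pmf)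
  finally show ?thesis .
qed

text \<open>
  Blocks that are not to be predicted are completed by \<open>return_pmf 0\<close>, so that \<open>X\<close> and \<open>Y\<close> have the same
  index set.
\<close>

lemma neg_multinomials_convolution:
  assumes n: "n \<le> N" and r: "\<forall>\<nu>\<in>{1..N}. r \<nu> > 0" and s: "\<forall>\<nu>\<in>{1..n}. s \<nu> > 0"
    and p: "p \<in> param_set N m"
  shows "map_pmf (\<lambda>(x, y). x + y) (XY_pmf N n m r s p)
       = neg_multinomials_pmf N m (\<lambda>\<nu>. if \<nu> \<le> n then r \<nu> + s \<nu> else r \<nu>) p"
proof -
  let ?F = "\<lambda>\<nu>. neg_multinomial_pmf (m \<nu>) (r \<nu>) (p \<nu>)"
  let ?G = "\<lambda>\<nu>. if \<nu> \<le> n then neg_multinomial_pmf (m \<nu>) (s \<nu>) (p \<nu>) else return_pmf 0"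
  have z: "(\<lambda>_. 0) = (0 :: nat \<Rightarrow> nat)" by (simp add: zero_fun_def)
  have "{\<nu> \<in> {1..N}. \<nu> \<le> n} = {1..n}"
    using n by auto
  then have G: "neg_multinomials_pmf n m s p = Pi_pmf {1..N} 0 ?G"
    unfolding neg_multinomials_pmf_def z by (subst Pi_pmf_if_set) simp_all
  have "neg_multinomials_pmf N m (\<lambda>\<nu>. if \<nu> \<le> n then r \<nu> + s \<nu> else r \<nu>) p
     = Pi_pmf {1..N} 0 (\<lambda>\<nu>. bind_pmf (?F \<nu>) (\<lambda>x. map_pmf (\<lambda>y. x + y) (?G \<nu>)))"
    unfolding neg_multinomials_pmf_def z
  proof (intro Pi_pmf_cong refl)
    fix \<nu> assume \<nu>: "\<nu> \<in> {1..N}"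
    show "neg_multinomial_pmf (m \<nu>) (if \<nu> \<le> n then r \<nu> + s \<nu> else r \<nu>) (p \<nu>)
        = bind_pmf (?F \<nu>) (\<lambda>x. map_pmf (\<lambda>y. x + y) (?G \<nu>))"
      using \<nu> r s param_set_component[OF p \<nu>]
      by (auto simp: neg_multinomial_convolution bind_return_pmf')
  qed
  then show ?thesis
    unfolding XY_pmf_def G Pi_pmf_add[OF finite_atLeastAtMost]
    by (simp add: neg_multinomials_pmf_def z)
qed

text \<open>
  The forward equation for independent blocks, each with its own clock \<open>t\<^sub>\<nu>\<close>.
\<close>

lemma joint_mass_has_derivative:
  assumes z: "z \<in> states N m" and p: "p \<in> param_set N m"
    and a: "\<And>\<nu>. \<nu> \<in> {1..N} \<Longrightarrow> t \<nu> \<tau> > 0"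
    and t: "\<And>\<nu>. \<nu> \<in> {1..N} \<Longrightarrow> (t \<nu> has_real_derivative t' \<nu>) (at \<tau>)"
  shows "((\<lambda>\<tau>. joint_mass N m (\<lambda>\<nu>. t \<nu> \<tau>) p z) has_real_derivative
     (\<Sum>\<nu>=1..N. t' \<nu> * ((\<Sum>w\<in>{..z \<nu>}. levy_coeff (m \<nu>) w * mpow (m \<nu>) (p \<nu>) w
                                * joint_mass N m (\<lambda>\<nu>. t \<nu> \<tau>) p (z - block \<nu> w))
          + ln (p0 (m \<nu>) (p \<nu>)) * joint_mass N m (\<lambda>\<nu>. t \<nu> \<tau>) p z))) (at \<tau>)"
proof -
  let ?f = "\<lambda>\<nu> x. neg_multinomial_mass (m \<nu>) (t \<nu> \<tau>) (p \<nu>) x"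
  let ?d = "\<lambda>\<nu>. (\<Sum>w\<in>{..z \<nu>}. levy_coeff (m \<nu>) w * mpow (m \<nu>) (p \<nu>) w * ?f \<nu> (z \<nu> - w))
       + ln (p0 (m \<nu>) (p \<nu>)) * ?f \<nu> (z \<nu>)"
  have "((\<lambda>\<tau>. neg_multinomial_mass (m \<nu>) (t \<nu> \<tau>) (p \<nu>) (z \<nu>)) has_real_derivative ?d \<nu> * t' \<nu>) (at \<tau>)"
    if \<nu>: "\<nu> \<in> {1..N}" for \<nu>
  proof -
    have "z \<nu> \<in> count_vectors (m \<nu>)"
      using z \<nu> by (auto simp: states_def)
    from DERIV_chain2[OF neg_multinomial_mass_has_derivative[OF this param_set_component[OF p \<nu>] a[OF \<nu>]] t[OF \<nu>]]
    show ?thesis .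
  qed
  then have "((\<lambda>\<tau>. joint_mass N m (\<lambda>\<nu>. t \<nu> \<tau>) p z) has_real_derivative
      (\<Sum>\<nu>=1..N. ?d \<nu> * t' \<nu> * (\<Prod>\<mu>\<in>{1..N} - {\<nu>}. ?f \<mu> (z \<mu>)))) (at \<tau>)"
    unfolding joint_mass_def by (rule has_field_derivative_prod)
  also have "(\<Sum>\<nu>=1..N. ?d \<nu> * t' \<nu> * (\<Prod>\<mu>\<in>{1..N} - {\<nu>}. ?f \<mu> (z \<mu>)))
     = (\<Sum>\<nu>=1..N. t' \<nu> * ((\<Sum>w\<in>{..z \<nu>}. levy_coeff (m \<nu>) w * mpow (m \<nu>) (p \<nu>) w
                                * joint_mass N m (\<lambda>\<nu>. t \<nu> \<tau>) p (z - block \<nu> w))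
          + ln (p0 (m \<nu>) (p \<nu>)) * joint_mass N m (\<lambda>\<nu>. t \<nu> \<tau>) p z))"
  proof (intro sum.cong refl)
    fix \<nu> assume \<nu>: "\<nu> \<in> {1..N}"
    let ?R = "\<Prod>\<mu>\<in>{1..N} - {\<nu>}. ?f \<mu> (z \<mu>)"
    have split: "joint_mass N m (\<lambda>\<nu>. t \<nu> \<tau>) p (z - block \<nu> w) = ?f \<nu> (z \<nu> - w) * ?R" for w
      unfolding joint_mass_def using \<nu>
      by (subst prod.remove[of _ \<nu>]) (auto simp: block_simps intro!: prod.cong)
    show "?d \<nu> * t' \<nu> * ?R = t' \<nu> * ((\<Sum>w\<in>{..z \<nu>}. levy_coeff (m \<nu>) w * mpow (m \<nu>) (p \<nu>) w
                                * joint_mass N m (\<lambda>\<nu>. t \<nu> \<tau>) p (z - block \<nu> w))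
          + ln (p0 (m \<nu>) (p \<nu>)) * joint_mass N m (\<lambda>\<nu>. t \<nu> \<tau>) p z)"
    proof -
      have 1: "joint_mass N m (\<lambda>\<nu>. t \<nu> \<tau>) p z = ?f \<nu> (z \<nu>) * ?R"
        unfolding joint_mass_def using \<nu> by (subst prod.remove[of _ \<nu>]) auto
      show ?thesis
        unfolding 1 split by (simp add: algebra_simps sum_distrib_left sum_distrib_right)
    qed
  qed
  finally show ?thesis .
qed

text \<open>
  Summation by parts: the inflow paired with a function \<open>F\<close> is the rate-weighted expectation of \<open>F\<close>
  after a jump.
\<close>

lemma nn_integral_inflow:
  assumes \<nu>: "\<nu> \<in> {1..N}" and f: "\<And>z. f z \<ge> 0" and p: "p \<in> param_set N m"
  shows "(\<integral>\<^sup>+z. ennreal (\<Sum>w\<in>{..z \<nu>}. levy_coeff (m \<nu>) w * mpow (m \<nu>) (p \<nu>) w * f (z - block \<nu> w)) * F z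
            \<partial>count_space (states N m))
       = (\<integral>\<^sup>+w. ennreal (levy_coeff (m \<nu>) w) * ennreal (mpow (m \<nu>) (p \<nu>) w)
            * (\<integral>\<^sup>+z. ennreal (f z) * F (z + block \<nu> w) \<partial>count_space (states N m))
            \<partial>count_space (count_vectors (m \<nu>)))"
proof -
  let ?W = "count_space (count_vectors (m \<nu>))" and ?Z = "count_space (states N m)"
  let ?c = "\<lambda>w. levy_coeff (m \<nu>) w * mpow (m \<nu>) (p \<nu>) w"
  have c: "?c w \<ge> 0" for w
    using mpow_pos[OF param_set_component[OF p \<nu>], of w] levy_coeff_nonneg[of "m \<nu>" w] by simp
  have "ennreal (\<Sum>w\<in>{..z \<nu>}. ?c w * f (z - block \<nu> w)) * F z
      = (\<integral>\<^sup>+w. (if w \<le> z \<nu> then ennreal (?c w * f (z - block \<nu> w)) * F z else 0) \<partial>?W)"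
    if z: "z \<in> states N m" for z
  proof -
    have cv: "z \<nu> \<in> count_vectors (m \<nu>)"
      using z \<nu> by (auto simp: states_def)
    have "(\<integral>\<^sup>+w. (if w \<le> z \<nu> then ennreal (?c w * f (z - block \<nu> w)) * F z else 0) \<partial>?W)
        = (\<Sum>w\<in>{..z \<nu>}. if w \<le> z \<nu> then ennreal (?c w * f (z - block \<nu> w)) * F z else 0)"
      using cv by (intro nn_integral_count_space' finite_atMost_count_vector[OF cv])
        (auto intro: count_vectors_downward_closed)
    also have "\<dots> = ennreal (\<Sum>w\<in>{..z \<nu>}. ?c w * f (z - block \<nu> w)) * F z"
    proof -
      have "ennreal (\<Sum>w\<in>{..z \<nu>}. ?c w * f (z - block \<nu> w)) = (\<Sum>w\<in>{..z \<nu>}. ennreal (?c w * f (z - block \<nu> w)))"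
        by (rule sum_ennreal[symmetric]) (intro mult_nonneg_nonneg c f)
      then show ?thesis
        by (simp add: sum_distrib_right)
    qed
    finally show ?thesis ..
  qed
  then have "(\<integral>\<^sup>+z. ennreal (\<Sum>w\<in>{..z \<nu>}. ?c w * f (z - block \<nu> w)) * F z \<partial>?Z)
     = (\<integral>\<^sup>+z. \<integral>\<^sup>+w. (if w \<le> z \<nu> then ennreal (?c w * f (z - block \<nu> w)) * F z else 0)
          \<partial>?W \<partial>?Z)"
    by (intro nn_integral_cong) auto
  also have "\<dots> = (\<integral>\<^sup>+w. \<integral>\<^sup>+z. (if w \<le> z \<nu> then ennreal (?c w * f (z - block \<nu> w)) * F z else 0)
          \<partial>?Z \<partial>?W)"
    by (intro nn_integral_count_space_nn_integral countable_count_vectors) simp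
  also have "\<dots> = (\<integral>\<^sup>+w. ennreal (levy_coeff (m \<nu>) w) * ennreal (mpow (m \<nu>) (p \<nu>) w)
            * (\<integral>\<^sup>+z. ennreal (f z) * F (z + block \<nu> w) \<partial>?Z)
            \<partial>?W)"
  proof (intro nn_integral_cong)
    fix w assume "w \<in> space (?W)"
    then have w: "w \<in> count_vectors (m \<nu>)" by simp
    have undo: "z + block \<nu> w - block \<nu> w = z" for z :: "nat \<Rightarrow> nat \<Rightarrow> nat"
      by (simp add: fun_eq_iff)
    have "(\<integral>\<^sup>+z. (if w \<le> z \<nu> then ennreal (?c w * f (z - block \<nu> w)) * F z else 0) \<partial>?Z)
        = (\<integral>\<^sup>+z. ennreal (?c w * f z) * F (z + block \<nu> w) \<partial>?Z)"
      unfolding nn_integral_states_shift[of \<nu> N w m, OF \<nu> w] undo ..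
    also have "\<dots> = (\<integral>\<^sup>+z. ennreal (?c w) * (ennreal (f z) * F (z + block \<nu> w)) \<partial>?Z)"
      by (simp only: ennreal_mult[OF c f] mult.assoc[where 'a = ennreal])
    also have "\<dots> = ennreal (?c w) * (\<integral>\<^sup>+z. ennreal (f z) * F (z + block \<nu> w) \<partial>?Z)"
      by (rule nn_integral_cmult) simp
    also have "ennreal (?c w) = ennreal (levy_coeff (m \<nu>) w) * ennreal (mpow (m \<nu>) (p \<nu>) w)"
      using mpow_pos[OF param_set_component[OF p \<nu>], of w] levy_coeff_nonneg[of "m \<nu>" w] by (simp add: ennreal_mult)
    finally show "(\<integral>\<^sup>+z. (if w \<le> z \<nu> then ennreal (?c w * f (z - block \<nu> w)) * F z else 0) \<partial>?Z)
      = ennreal (levy_coeff (m \<nu>) w) * ennreal (mpow (m \<nu>) (p \<nu>) w)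
            * (\<integral>\<^sup>+z. ennreal (f z) * F (z + block \<nu> w) \<partial>?Z)" .
  qed
  finally show ?thesis .
qed

section \<open>Integrals over parameters, times and counts\<close>

lemma integral_dominated_convergence_at_within:
  fixes s :: "real \<Rightarrow> 'a \<Rightarrow> real"
  assumes meas: "\<And>\<tau>. \<tau> \<in> A \<Longrightarrow> s \<tau> \<in> borel_measurable M" "f \<in> borel_measurable M" "integrable M w"
    and lim: "\<And>x. x \<in> space M \<Longrightarrow> ((\<lambda>\<tau>. s \<tau> x) \<longlongrightarrow> f x) (at c within A)"
    and bound: "eventually (\<lambda>\<tau>. \<forall>x\<in>space M. \<bar>s \<tau> x\<bar> \<le> w x) (at c within A)"
    and nontrivial: "at c within A \<noteq> bot"
  shows "((\<lambda>\<tau>. integral\<^sup>L M (s \<tau>)) \<longlongrightarrow> integral\<^sup>L M f) (at c within A)"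
    and "integrable M f"
proof -
  have seq: "integrable M f \<and> (\<lambda>n. integral\<^sup>L M (s (X n))) \<longlonglongrightarrow> integral\<^sup>L M f"
    if X: "\<forall>i. X i \<in> A - {c}" "X \<longlonglongrightarrow> c" for X
  proof -
    have X': "filterlim X (at c within A) sequentially"
      using X by (intro filterlim_at_withinI) auto
    from filterlim_iff[THEN iffD1, OF this, rule_format, OF bound]
    obtain n0 where n0: "\<And>n x. n \<ge> n0 \<Longrightarrow> x \<in> space M \<Longrightarrow> \<bar>s (X n) x\<bar> \<le> w x"
      by (auto simp: eventually_sequentially)
    have m: "s (X (n + n0)) \<in> borel_measurable M" for n
      using X(1) by (intro meas) auto
    have l: "AE x in M. (\<lambda>n. s (X (n + n0)) x) \<longlonglongrightarrow> f x"
      using filterlim_compose[OF lim X'] by (intro AE_I2 LIMSEQ_ignore_initial_segment) auto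
    have b: "AE x in M. norm (s (X (n + n0)) x) \<le> w x" for n
      using n0[of "n + n0"] by (intro AE_I2) auto
    show ?thesis
      using integrable_dominated_convergence[OF meas(2) m meas(3) l b]
        LIMSEQ_offset[OF integral_dominated_convergence[OF meas(2) m meas(3) l b]] by simp
  qed
  show "((\<lambda>\<tau>. integral\<^sup>L M (s \<tau>)) \<longlongrightarrow> integral\<^sup>L M f) (at c within A)"
    unfolding tendsto_at_iff_sequentially o_def using seq by blast
  obtain X where "\<forall>i. X i \<in> A - {c}" "X \<longlonglongrightarrow> c"
    using nontrivial unfolding trivial_limit_within islimpt_sequential by auto
  then show "integrable M f"
    using seq by blast
qed

abbreviation unit_interval :: "real measure" where
  "unit_interval \<equiv> restrict_space lborel {0..1}"

lemma nn_integral_unit_interval_has_integral: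
  assumes "\<And>\<tau>. \<tau> \<in> {0..1} \<Longrightarrow> 0 \<le> f \<tau>" "(f has_integral I) {0..1::real}"
  shows "(\<integral>\<^sup>+\<tau>. ennreal (f \<tau>) \<partial>unit_interval) = ennreal I"
proof -
  have "(\<integral>\<^sup>+\<tau>. ennreal (f \<tau>) \<partial>unit_interval) = (\<integral>\<^sup>+\<tau>. ennreal (indicator {0..1} \<tau> * f \<tau>) \<partial>lborel)"
    by (subst nn_integral_restrict_space) (auto intro!: nn_integral_cong simp: indicator_def)
  also have "\<dots> = ennreal I"
    by (rule nn_integral_has_integral_lebesgue[OF assms])
  finally show ?thesis .
qed

lemma measurable_unit_interval_continuous:
  "continuous_on {0..1} f \<Longrightarrow> f \<in> borel_measurable unit_interval" for f :: "real \<Rightarrow> real"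
  by (subst measurable_cong_sets[OF sets_restrict_space_cong[OF sets_lborel] refl])
     (rule borel_measurable_continuous_on_restrict)

lemma AE_unit_interval_finite_exception:
  assumes "finite S" "\<And>\<tau>. \<tau> \<in> {0<..<1} - S \<Longrightarrow> P \<tau>"
  shows "AE \<tau> in unit_interval. P \<tau>"
proof -
  have "AE \<tau> in lborel. \<tau> \<notin> S \<union> {0, 1}"
    using assms(1) by (intro AE_not_in finite_imp_null_set_lborel) simp
  then have "AE \<tau> in lborel. \<tau> \<in> {0..1} \<longrightarrow> P \<tau>"
  proof eventually_elim
    case (elim \<tau>)
    then show ?case
      using assms(2)[of \<tau>] by auto
  qed
  then show ?thesis
    by (subst AE_restrict_space_iff) auto
qed

lemma measurable_nn_integral_count_space:
  assumes I: "countable I" and F: "\<And>i. i \<in> I \<Longrightarrow> (\<lambda>x. F x i) \<in> borel_measurable M"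
  shows "(\<lambda>x. \<integral>\<^sup>+i. F x i \<partial>count_space I) \<in> borel_measurable M"
proof -
  interpret sigma_finite_measure "count_space I"
    using I by (rule sigma_finite_measure_count_space_countable)
  have "(\<lambda>(i, x). F x i) \<in> borel_measurable (count_space I \<Otimes>\<^sub>M M)"
    using I F by (intro measurable_pair_measure_countable1) auto
  from measurable_compose[OF measurable_pair_swap' this]
  have "case_prod F \<in> borel_measurable (M \<Otimes>\<^sub>M count_space I)"
    by (simp add: case_prod_beta' split_beta)
  then show ?thesis
    by (rule borel_measurable_nn_integral)
qed

lemma ennreal_add_right_imp_eq: "a + c = b + c \<Longrightarrow> c < \<infinity> \<Longrightarrow> a = (b :: ennreal)"
  by (auto simp: add.commute[of _ c] ennreal_add_left_cancel)

section \<open>The Kullback--Leibler loss\<close>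

lemma L_KL_nonneg:
  assumes "d > 0" "\<theta> > 0"
  shows "L_KL d \<theta> \<ge> 0"
proof -
  have "L_KL d \<theta> = \<theta> * (d / \<theta> - 1 - ln (d / \<theta>))"
    using assms by (simp add: L_KL_def field_simps)
  then show ?thesis
    using assms ln_le_minus_one[of "d / \<theta>"] by simp
qed

text \<open>
  The algebraic core of the theorem. With \<open>a\<close> and \<open>b\<close> the values of \<open>log_marginal\<close> before and after a
  jump, the loss is the change \<open>d - \<theta>\<close> of the function plus \<open>\<theta>\<close> times the change \<open>b - a\<close> along the jump,
  up to \<open>\<theta> ln \<theta>\<close>. The terms are distributed over the two sides so that all are nonnegative.
\<close>

lemma L_KL_balance:
  assumes "d > 0" "0 < \<theta>" "\<theta> \<le> 1" "a \<ge> 0" "b \<ge> 0" "b - a = - ln d"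
  shows "ennreal (L_KL d \<theta>) + ennreal \<theta> + ennreal \<theta> * ennreal a + ennreal \<theta> * ennreal (- ln \<theta>)
       = ennreal d + ennreal \<theta> * ennreal b"
proof -
  have "L_KL d \<theta> + \<theta> + \<theta> * a + \<theta> * (- ln \<theta>) = d + \<theta> * (a - ln d)"
    using assms(1,2) by (simp add: L_KL_def ln_div algebra_simps)
  also have "a - ln d = b" using assms(6) by simp
  finally have "ennreal (L_KL d \<theta> + \<theta> + \<theta> * a + \<theta> * (- ln \<theta>)) = ennreal (d + \<theta> * b)"
    by simp
  moreover have "0 \<le> - ln \<theta>" using assms by simp
  ultimately show ?thesis
    using assms L_KL_nonneg[of d \<theta>] by (simp only: ennreal_plus[symmetric] ennreal_mult[symmetric] less_imp_le
        add_nonneg_nonneg mult_nonneg_nonneg)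
qed

section \<open>Marginal likelihoods along a path of sizes\<close>

text \<open>
  The prior enters as a measure \<open>Q\<close> on the parameter set; it may be improper, and only the
  kernel at the initial sizes has to be integrable. As the \<open>t\<^sub>\<nu>\<close> are nondecreasing, this controls the
  kernel at all later times and all counts.
\<close>

locale negative_multinomial_path =
  fixes N :: nat and m :: "nat \<Rightarrow> nat" and p :: "nat \<Rightarrow> nat \<Rightarrow> real"
    and Q :: "(nat \<Rightarrow> nat \<Rightarrow> real) measure"
    and t t' :: "nat \<Rightarrow> real \<Rightarrow> real"
  assumes space_Q: "space Q = param_set N m"
    and coordinate_measurable:
      "\<And>\<nu> i. \<nu> \<in> {1..N} \<Longrightarrow> i \<in> {1..m \<nu>} \<Longrightarrow> (\<lambda>q. q \<nu> i) \<in> borel_measurable Q"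
    and p: "p \<in> param_set N m"
    and t_pos: "\<And>\<nu> \<tau>. \<nu> \<in> {1..N} \<Longrightarrow> \<tau> \<in> {0..1} \<Longrightarrow> 0 < t \<nu> \<tau>"
    and t_mono: "\<And>\<nu>. \<nu> \<in> {1..N} \<Longrightarrow> mono_on {0..1} (t \<nu>)"
    and t_deriv: "\<And>\<nu> \<tau>. \<nu> \<in> {1..N} \<Longrightarrow> \<tau> \<in> {0..1} \<Longrightarrow>
      (t \<nu> has_real_derivative t' \<nu> \<tau>) (at \<tau> within {0..1})"
    and t'_continuous: "\<And>\<nu>. \<nu> \<in> {1..N} \<Longrightarrow> continuous_on {0..1} (t' \<nu>)"
    and Q_nonzero: "emeasure Q (space Q) \<noteq> 0"
    and Q_finite: "(\<integral>\<^sup>+q. (\<Prod>\<nu>=1..N. p0 (m \<nu>) (q \<nu>) powr t \<nu> 0) \<partial>Q) < \<infinity>"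
begin

text \<open>
  The likelihood of \<open>z\<close> without the factors that are free of the parameter.
\<close>

definition kernel :: "real \<Rightarrow> (nat \<Rightarrow> nat \<Rightarrow> real) \<Rightarrow> (nat \<Rightarrow> nat \<Rightarrow> nat) \<Rightarrow> real" where
  "kernel \<tau> q z = (\<Prod>\<nu>=1..N. p0 (m \<nu>) (q \<nu>) powr t \<nu> \<tau> * mpow (m \<nu>) (q \<nu>) (z \<nu>))"

definition marginal :: "real \<Rightarrow> (nat \<Rightarrow> nat \<Rightarrow> nat) \<Rightarrow> real" where
  "marginal \<tau> z = (LINT q|Q. kernel \<tau> q z)"

text \<open>
  Dividing by \<open>marginal 0 0\<close> makes this nonnegative, as \<open>marginal 0 0\<close> dominates all marginals.
\<close>

definition log_marginal :: "real \<Rightarrow> (nat \<Rightarrow> nat \<Rightarrow> nat) \<Rightarrow> real" where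
  "log_marginal \<tau> z = - ln (marginal \<tau> z / marginal 0 0)"

text \<open>
  The total jump rate of block \<open>\<nu>\<close> under the parameter \<open>q\<close>, see \<open>levy_total_mass\<close>.
\<close>

definition jump_rate :: "nat \<Rightarrow> (nat \<Rightarrow> nat \<Rightarrow> real) \<Rightarrow> real" where
  "jump_rate \<nu> q = - ln (p0 (m \<nu>) (q \<nu>))"

lemma simplex: "q \<in> space Q \<Longrightarrow> \<nu> \<in> {1..N} \<Longrightarrow> q \<nu> \<in> open_simplex (m \<nu>)"
  unfolding space_Q by (rule param_set_component)

lemma jump_rate_nonneg: "q \<in> space Q \<Longrightarrow> \<nu> \<in> {1..N} \<Longrightarrow> jump_rate \<nu> q \<ge> 0"
  using open_simplex_bounds(1,2)[OF simplex] by (simp add: jump_rate_def)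

lemma kernel_exp:
  assumes "q \<in> space Q"
  shows "kernel \<tau> q z = exp (- (\<Sum>\<nu>=1..N. t \<nu> \<tau> * jump_rate \<nu> q)) * (\<Prod>\<nu>=1..N. mpow (m \<nu>) (q \<nu>) (z \<nu>))"
proof -
  have "p0 (m \<nu>) (q \<nu>) \<noteq> 0" if "\<nu> \<in> {1..N}" for \<nu>
    using open_simplex_bounds(1)[OF simplex[OF assms that]] by simp
  then show ?thesis
    unfolding kernel_def prod.distrib sum_negf[symmetric]
    by (subst exp_sum) (auto intro!: arg_cong2[where f="(*)"] prod.cong simp: powr_def jump_rate_def)
qed

lemma prod_mpow:
  assumes "q \<in> space Q"
  shows "0 < (\<Prod>\<nu>=1..N. mpow (m \<nu>) (q \<nu>) (z \<nu>))" "(\<Prod>\<nu>=1..N. mpow (m \<nu>) (q \<nu>) (z \<nu>)) \<le> 1"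
  by (intro prod_pos prod_le_1 conjI less_imp_le[OF mpow_pos] mpow_pos mpow_le_1 simplex[OF assms]; assumption)+

lemma kernel_pos: "q \<in> space Q \<Longrightarrow> kernel \<tau> q z > 0"
  by (simp only: kernel_exp) (intro mult_pos_pos exp_gt_zero prod_mpow)

lemma kernel_mono:
  assumes q: "q \<in> space Q" and "\<sigma> \<in> {0..1}" "\<tau> \<in> {0..1}" "\<sigma> \<le> \<tau>"
  shows "kernel \<tau> q z \<le> kernel \<sigma> q z"
  unfolding kernel_exp[OF q] using assms jump_rate_nonneg[OF q] prod_mpow[OF q, of z]
  by (intro mult_right_mono) (auto intro!: sum_mono mult_right_mono mono_onD[OF t_mono])

lemma kernel_le_0:
  assumes q: "q \<in> space Q" and "\<tau> \<in> {0..1}"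
  shows "kernel \<tau> q z \<le> kernel 0 q 0"
proof -
  have "kernel \<tau> q z \<le> kernel 0 q z"
    using assms by (intro kernel_mono) auto
  also have "\<dots> \<le> kernel 0 q 0"
    using prod_mpow[OF q, of z] by (simp add: kernel_exp[OF q])
  finally show ?thesis .
qed

lemma kernel_add_block:
  assumes "\<nu> \<in> {1..N}"
  shows "kernel \<tau> q (z + block \<nu> w) = kernel \<tau> q z * mpow (m \<nu>) (q \<nu>) w"
proof -
  have "(\<Prod>\<mu>=1..N. mpow (m \<mu>) (q \<mu>) (block \<nu> w \<mu>)) = mpow (m \<nu>) (q \<nu>) w"
    using assms by (subst prod.remove[of _ \<nu>]) (auto simp: block_simps)
  then show ?thesis
    unfolding kernel_def by (simp add: mpow_add prod.distrib)
qed

lemma p0_measurable: "\<nu> \<in> {1..N} \<Longrightarrow> (\<lambda>q. p0 (m \<nu>) (q \<nu>)) \<in> borel_measurable Q"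
  unfolding p0_def
  by (intro borel_measurable_diff borel_measurable_const borel_measurable_sum coordinate_measurable) auto

lemma mpow_measurable: "\<nu> \<in> {1..N} \<Longrightarrow> (\<lambda>q. mpow (m \<nu>) (q \<nu>) w) \<in> borel_measurable Q"
  unfolding mpow_def
  by (intro borel_measurable_prod borel_measurable_power coordinate_measurable) auto

lemma jump_rate_measurable: "\<nu> \<in> {1..N} \<Longrightarrow> jump_rate \<nu> \<in> borel_measurable Q"
  unfolding jump_rate_def[abs_def] by (intro borel_measurable_uminus borel_measurable_ln p0_measurable)

lemma kernel_measurable: "(\<lambda>q. kernel \<tau> q z) \<in> borel_measurable Q"
  unfolding kernel_def
  by (intro borel_measurable_prod borel_measurable_times powr_real_measurable p0_measurable mpow_measurable
      borel_measurable_const)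

lemma kernel_integrable_0: "integrable Q (\<lambda>q. kernel 0 q 0)"
proof (rule integrableI_nonneg[OF kernel_measurable])
  show "(\<integral>\<^sup>+q. ennreal (kernel 0 q 0) \<partial>Q) < \<infinity>"
    using Q_finite by (simp add: kernel_def)
qed (auto intro: less_imp_le kernel_pos)

lemma kernel_integrable: "\<tau> \<in> {0..1} \<Longrightarrow> integrable Q (\<lambda>q. kernel \<tau> q z)"
  by (rule Bochner_Integration.integrable_bound[OF kernel_integrable_0 kernel_measurable])
     (auto intro!: AE_I2 simp: kernel_le_0 kernel_pos less_imp_le abs_of_pos)

lemma marginal_le: "\<tau> \<in> {0..1} \<Longrightarrow> marginal \<tau> z \<le> marginal 0 0"
  unfolding marginal_def by (intro integral_mono kernel_integrable kernel_le_0) auto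

lemma nn_integral_kernel: "\<tau> \<in> {0..1} \<Longrightarrow> (\<integral>\<^sup>+q. ennreal (kernel \<tau> q z) \<partial>Q) = ennreal (marginal \<tau> z)"
  unfolding marginal_def
  by (intro nn_integral_eq_integral kernel_integrable AE_I2) (auto intro: less_imp_le kernel_pos)

text \<open>
  The prior charges some set of parameters that stay at distance \<open>\<epsilon>\<close> from the boundaries of all
  simplices; there the kernel decays at most geometrically in the total count.
\<close>

lemma marginal_lower_bound:
  obtains c \<epsilon> where "0 < c" "0 < \<epsilon>" "\<epsilon> \<le> 1"
    "\<And>\<tau> z. \<tau> \<in> {0..1} \<Longrightarrow> c * \<epsilon> ^ (\<Sum>\<nu>=1..N. deg (m \<nu>) (z \<nu>)) \<le> marginal \<tau> z"
proof -
  \<comment> \<open>The sets \<open>K j\<close> exhaust the parameter set, so one of them has positive measure.\<close>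
  define K where "K j = {q \<in> space Q. \<forall>\<nu>\<in>{1..N}. 1 / real (Suc j) \<le> p0 (m \<nu>) (q \<nu>)
      \<and> (\<forall>i\<in>{1..m \<nu>}. 1 / real (Suc j) \<le> q \<nu> i)}" for j
  have K_sets [measurable]: "K j \<in> sets Q" for j
    unfolding K_def
    by (intro sets.sets_Collect_finite_All sets.sets_Collect_conj
        borel_measurable_le borel_measurable_const p0_measurable coordinate_measurable finite_atLeastAtMost)
  have "space Q = (\<Union>j. K j)"
  proof (intro equalityI subsetI)
    fix q assume q: "q \<in> space Q"
    define V where "V = insert 1 ((\<lambda>\<nu>. p0 (m \<nu>) (q \<nu>)) ` {1..N} \<union> (\<lambda>(\<nu>, i). q \<nu> i) ` (SIGMA \<nu>:{1..N}. {1..m \<nu>}))"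
    have V: "finite V" "V \<noteq> {}"
      by (simp_all add: V_def)
    have "\<forall>v\<in>V. v > 0"
      using open_simplex_bounds(1,3)[OF simplex[OF q]] by (auto simp: V_def)
    then have "Min V > 0" using V by simp
    then obtain j where j: "1 / real (Suc j) < Min V"
      using nat_approx_posE by blast
    have le: "1 / real (Suc j) \<le> v" if "v \<in> V" for v
      using j V that by (meson Min_le less_imp_le order_trans)
    have "q \<in> K j"
      unfolding K_def
    proof (intro CollectI conjI ballI q le)
      fix \<nu> assume "\<nu> \<in> {1..N}"
      then show "p0 (m \<nu>) (q \<nu>) \<in> V" by (simp add: V_def)
    next
      fix \<nu> i assume "\<nu> \<in> {1..N}" "i \<in> {1..m \<nu>}"
      then show "q \<nu> i \<in> V"
        unfolding V_def by (intro insertI2 UnI2 image_eqI[of _ _ "(\<nu>, i)"]) auto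
    qed
    then show "q \<in> (\<Union>j. K j)" by blast
  qed (auto simp: K_def)
  then have "\<exists>j. emeasure Q (K j) \<noteq> 0"
    using Q_nonzero emeasure_UN_eq_0[of Q K] K_sets by (metis UNIV_I image_subset_iff)
  then obtain j where j: "emeasure Q (K j) \<noteq> 0" by blast
  define \<epsilon> where "\<epsilon> = 1 / real (Suc j)"
  define R where "R = (\<Sum>\<nu>=1..N. t \<nu> 1)"
  have \<epsilon>: "0 < \<epsilon>" "\<epsilon> \<le> 1" by (auto simp: \<epsilon>_def)
  have lower: "\<epsilon> powr R * \<epsilon> ^ (\<Sum>\<nu>=1..N. deg (m \<nu>) (z \<nu>)) \<le> kernel \<tau> q z"
    if q: "q \<in> K j" and \<tau>: "\<tau> \<in> {0..1}" for q z \<tau>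
  proof -
    have "\<epsilon> powr R * \<epsilon> ^ (\<Sum>\<nu>=1..N. deg (m \<nu>) (z \<nu>)) = (\<Prod>\<nu>=1..N. \<epsilon> powr t \<nu> 1 * (\<Prod>i=1..m \<nu>. \<epsilon> ^ z \<nu> i))"
      using \<epsilon> by (simp add: R_def powr_sum prod.distrib power_sum deg_def)
    also have "\<dots> \<le> kernel \<tau> q z"
      unfolding kernel_def mpow_def
    proof (intro prod_mono conjI mult_mono mult_nonneg_nonneg prod_nonneg)
      fix \<nu> assume \<nu>: "\<nu> \<in> {1..N}"
      have "\<epsilon> \<le> p0 (m \<nu>) (q \<nu>)"
        using q \<nu> by (auto simp: K_def \<epsilon>_def)
      moreover have "t \<nu> \<tau> \<le> t \<nu> 1"
        using \<tau> by (intro mono_onD[OF t_mono[OF \<nu>]]) auto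
      moreover have "t \<nu> \<tau> > 0" using t_pos[OF \<nu> \<tau>] .
      ultimately show "\<epsilon> powr t \<nu> 1 \<le> p0 (m \<nu>) (q \<nu>) powr t \<nu> \<tau>"
        using \<epsilon> by (meson order_trans powr_mono' powr_mono2 less_imp_le)
    next
      fix \<nu> i assume "\<nu> \<in> {1..N}" "i \<in> {1..m \<nu>}"
      then show "\<epsilon> ^ z \<nu> i \<le> q \<nu> i ^ z \<nu> i"
        using q \<epsilon> by (intro power_mono) (auto simp: K_def \<epsilon>_def)
    qed (use \<epsilon> in auto)
    finally show ?thesis .
  qed
  have fin: "emeasure Q (K j) < \<infinity>"
  proof -
    have "ennreal (\<epsilon> powr R) * emeasure Q (K j) = (\<integral>\<^sup>+q. ennreal (\<epsilon> powr R) * indicator (K j) q \<partial>Q)"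
      by (simp add: nn_integral_cmult)
    also have "\<dots> \<le> (\<integral>\<^sup>+q. ennreal (kernel 0 q 0) \<partial>Q)"
      using lower[of _ 0 0] by (intro nn_integral_mono) (auto simp: indicator_def intro!: ennreal_leI)
    also have "\<dots> < \<infinity>"
      by (simp add: nn_integral_kernel)
    finally show ?thesis
      using \<epsilon> by (auto simp: ennreal_mult_less_top)
  qed
  show ?thesis
  proof
    show "0 < \<epsilon> powr R * measure Q (K j)"
      using \<epsilon> j fin by (auto simp: measure_def enn2real_positive_iff top.not_eq_extremum zero_less_iff_neq_zero)
    fix \<tau> :: real and z assume \<tau>: "\<tau> \<in> {0..1}"
    let ?C = "\<epsilon> powr R * \<epsilon> ^ (\<Sum>\<nu>=1..N. deg (m \<nu>) (z \<nu>))"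
    have "?C * measure Q (K j) = (LINT q|Q. ?C * indicator (K j) q)"
      using fin by simp
    also have "\<dots> \<le> marginal \<tau> z"
      unfolding marginal_def
    proof (intro integral_mono kernel_integrable \<tau> integrable_mult_right)
      show "integrable Q (indicator (K j) :: _ \<Rightarrow> real)"
        using fin by (simp add: integrable_indicator_iff)
    qed (use lower[OF _ \<tau>, of _ z] in \<open>auto simp: indicator_def less_imp_le kernel_pos\<close>)
    finally show "\<epsilon> powr R * measure Q (K j) * \<epsilon> ^ (\<Sum>\<nu>=1..N. deg (m \<nu>) (z \<nu>)) \<le> marginal \<tau> z"
      by (simp add: mult.assoc mult.left_commute mult.commute)
  qed (use \<epsilon> in auto)
qed

lemma marginal_pos:
  assumes "\<tau> \<in> {0..1}"
  shows "marginal \<tau> z > 0"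
proof -
  obtain c \<epsilon> where "0 < c" "0 < \<epsilon>" "c * \<epsilon> ^ (\<Sum>\<nu>=1..N. deg (m \<nu>) (z \<nu>)) \<le> marginal \<tau> z"
    using marginal_lower_bound assms by metis
  then show ?thesis
    by (meson less_le_trans mult_pos_pos zero_less_power)
qed

lemma log_marginal_nonneg: "\<tau> \<in> {0..1} \<Longrightarrow> log_marginal \<tau> z \<ge> 0"
  unfolding log_marginal_def using marginal_pos[of \<tau> z] marginal_pos[of 0 0] marginal_le[of \<tau> z] by simp

lemma log_marginal_upper_bound:
  obtains A B where "0 \<le> A" "0 \<le> B"
    "\<And>\<tau> z. \<tau> \<in> {0..1} \<Longrightarrow> log_marginal \<tau> z \<le> A + B * real (\<Sum>\<nu>=1..N. deg (m \<nu>) (z \<nu>))"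
proof -
  obtain c \<epsilon> where c: "0 < c" "0 < \<epsilon>" "\<epsilon> \<le> 1"
    "\<And>\<tau> z. \<tau> \<in> {0..1} \<Longrightarrow> c * \<epsilon> ^ (\<Sum>\<nu>=1..N. deg (m \<nu>) (z \<nu>)) \<le> marginal \<tau> z"
    using marginal_lower_bound by blast
  show ?thesis
  proof
    show "0 \<le> \<bar>ln (marginal 0 0) - ln c\<bar>" "0 \<le> - ln \<epsilon>"
      using c by auto
    fix \<tau> :: real and z assume \<tau>: "\<tau> \<in> {0..1}"
    let ?d = "\<Sum>\<nu>=1..N. deg (m \<nu>) (z \<nu>)"
    have "ln c + real ?d * ln \<epsilon> = ln (c * \<epsilon> ^ ?d)"
      using c by (simp add: ln_mult ln_realpow del: of_nat_sum)
    also have "\<dots> \<le> ln (marginal \<tau> z)"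
      using c \<tau> marginal_pos[OF \<tau>, of z] by (subst ln_le_cancel_iff) auto
    finally show "log_marginal \<tau> z \<le> \<bar>ln (marginal 0 0) - ln c\<bar> + - ln \<epsilon> * real ?d"
      using marginal_pos[of 0 0] marginal_pos[OF \<tau>, of z]
      by (simp add: log_marginal_def ln_div algebra_simps del: of_nat_sum)
  qed
qed

lemma t_continuous: "\<nu> \<in> {1..N} \<Longrightarrow> continuous_on {0..1} (t \<nu>)"
  by (intro DERIV_continuous_on[where D = "t' \<nu>"] t_deriv) auto

lemma kernel_tendsto:
  assumes q: "q \<in> space Q" and \<tau>: "\<tau> \<in> {0..1}"
  shows "((\<lambda>\<sigma>. kernel \<sigma> q z) \<longlongrightarrow> kernel \<tau> q z) (at \<tau> within {0..1})"
  unfolding kernel_exp[OF q]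
  using t_continuous \<tau> by (intro tendsto_intros) (auto simp: continuous_on_def)

lemma marginal_continuous: "continuous_on {0..1} (\<lambda>\<tau>. marginal \<tau> z)"
  unfolding continuous_on_def marginal_def
proof
  fix \<tau> :: real assume \<tau>: "\<tau> \<in> {0..1}"
  show "((\<lambda>\<sigma>. LINT q|Q. kernel \<sigma> q z) \<longlongrightarrow> (LINT q|Q. kernel \<tau> q z)) (at \<tau> within {0..1})"
  proof (rule integral_dominated_convergence_at_within(1)[where w = "\<lambda>q. kernel 0 q 0"])
    show "\<forall>\<^sub>F \<sigma> in at \<tau> within {0..1}. \<forall>q\<in>space Q. \<bar>kernel \<sigma> q z\<bar> \<le> kernel 0 q 0"
      unfolding eventually_at_filter
      by (auto simp: kernel_pos abs_of_pos kernel_le_0)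
    show "at \<tau> within {0..1} \<noteq> bot"
      using \<tau> by (simp add: trivial_limit_within islimpt_Icc)
  qed (use \<tau> kernel_tendsto in \<open>auto intro: kernel_measurable kernel_integrable_0\<close>)
qed

lemma log_marginal_continuous: "continuous_on {0..1} (\<lambda>\<tau>. log_marginal \<tau> z)"
  unfolding log_marginal_def
  using marginal_pos[of 0 0] marginal_pos[of _ z]
  by (intro continuous_intros marginal_continuous) (auto simp: less_imp_neq[symmetric])


section \<open>Differentiating the marginal likelihood\<close>

text \<open>
  The last times at which some block has its initial size. The derivative of the kernel contains
  the factor \<open>jump_rate\<close>, which the prior need not integrate at the initial size: only before such a
  time, when the block does not move, and after it, when a positive power of \<open>p\<^sub>0\<close> is to spare, is the
  derivative under control.
\<close>

definition departure_times :: "real set" where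
  "departure_times = (\<Union>\<nu>\<in>{1..N}. {\<tau>\<in>{0..1}. t \<nu> \<tau> = t \<nu> 0 \<and> (\<forall>\<sigma>\<in>{0..1}. \<tau> < \<sigma> \<longrightarrow> t \<nu> 0 < t \<nu> \<sigma>)})"

lemma finite_departure_times: "finite departure_times"
  unfolding departure_times_def
proof (intro finite_UN_I finite_atLeastAtMost)
  fix \<nu>
  let ?S = "{\<tau>\<in>{0..1}. t \<nu> \<tau> = t \<nu> 0 \<and> (\<forall>\<sigma>\<in>{0..1}. \<tau> < \<sigma> \<longrightarrow> t \<nu> 0 < t \<nu> \<sigma>)}"
  have "\<not> x < y" if "x \<in> ?S" "y \<in> ?S" for x y
  proof
    assume "x < y"
    then have "t \<nu> 0 < t \<nu> y"
      using that by blast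
    then show False
      using that by simp
  qed
  then have "x = y" if "x \<in> ?S" "y \<in> ?S" for x y
    using that by (meson linorder_neqE)
  then have "?S = {} \<or> (\<exists>x. ?S = {x})" by blast
  then show "finite ?S"
    by (elim disjE exE) (simp_all only: finite.emptyI finite_insert)
qed

lemma t_locally:
  assumes \<nu>: "\<nu> \<in> {1..N}" and \<tau>: "\<tau> \<in> {0<..<1} - departure_times"
  shows "t \<nu> 0 < t \<nu> \<tau> \<or> (\<forall>\<^sub>F \<sigma> in at \<tau>. t \<nu> \<sigma> = t \<nu> \<tau>) \<and> t' \<nu> \<tau> = 0"
proof (cases "t \<nu> 0 < t \<nu> \<tau>")
  case False
  have mono: "t \<nu> x \<le> t \<nu> y" if "x \<in> {0..1}" "y \<in> {0..1}" "x \<le> y" for x y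
    using mono_onD[OF t_mono[OF \<nu>] that] .
  have eq: "t \<nu> \<tau> = t \<nu> 0"
    using False mono[of 0 \<tau>] \<tau> by auto
  have "\<not> (\<forall>\<sigma>\<in>{0..1}. \<tau> < \<sigma> \<longrightarrow> t \<nu> 0 < t \<nu> \<sigma>)"
  proof
    assume "\<forall>\<sigma>\<in>{0..1}. \<tau> < \<sigma> \<longrightarrow> t \<nu> 0 < t \<nu> \<sigma>"
    then have "\<tau> \<in> departure_times"
      unfolding departure_times_def using \<nu> \<tau> eq by (intro UN_I[of \<nu>] CollectI conjI) auto
    then show False
      using \<tau> by blast
  qed
  then obtain \<sigma> where \<sigma>: "\<sigma> \<in> {0..1}" "\<tau> < \<sigma>" "t \<nu> \<sigma> \<le> t \<nu> 0"
    by (meson not_less)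
  have const: "t \<nu> x = t \<nu> \<tau>" if "x \<in> {0<..<\<sigma>}" for x
  proof -
    have "t \<nu> 0 \<le> t \<nu> x" "t \<nu> x \<le> t \<nu> \<sigma>"
      using that \<sigma>(1) by (auto intro!: mono)
    with \<sigma>(3) eq show ?thesis by linarith
  qed
  have ev: "\<forall>\<^sub>F x in nhds \<tau>. t \<nu> x = t \<nu> \<tau>"
    unfolding eventually_nhds
  proof (intro exI[of _ "{0<..<\<sigma>}"] conjI ballI const)
    show "\<tau> \<in> {0<..<\<sigma>}"
      using \<tau> \<sigma>(2) by simp
  qed auto
  have "(t \<nu> has_real_derivative t' \<nu> \<tau>) (at \<tau>)"
    using t_deriv[OF \<nu>, of \<tau>] \<tau> by (auto simp: at_within_Icc_at)
  moreover have "(t \<nu> has_real_derivative 0) (at \<tau>)"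
    using DERIV_cong_ev[OF refl ev refl, of 0] by simp
  ultimately have "t' \<nu> \<tau> = 0"
    by (rule DERIV_unique)
  then show ?thesis
    using ev by (simp add: eventually_nhds_conv_at)
qed simp

lemma t'_nonneg:
  assumes \<nu>: "\<nu> \<in> {1..N}" and \<tau>: "\<tau> \<in> {0..1}"
  shows "t' \<nu> \<tau> \<ge> 0"
proof (rule tendsto_lowerbound)
  show "((\<lambda>\<sigma>. (t \<nu> \<sigma> - t \<nu> \<tau>) / (\<sigma> - \<tau>)) \<longlongrightarrow> t' \<nu> \<tau>) (at \<tau> within {0..1})"
    using t_deriv[OF assms] by (simp add: has_field_derivative_iff)
  have "0 \<le> (t \<nu> \<sigma> - t \<nu> \<tau>) / (\<sigma> - \<tau>)" if "\<sigma> \<in> {0..1}" "\<sigma> \<noteq> \<tau>" for \<sigma>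
    using mono_onD[OF t_mono[OF \<nu>], of \<sigma> \<tau>] mono_onD[OF t_mono[OF \<nu>], of \<tau> \<sigma>] that \<tau>
    by (cases "\<sigma> < \<tau>") (auto intro: divide_nonpos_neg)
  then show "\<forall>\<^sub>F \<sigma> in at \<tau> within {0..1}. 0 \<le> (t \<nu> \<sigma> - t \<nu> \<tau>) / (\<sigma> - \<tau>)"
    by (auto simp: eventually_at_filter)
  show "at \<tau> within {0..1} \<noteq> bot"
    using \<tau> by (simp add: trivial_limit_within)
qed

text \<open>
  Difference quotients of the kernel are dominated by a multiple of the kernel at time 0: a block in the
  moving set \<open>J\<close> contributes an extra factor \<open>exp (- \<delta> * jump_rate)\<close>, which absorbs the factor
  \<open>jump_rate\<close> that comes from the derivative since \<open>x exp (- x) \<le> 1\<close>.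
\<close>

lemma kernel_difference_bound:
  assumes q: "q \<in> space Q" and J: "J \<subseteq> {1..N}" and \<delta>: "\<delta> > 0"
    and \<sigma>\<tau>: "\<sigma> \<in> {0..1}" "\<tau> \<in> {0..1}"
    and moving: "\<And>\<nu>. \<nu> \<in> J \<Longrightarrow> t \<nu> 0 + \<delta> \<le> t \<nu> \<sigma>" "\<And>\<nu>. \<nu> \<in> J \<Longrightarrow> t \<nu> 0 + \<delta> \<le> t \<nu> \<tau>"
      "\<And>\<nu>. \<nu> \<in> J \<Longrightarrow> \<bar>t \<nu> \<sigma> - t \<nu> \<tau>\<bar> \<le> L * \<bar>\<sigma> - \<tau>\<bar>"
    and resting: "\<And>\<nu>. \<nu> \<in> {1..N} - J \<Longrightarrow> t \<nu> \<sigma> = t \<nu> \<tau>"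
    and L: "L \<ge> 0"
  shows "\<bar>kernel \<sigma> q z - kernel \<tau> q z\<bar> \<le> L / \<delta> * kernel 0 q 0 * \<bar>\<sigma> - \<tau>\<bar>"
proof -
  define E where "E \<tau> = (\<Sum>\<nu>=1..N. t \<nu> \<tau> * jump_rate \<nu> q)" for \<tau>
  define B where "B = (\<Sum>\<nu>\<in>J. jump_rate \<nu> q)"
  let ?P = "\<Prod>\<nu>=1..N. mpow (m \<nu>) (q \<nu>) (z \<nu>)"
  have finJ: "finite J"
    using J by (rule finite_subset) simp
  have jump_rate: "jump_rate \<nu> q \<ge> 0" if "\<nu> \<in> {1..N}" for \<nu>
    using jump_rate_nonneg[OF q that] .
  have B: "B \<ge> 0"
    unfolding B_def using J jump_rate by (intro sum_nonneg) auto
  have lower: "E 0 + \<delta> * B \<le> E \<rho>" if \<rho>: "\<rho> = \<sigma> \<or> \<rho> = \<tau>" for \<rho>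
  proof -
    have "E 0 + \<delta> * B = (\<Sum>\<nu>=1..N. (t \<nu> 0 + (if \<nu> \<in> J then \<delta> else 0)) * jump_rate \<nu> q)"
    proof -
      have "\<delta> * B = (\<Sum>\<nu>\<in>{1..N} \<inter> J. \<delta> * jump_rate \<nu> q)"
        using J by (simp add: B_def sum_distrib_left Int_absorb1)
      also have "\<dots> = (\<Sum>\<nu>=1..N. if \<nu> \<in> J then \<delta> * jump_rate \<nu> q else 0)"
        by (rule sum.inter_restrict) simp
      finally show ?thesis
        unfolding E_def by (simp only: sum.distrib[symmetric]) (intro sum.cong refl, auto simp: distrib_right)
    qed
    also have "\<dots> \<le> E \<rho>"
      unfolding E_def
    proof (intro sum_mono mult_right_mono jump_rate)
      fix \<nu> assume "\<nu> \<in> {1..N}"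
      moreover have "\<rho> \<in> {0..1}" using \<rho> \<sigma>\<tau> by auto
      ultimately show "t \<nu> 0 + (if \<nu> \<in> J then \<delta> else 0) \<le> t \<nu> \<rho>"
        using moving \<rho> mono_onD[OF t_mono, of \<nu> 0 \<rho>] by auto
    qed
    finally show ?thesis .
  qed
  have diff: "\<bar>E \<sigma> - E \<tau>\<bar> \<le> L * \<bar>\<sigma> - \<tau>\<bar> * B"
  proof -
    have "E \<sigma> - E \<tau> = (\<Sum>\<nu>\<in>J. (t \<nu> \<sigma> - t \<nu> \<tau>) * jump_rate \<nu> q)"
      unfolding E_def sum_subtractf[symmetric] left_diff_distrib[symmetric]
      using J resting by (intro sum.mono_neutral_right) auto
    also have "\<bar>\<dots>\<bar> \<le> (\<Sum>\<nu>\<in>J. \<bar>(t \<nu> \<sigma> - t \<nu> \<tau>) * jump_rate \<nu> q\<bar>)"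
      by (rule sum_abs)
    also have "\<dots> \<le> (\<Sum>\<nu>\<in>J. L * \<bar>\<sigma> - \<tau>\<bar> * jump_rate \<nu> q)"
    proof (intro sum_mono)
      fix \<nu> assume \<nu>: "\<nu> \<in> J"
      then have "0 \<le> jump_rate \<nu> q"
        using J by (intro jump_rate) auto
      then show "\<bar>(t \<nu> \<sigma> - t \<nu> \<tau>) * jump_rate \<nu> q\<bar> \<le> L * \<bar>\<sigma> - \<tau>\<bar> * jump_rate \<nu> q"
        using moving(3)[OF \<nu>] by (simp add: abs_mult mult_right_mono)
    qed
    finally show ?thesis
      by (simp add: B_def sum_distrib_left)
  qed
  have exp_diff: "\<bar>exp (- x) - exp (- y)\<bar> \<le> \<bar>x - y\<bar> * exp (- c)" if "c \<le> x" "c \<le> y" for x y c :: real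
  proof -
    have *: "exp (- x) - exp (- y) \<le> (y - x) * exp (- c)" if "c \<le> x" "x \<le> y" for x y
    proof -
      have "exp (- x) - exp (- y) = exp (- x) * (1 - exp (x - y))"
        by (simp add: right_diff_distrib exp_add[symmetric])
      also have "\<dots> \<le> exp (- c) * (y - x)"
      proof (intro mult_mono)
        show "1 - exp (x - y) \<le> y - x"
          using exp_ge_add_one_self[of "x - y"] by linarith
      qed (use that in auto)
      finally show ?thesis by (simp add: mult.commute)
    qed
    show ?thesis
      using *[of x y] *[of y x] that by (cases "x \<le> y") (auto simp: abs_if)
  qed
  have "\<bar>kernel \<sigma> q z - kernel \<tau> q z\<bar> = \<bar>exp (- E \<sigma>) - exp (- E \<tau>)\<bar> * ?P"
    using prod_mpow[OF q, of z] by (simp add: kernel_exp[OF q] E_def abs_mult flip: left_diff_distrib)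
  also have "\<dots> \<le> \<bar>exp (- E \<sigma>) - exp (- E \<tau>)\<bar> * 1"
    using prod_mpow[OF q, of z] by (intro mult_left_mono) auto
  also have "\<dots> \<le> \<bar>E \<sigma> - E \<tau>\<bar> * exp (- (E 0 + \<delta> * B))"
    using exp_diff[OF lower lower] by simp
  also have "\<dots> \<le> (L * \<bar>\<sigma> - \<tau>\<bar> * B) * exp (- (E 0 + \<delta> * B))"
    using diff by (intro mult_right_mono) auto
  also have "\<dots> = L / \<delta> * exp (- E 0) * \<bar>\<sigma> - \<tau>\<bar> * ((\<delta> * B) * exp (- (\<delta> * B)))"
  proof -
    have "exp (- (E 0 + \<delta> * B)) = exp (- E 0) * exp (- (\<delta> * B))"
      by (simp add: exp_add[symmetric])
    then show ?thesis
      using \<delta> by simp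
  qed
  also have "\<dots> \<le> L / \<delta> * exp (- E 0) * \<bar>\<sigma> - \<tau>\<bar> * 1"
  proof (intro mult_left_mono)
    have "\<delta> * B \<le> exp (\<delta> * B)"
      using exp_ge_add_one_self[of "\<delta> * B"] by linarith
    then show "(\<delta> * B) * exp (- (\<delta> * B)) \<le> 1"
      by (simp add: exp_minus divide_inverse[symmetric])
  qed (use L \<delta> in auto)
  also have "exp (- E 0) = kernel 0 q 0"
    by (simp add: kernel_exp[OF q] E_def)
  finally show ?thesis by simp
qed

text \<open>
  The sum of \<open>F\<close> over the jumps of block \<open>\<nu>\<close>, weighted by \<open>levy_coeff\<close> only; the power \<open>p\<^bsup>w\<^esup>\<close> that
  completes the jump rate is left to \<open>F\<close>, since the posterior replaces it by its own estimate.
\<close>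

definition jump_sum :: "nat \<Rightarrow> ((nat \<Rightarrow> nat) \<Rightarrow> ennreal) \<Rightarrow> ennreal" where
  "jump_sum \<nu> F = (\<integral>\<^sup>+w. ennreal (levy_coeff (m \<nu>) w) * F w \<partial>count_space (count_vectors (m \<nu>)))"

text \<open>
  Away from departure times this is minus the derivative of \<open>marginal\<close>, written as a sum over jumps.
  The values lie in \<open>[0, \<infinity>]\<close>, because the sum can diverge at departure times.
\<close>

definition decay :: "real \<Rightarrow> (nat \<Rightarrow> nat \<Rightarrow> nat) \<Rightarrow> ennreal" where
  "decay \<tau> z = (\<Sum>\<nu>=1..N. ennreal (t' \<nu> \<tau>) *
     jump_sum \<nu> (\<lambda>w. ennreal (marginal \<tau> (z + block \<nu> w))))"

text \<open>
  Adding a jump \<open>w\<close> to the count multiplies the kernel by \<open>q\<^bsup>w\<^esup>\<close>, so that the sum over jumps restores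
  the logarithm in the derivative of the kernel.
\<close>

lemma decay_eq_nn_integral:
  assumes \<tau>: "\<tau> \<in> {0..1}"
  shows "decay \<tau> z = (\<integral>\<^sup>+q. ennreal ((\<Sum>\<nu>=1..N. t' \<nu> \<tau> * jump_rate \<nu> q) * kernel \<tau> q z) \<partial>Q)"
proof -
  have block: "jump_sum \<nu> (\<lambda>w. ennreal (marginal \<tau> (z + block \<nu> w)))
      = (\<integral>\<^sup>+q. ennreal (jump_rate \<nu> q) * ennreal (kernel \<tau> q z) \<partial>Q)" if \<nu>: "\<nu> \<in> {1..N}" for \<nu>
  proof -
    let ?W = "count_space (count_vectors (m \<nu>))"
    have "jump_sum \<nu> (\<lambda>w. ennreal (marginal \<tau> (z + block \<nu> w)))
       = (\<integral>\<^sup>+w. \<integral>\<^sup>+q. ennreal (levy_coeff (m \<nu>) w) * ennreal (kernel \<tau> q (z + block \<nu> w)) \<partial>Q \<partial>?W)"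
      unfolding jump_sum_def
    proof (intro nn_integral_cong)
      fix w
      have "(\<lambda>q. ennreal (kernel \<tau> q (z + block \<nu> w))) \<in> borel_measurable Q"
        using kernel_measurable by measurable
      then show "ennreal (levy_coeff (m \<nu>) w) * ennreal (marginal \<tau> (z + block \<nu> w))
        = (\<integral>\<^sup>+q. ennreal (levy_coeff (m \<nu>) w) * ennreal (kernel \<tau> q (z + block \<nu> w)) \<partial>Q)"
        by (subst nn_integral_cmult) (simp_all only: nn_integral_kernel[OF \<tau>])
    qed
    also have "\<dots> = (\<integral>\<^sup>+q. \<integral>\<^sup>+w. ennreal (levy_coeff (m \<nu>) w) * ennreal (kernel \<tau> q (z + block \<nu> w)) \<partial>?W \<partial>Q)"
      by (intro nn_integral_count_space_nn_integral[symmetric] countable_count_vectors)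
         (use kernel_measurable in measurable)
    also have "\<dots> = (\<integral>\<^sup>+q. ennreal (jump_rate \<nu> q) * ennreal (kernel \<tau> q z) \<partial>Q)"
    proof (intro nn_integral_cong)
      fix q assume q: "q \<in> space Q"
      have "(\<integral>\<^sup>+w. ennreal (levy_coeff (m \<nu>) w) * ennreal (kernel \<tau> q (z + block \<nu> w)) \<partial>?W)
         = (\<integral>\<^sup>+w. ennreal (levy_coeff (m \<nu>) w) * ennreal (mpow (m \<nu>) (q \<nu>) w) * ennreal (kernel \<tau> q z) \<partial>?W)"
        using kernel_pos[OF q] mpow_pos[OF simplex[OF q \<nu>]]
        by (simp add: kernel_add_block[OF \<nu>] ennreal_mult less_imp_le mult.assoc mult.commute mult.left_commute)
      also have "\<dots> = ennreal (jump_rate \<nu> q) * ennreal (kernel \<tau> q z)"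
        by (simp add: nn_integral_multc levy_total_mass[OF simplex[OF q \<nu>]] jump_rate_def)
      finally show "(\<integral>\<^sup>+w. ennreal (levy_coeff (m \<nu>) w) * ennreal (kernel \<tau> q (z + block \<nu> w)) \<partial>?W)
         = ennreal (jump_rate \<nu> q) * ennreal (kernel \<tau> q z)" .
    qed
    finally show ?thesis .
  qed
  have "decay \<tau> z = (\<Sum>\<nu>=1..N. ennreal (t' \<nu> \<tau>) * (\<integral>\<^sup>+q. ennreal (jump_rate \<nu> q) * ennreal (kernel \<tau> q z) \<partial>Q))"
    unfolding decay_def by (intro sum.cong refl arg_cong2[where f="(*)"] block)
  also have "\<dots> = (\<integral>\<^sup>+q. (\<Sum>\<nu>=1..N. ennreal (t' \<nu> \<tau>) * (ennreal (jump_rate \<nu> q) * ennreal (kernel \<tau> q z))) \<partial>Q)"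
    using kernel_measurable jump_rate_measurable
    by (subst nn_integral_sum) (auto simp: nn_integral_cmult)
  also have "\<dots> = (\<integral>\<^sup>+q. ennreal ((\<Sum>\<nu>=1..N. t' \<nu> \<tau> * jump_rate \<nu> q) * kernel \<tau> q z) \<partial>Q)"
  proof (intro nn_integral_cong)
    fix q assume q: "q \<in> space Q"
    have "(\<Sum>\<nu>=1..N. ennreal (t' \<nu> \<tau>) * (ennreal (jump_rate \<nu> q) * ennreal (kernel \<tau> q z)))
        = (\<Sum>\<nu>=1..N. ennreal (t' \<nu> \<tau> * jump_rate \<nu> q * kernel \<tau> q z))"
      using q \<tau> by (intro sum.cong refl) (simp add: ennreal_mult t'_nonneg jump_rate_nonneg kernel_pos less_imp_le mult.assoc)
    also have "\<dots> = ennreal (\<Sum>\<nu>=1..N. t' \<nu> \<tau> * jump_rate \<nu> q * kernel \<tau> q z)"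
      using q \<tau> by (intro sum_ennreal mult_nonneg_nonneg t'_nonneg jump_rate_nonneg less_imp_le[OF kernel_pos])
    finally show "(\<Sum>\<nu>=1..N. ennreal (t' \<nu> \<tau>) * (ennreal (jump_rate \<nu> q) * ennreal (kernel \<tau> q z)))
        = ennreal ((\<Sum>\<nu>=1..N. t' \<nu> \<tau> * jump_rate \<nu> q) * kernel \<tau> q z)"
      by (simp add: sum_distrib_right)
  qed
  finally show ?thesis .
qed

lemma kernel_has_derivative:
  assumes q: "q \<in> space Q" and \<tau>: "\<tau> \<in> {0<..<1}"
  shows "((\<lambda>\<tau>. kernel \<tau> q z) has_real_derivative - ((\<Sum>\<nu>=1..N. t' \<nu> \<tau> * jump_rate \<nu> q) * kernel \<tau> q z)) (at \<tau>)"
proof -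
  have t: "(t \<nu> has_real_derivative t' \<nu> \<tau>) (at \<tau>)" if "\<nu> \<in> {1..N}" for \<nu>
    using t_deriv[OF that, of \<tau>] \<tau> by (auto simp: at_within_Icc_at)
  have "((\<lambda>\<tau>. \<Sum>\<nu>=1..N. t \<nu> \<tau> * jump_rate \<nu> q) has_real_derivative (\<Sum>\<nu>=1..N. t' \<nu> \<tau> * jump_rate \<nu> q)) (at \<tau>)"
    by (intro DERIV_sum DERIV_cmult_right t)
  from DERIV_cmult_right[OF DERIV_fun_exp[OF DERIV_minus[OF this]], of "\<Prod>\<nu>=1..N. mpow (m \<nu>) (q \<nu>) (z \<nu>)"]
  show ?thesis
    unfolding kernel_exp[OF q] by (simp add: mult.commute mult.left_commute)
qed

lemma marginal_has_derivative:
  assumes \<tau>: "\<tau> \<in> {0<..<1} - departure_times"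
  shows "((\<lambda>\<tau>. marginal \<tau> z) has_real_derivative - enn2real (decay \<tau> z)) (at \<tau>)" (is ?der)
    and "decay \<tau> z < \<infinity>"
proof -
  \<comment> \<open>The blocks in \<open>J\<close> have left their initial size, by at least \<open>2 * \<delta>\<close>, so near \<open>\<tau>\<close> a margin \<open>\<delta>\<close> remains.\<close>
  define J where "J = {\<nu>\<in>{1..N}. t \<nu> 0 < t \<nu> \<tau>}"
  define \<delta> where "\<delta> = Min (insert 1 ((\<lambda>\<nu>. (t \<nu> \<tau> - t \<nu> 0) / 2) ` J))"
  define L where "L = (\<Sum>\<nu>=1..N. \<bar>t' \<nu> \<tau>\<bar> + 1)"
  let ?D = "\<lambda>q. (\<Sum>\<nu>=1..N. t' \<nu> \<tau> * jump_rate \<nu> q) * kernel \<tau> q z"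
  have \<tau>01: "\<tau> \<in> {0..1}" "\<tau> \<in> {0<..<1}" using \<tau> by auto
  have finJ: "finite J" by (simp add: J_def)
  have \<delta>: "\<delta> > 0" unfolding \<delta>_def using finJ by (auto simp: J_def)
  have \<delta>_le: "\<delta> \<le> (t \<nu> \<tau> - t \<nu> 0) / 2" if "\<nu> \<in> J" for \<nu>
    unfolding \<delta>_def using finJ that by (intro Min_le) auto
  have L: "L \<ge> 0" unfolding L_def by (intro sum_nonneg) auto
  have t: "(t \<nu> has_real_derivative t' \<nu> \<tau>) (at \<tau>)" if "\<nu> \<in> {1..N}" for \<nu>
    using t_deriv[OF that, of \<tau>] \<tau> by (auto simp: at_within_Icc_at)
  have moving: "\<forall>\<^sub>F \<sigma> in at \<tau>. \<forall>\<nu>\<in>J. t \<nu> 0 + \<delta> \<le> t \<nu> \<sigma>"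
  proof (intro eventually_ball_finite finJ ballI)
    fix \<nu> assume \<nu>: "\<nu> \<in> J"
    then have "t \<nu> \<midarrow>\<tau>\<rightarrow> t \<nu> \<tau>"
      using t[of \<nu>] by (auto simp: J_def intro: DERIV_isCont[unfolded isCont_def])
    moreover have "t \<nu> 0 + \<delta> < t \<nu> \<tau>"
      using \<delta>_le[OF \<nu>] \<nu> by (auto simp: J_def)
    ultimately have "\<forall>\<^sub>F \<sigma> in at \<tau>. t \<nu> 0 + \<delta> < t \<nu> \<sigma>"
      by (rule order_tendstoD(1))
    then show "\<forall>\<^sub>F \<sigma> in at \<tau>. t \<nu> 0 + \<delta> \<le> t \<nu> \<sigma>"
      by eventually_elim simp
  qed
  have lipschitz: "\<forall>\<^sub>F \<sigma> in at \<tau>. \<forall>\<nu>\<in>{1..N}. \<bar>t \<nu> \<sigma> - t \<nu> \<tau>\<bar> \<le> L * \<bar>\<sigma> - \<tau>\<bar>"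
  proof (intro eventually_ball_finite finite_atLeastAtMost ballI)
    fix \<nu> assume \<nu>: "\<nu> \<in> {1..N}"
    have "((\<lambda>\<sigma>. \<bar>(t \<nu> \<sigma> - t \<nu> \<tau>) / (\<sigma> - \<tau>)\<bar>) \<longlongrightarrow> \<bar>t' \<nu> \<tau>\<bar>) (at \<tau>)"
      using t[OF \<nu>] by (intro tendsto_rabs) (simp add: has_field_derivative_iff)
    then have "\<forall>\<^sub>F \<sigma> in at \<tau>. \<bar>(t \<nu> \<sigma> - t \<nu> \<tau>) / (\<sigma> - \<tau>)\<bar> < \<bar>t' \<nu> \<tau>\<bar> + 1"
      by (rule order_tendstoD(2)) simp
    then show "\<forall>\<^sub>F \<sigma> in at \<tau>. \<bar>t \<nu> \<sigma> - t \<nu> \<tau>\<bar> \<le> L * \<bar>\<sigma> - \<tau>\<bar>"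
      using eventually_neq_at_within[of \<tau> \<tau> UNIV]
    proof eventually_elim
      case (elim \<sigma>)
      have "\<bar>t' \<nu> \<tau>\<bar> + 1 \<le> L"
        unfolding L_def using \<nu> by (intro member_le_sum) auto
      then have "\<bar>(t \<nu> \<sigma> - t \<nu> \<tau>) / (\<sigma> - \<tau>)\<bar> \<le> L" using elim by linarith
      then show ?case using elim by (simp add: abs_divide field_simps)
    qed
  qed
  have resting: "\<forall>\<^sub>F \<sigma> in at \<tau>. \<forall>\<nu>\<in>{1..N} - J. t \<nu> \<sigma> = t \<nu> \<tau>"
  proof (intro eventually_ball_finite ballI finite_Diff finite_atLeastAtMost)
    fix \<nu> assume "\<nu> \<in> {1..N} - J"
    then show "\<forall>\<^sub>F \<sigma> in at \<tau>. t \<nu> \<sigma> = t \<nu> \<tau>"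
      using t_locally[OF _ \<tau>, of \<nu>] unfolding J_def by blast
  qed
  have inside: "\<forall>\<^sub>F \<sigma> in at \<tau>. \<sigma> \<in> {0..1}"
  proof -
    have "\<forall>\<^sub>F \<sigma> in at \<tau>. \<sigma> \<in> {0<..<1}"
      using \<tau> by (intro eventually_at_in_open') auto
    then show ?thesis by eventually_elim auto
  qed
  have at: "at \<tau> within {0..1} = at \<tau>"
    using \<tau>01 by (auto simp: at_within_Icc_at)
  have bound: "\<forall>\<^sub>F \<sigma> in at \<tau> within {0..1}. \<forall>q\<in>space Q. \<bar>(kernel \<sigma> q z - kernel \<tau> q z) / (\<sigma> - \<tau>)\<bar> \<le> L / \<delta> * kernel 0 q 0"
    unfolding at using moving lipschitz resting inside eventually_neq_at_within[of \<tau> \<tau> UNIV]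
  proof eventually_elim
    case (elim \<sigma>)
    show ?case
    proof
      fix q assume q: "q \<in> space Q"
      have "\<bar>kernel \<sigma> q z - kernel \<tau> q z\<bar> \<le> L / \<delta> * kernel 0 q 0 * \<bar>\<sigma> - \<tau>\<bar>"
      proof (rule kernel_difference_bound[OF q, of J])
        show "t \<nu> 0 + \<delta> \<le> t \<nu> \<tau>" if "\<nu> \<in> J" for \<nu>
          using \<delta>_le[OF that] that by (auto simp: J_def)
      qed (use elim \<tau>01 L \<delta> in \<open>auto simp: J_def\<close>)
      then show "\<bar>(kernel \<sigma> q z - kernel \<tau> q z) / (\<sigma> - \<tau>)\<bar> \<le> L / \<delta> * kernel 0 q 0"
        using elim by (simp add: abs_divide pos_divide_le_eq)
    qed
  qed
  have quotient: "((\<lambda>\<sigma>. (kernel \<sigma> q z - kernel \<tau> q z) / (\<sigma> - \<tau>)) \<longlongrightarrow> - ?D q) (at \<tau> within {0..1})"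
    if "q \<in> space Q" for q
    using kernel_has_derivative[OF that \<tau>01(2), of z] unfolding at by (simp add: has_field_derivative_iff)
  have D_meas: "(\<lambda>q. - ?D q) \<in> borel_measurable Q"
    by (intro borel_measurable_uminus borel_measurable_times borel_measurable_sum kernel_measurable
        jump_rate_measurable borel_measurable_const) auto
  have q_meas: "(\<lambda>q. (kernel \<sigma> q z - kernel \<tau> q z) / (\<sigma> - \<tau>)) \<in> borel_measurable Q" for \<sigma>
    by (intro borel_measurable_divide borel_measurable_diff kernel_measurable borel_measurable_const)
  have w: "integrable Q (\<lambda>q. L / \<delta> * kernel 0 q 0)"
    by (intro integrable_mult_right kernel_integrable_0)
  have nontrivial: "at \<tau> within {0..1} \<noteq> bot"
    by (simp add: at)
  have lim: "((\<lambda>\<sigma>. LINT q|Q. (kernel \<sigma> q z - kernel \<tau> q z) / (\<sigma> - \<tau>)) \<longlongrightarrow> (LINT q|Q. - ?D q)) (at \<tau>)"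
    using integral_dominated_convergence_at_within(1)[OF q_meas D_meas w quotient bound nontrivial] unfolding at .
  have int: "integrable Q (\<lambda>q. - ?D q)"
    using integral_dominated_convergence_at_within(2)[OF q_meas D_meas w quotient bound nontrivial] .
  have D_nonneg: "0 \<le> ?D q" if "q \<in> space Q" for q
    using that \<tau>01 by (intro mult_nonneg_nonneg sum_nonneg t'_nonneg jump_rate_nonneg less_imp_le[OF kernel_pos])
  have decay: "decay \<tau> z = ennreal (LINT q|Q. ?D q)"
    unfolding decay_eq_nn_integral[OF \<tau>01(1)] using int D_nonneg
    by (intro nn_integral_eq_integral AE_I2) auto
  then show "decay \<tau> z < \<infinity>" by simp
  have "enn2real (decay \<tau> z) = (LINT q|Q. ?D q)"
    unfolding decay using D_nonneg by (intro enn2real_ennreal Bochner_Integration.integral_nonneg)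
  moreover have "\<forall>\<^sub>F \<sigma> in at \<tau>. (LINT q|Q. (kernel \<sigma> q z - kernel \<tau> q z) / (\<sigma> - \<tau>)) = (marginal \<sigma> z - marginal \<tau> z) / (\<sigma> - \<tau>)"
    using inside by eventually_elim (use \<tau>01 in \<open>simp add: marginal_def kernel_integrable\<close>)
  ultimately show ?der
    using lim unfolding has_field_derivative_iff at by (subst (asm) tendsto_cong) simp_all
qed


section \<open>Dynkin's formula for the log marginal\<close>

definition mass :: "real \<Rightarrow> (nat \<Rightarrow> nat \<Rightarrow> nat) \<Rightarrow> real" where
  "mass \<tau> z = joint_mass N m (\<lambda>\<nu>. t \<nu> \<tau>) p z"

definition expect :: "real \<Rightarrow> ((nat \<Rightarrow> nat \<Rightarrow> nat) \<Rightarrow> ennreal) \<Rightarrow> ennreal" where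
  "expect \<tau> F = (\<integral>\<^sup>+z. ennreal (mass \<tau> z) * F z \<partial>count_space (states N m))"

definition inflow :: "nat \<Rightarrow> real \<Rightarrow> (nat \<Rightarrow> nat \<Rightarrow> nat) \<Rightarrow> real" where
  "inflow \<nu> \<tau> z = (\<Sum>w\<in>{..z \<nu>}. levy_coeff (m \<nu>) w * mpow (m \<nu>) (p \<nu>) w * mass \<tau> (z - block \<nu> w))"

definition outflow_rate :: "real \<Rightarrow> real" where
  "outflow_rate \<tau> = (\<Sum>\<nu>=1..N. t' \<nu> \<tau> * jump_rate \<nu> p)"

lemma p_space: "p \<in> space Q"
  using p space_Q by simp

lemma mass_nonneg: "\<tau> \<in> {0..1} \<Longrightarrow> mass \<tau> z \<ge> 0"
  unfolding mass_def by (intro joint_mass_nonneg p) (auto intro: t_pos)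

lemma inflow_nonneg:
  assumes "\<nu> \<in> {1..N}" "\<tau> \<in> {0..1}"
  shows "inflow \<nu> \<tau> z \<ge> 0"
  unfolding inflow_def
  using mass_nonneg[OF assms(2)] less_imp_le[OF mpow_pos[OF simplex[OF p_space assms(1)]]]
  by (intro sum_nonneg mult_nonneg_nonneg levy_coeff_nonneg)

lemma expect_eq: "\<tau> \<in> {0..1} \<Longrightarrow>
    (\<integral>\<^sup>+z. F z \<partial>measure_pmf (neg_multinomials_pmf N m (\<lambda>\<nu>. t \<nu> \<tau>) p)) = expect \<tau> F"
  unfolding expect_def mass_def by (intro nn_integral_neg_multinomials p) (auto intro: t_pos)

lemma expect_const: "\<tau> \<in> {0..1} \<Longrightarrow> expect \<tau> (\<lambda>_. c) = c"
  by (simp add: expect_eq[symmetric] measure_pmf.emeasure_space_1[simplified])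

lemma expect_add: "\<tau> \<in> {0..1} \<Longrightarrow> expect \<tau> (\<lambda>z. F z + G z) = expect \<tau> F + expect \<tau> G"
  by (simp add: expect_eq[symmetric] nn_integral_add)

lemma expect_cmult: "\<tau> \<in> {0..1} \<Longrightarrow> expect \<tau> (\<lambda>z. c * F z) = c * expect \<tau> F"
  by (simp add: expect_eq[symmetric] nn_integral_cmult)

lemma expect_sum: "\<tau> \<in> {0..1} \<Longrightarrow> expect \<tau> (\<lambda>z. \<Sum>i\<in>I. F i z) = (\<Sum>i\<in>I. expect \<tau> (F i))"
  by (simp add: expect_eq[symmetric] nn_integral_sum)

lemma mass_continuous:
  assumes z: "z \<in> states N m"
  shows "continuous_on {0..1} (\<lambda>\<tau>. mass \<tau> z)"
  unfolding mass_def joint_mass_def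
proof (intro continuous_on_prod)
  fix \<nu> assume \<nu>: "\<nu> \<in> {1..N}"
  have "z \<nu> \<in> count_vectors (m \<nu>)"
    using z \<nu> by (auto simp: states_def)
  note D = neg_multinomial_mass_has_derivative[OF this simplex[OF p_space \<nu>]]
  have "continuous_on {0<..} (\<lambda>a. neg_multinomial_mass (m \<nu>) a (p \<nu>) (z \<nu>))"
    by (intro continuous_at_imp_continuous_on ballI DERIV_isCont[OF D]) simp
  then show "continuous_on {0..1} (\<lambda>\<tau>. neg_multinomial_mass (m \<nu>) (t \<nu> \<tau>) (p \<nu>) (z \<nu>))"
    by (rule continuous_on_compose2[OF _ t_continuous[OF \<nu>]]) (use t_pos[OF \<nu>] in auto)
qed

lemma states_diff: "z \<in> states N m \<Longrightarrow> z - x \<in> states N m"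
  by (auto simp: states_def count_vectors_def)

lemma inflow_continuous: "z \<in> states N m \<Longrightarrow> continuous_on {0..1} (\<lambda>\<tau>. inflow \<nu> \<tau> z)"
  unfolding inflow_def by (intro continuous_intros mass_continuous states_diff)

lemma outflow_rate_continuous: "continuous_on {0..1} outflow_rate"
  unfolding outflow_rate_def[abs_def] by (intro continuous_intros t'_continuous) auto

lemma outflow_rate_nonneg: "\<tau> \<in> {0..1} \<Longrightarrow> outflow_rate \<tau> \<ge> 0"
  unfolding outflow_rate_def by (intro sum_nonneg mult_nonneg_nonneg t'_nonneg jump_rate_nonneg p_space) auto

lemma mass_has_derivative:
  assumes z: "z \<in> states N m" and \<tau>: "\<tau> \<in> {0<..<1}"
  shows "((\<lambda>\<tau>. mass \<tau> z) has_real_derivative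
    (\<Sum>\<nu>=1..N. t' \<nu> \<tau> * inflow \<nu> \<tau> z) - outflow_rate \<tau> * mass \<tau> z) (at \<tau>)"
proof -
  have "((\<lambda>\<tau>. mass \<tau> z) has_real_derivative
     (\<Sum>\<nu>=1..N. t' \<nu> \<tau> * (inflow \<nu> \<tau> z + ln (p0 (m \<nu>) (p \<nu>)) * mass \<tau> z))) (at \<tau>)"
    unfolding mass_def inflow_def
  proof (rule joint_mass_has_derivative[OF z p])
    fix \<nu> assume \<nu>: "\<nu> \<in> {1..N}"
    show "t \<nu> \<tau> > 0" using t_pos[OF \<nu>, of \<tau>] \<tau> by auto
    show "(t \<nu> has_real_derivative t' \<nu> \<tau>) (at \<tau>)"
      using t_deriv[OF \<nu>, of \<tau>] \<tau> by (auto simp: at_within_Icc_at)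
  qed
  also have "(\<Sum>\<nu>=1..N. t' \<nu> \<tau> * (inflow \<nu> \<tau> z + ln (p0 (m \<nu>) (p \<nu>)) * mass \<tau> z))
     = (\<Sum>\<nu>=1..N. t' \<nu> \<tau> * inflow \<nu> \<tau> z) - outflow_rate \<tau> * mass \<tau> z"
    by (simp add: outflow_rate_def jump_rate_def sum_distrib_right distrib_left sum.distrib sum_negf mult.assoc)
  finally show ?thesis .
qed

definition decay_rate :: "real \<Rightarrow> (nat \<Rightarrow> nat \<Rightarrow> nat) \<Rightarrow> real" where
  "decay_rate \<tau> z = enn2real (decay \<tau> z) / marginal \<tau> z"

lemma decay_rate_nonneg: "\<tau> \<in> {0..1} \<Longrightarrow> decay_rate \<tau> z \<ge> 0"
  using marginal_pos[of \<tau> z] by (simp add: decay_rate_def)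

lemma log_marginal_has_derivative:
  assumes \<tau>: "\<tau> \<in> {0<..<1} - departure_times"
  shows "((\<lambda>\<tau>. log_marginal \<tau> z) has_real_derivative decay_rate \<tau> z) (at \<tau>)"
proof -
  have pos: "marginal \<tau> z > 0" "marginal 0 0 > 0"
    using marginal_pos[of \<tau> z] marginal_pos[of 0 0] \<tau> by auto
  have "((\<lambda>\<tau>. marginal \<tau> z / marginal 0 0) has_real_derivative - enn2real (decay \<tau> z) / marginal 0 0) (at \<tau>)"
    by (rule DERIV_cdivide[OF marginal_has_derivative(1)[OF \<tau>]])
  from DERIV_minus[OF DERIV_chain2[OF DERIV_ln_divide this]]
  have "((\<lambda>\<tau>. log_marginal \<tau> z) has_real_derivative
      - (1 / (marginal \<tau> z / marginal 0 0) * (- enn2real (decay \<tau> z) / marginal 0 0))) (at \<tau>)"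
    using pos by (simp add: log_marginal_def)
  also have "- (1 / (marginal \<tau> z / marginal 0 0) * (- enn2real (decay \<tau> z) / marginal 0 0)) = decay_rate \<tau> z"
    using pos by (simp add: decay_rate_def)
  finally show ?thesis .
qed

text \<open>
  Integration by parts in \<open>\<tau>\<close> for a single count \<open>z\<close>. The signed forward equation is split into inflow
  and outflow, which stand on different sides.
\<close>

lemma mass_log_marginal_identity:
  assumes z: "z \<in> states N m"
  shows "(\<integral>\<^sup>+\<tau>. ennreal (mass \<tau> z * decay_rate \<tau> z) \<partial>unit_interval)
      + (\<integral>\<^sup>+\<tau>. ennreal ((\<Sum>\<nu>=1..N. t' \<nu> \<tau> * inflow \<nu> \<tau> z) * log_marginal \<tau> z) \<partial>unit_interval)
      + ennreal (mass 0 z * log_marginal 0 z)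
    = ennreal (mass 1 z * log_marginal 1 z)
      + (\<integral>\<^sup>+\<tau>. ennreal (outflow_rate \<tau> * (mass \<tau> z * log_marginal \<tau> z)) \<partial>unit_interval)"
proof -
  let ?F = "\<lambda>\<tau>. mass \<tau> z * log_marginal \<tau> z"
  let ?A = "\<lambda>\<tau>. mass \<tau> z * decay_rate \<tau> z"
  let ?B = "\<lambda>\<tau>. (\<Sum>\<nu>=1..N. t' \<nu> \<tau> * inflow \<nu> \<tau> z) * log_marginal \<tau> z"
  let ?C = "\<lambda>\<tau>. outflow_rate \<tau> * (mass \<tau> z * log_marginal \<tau> z)"
  have B: "?B \<tau> \<ge> 0" and C: "?C \<tau> \<ge> 0" and A: "?A \<tau> \<ge> 0" if "\<tau> \<in> {0..1}" for \<tau>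
    using that by (auto intro!: mult_nonneg_nonneg sum_nonneg t'_nonneg inflow_nonneg log_marginal_nonneg
        outflow_rate_nonneg mass_nonneg decay_rate_nonneg)
  have int_B: "(?B has_integral integral {0..1} ?B) {0..1}"
    by (intro integrable_integral integrable_continuous_real continuous_intros t'_continuous
        inflow_continuous[OF z] log_marginal_continuous) auto
  have int_C: "(?C has_integral integral {0..1} ?C) {0..1}"
    by (intro integrable_integral integrable_continuous_real continuous_intros outflow_rate_continuous
        mass_continuous[OF z] log_marginal_continuous)
  have "((\<lambda>\<tau>. ?A \<tau> + ?B \<tau> - ?C \<tau>) has_integral ?F 1 - ?F 0) {0..1}"
  proof (rule fundamental_theorem_of_calculus_interior_strong[OF finite_departure_times])
    fix \<tau> assume \<tau>: "\<tau> \<in> {0<..<1} - departure_times"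
    have "((\<lambda>\<tau>. mass \<tau> z * log_marginal \<tau> z) has_real_derivative ?A \<tau> + ?B \<tau> - ?C \<tau>) (at \<tau>)"
      using \<tau> by (auto intro!: derivative_eq_intros mass_has_derivative[OF z] log_marginal_has_derivative
          simp: algebra_simps)
    then show "(?F has_vector_derivative ?A \<tau> + ?B \<tau> - ?C \<tau>) (at \<tau>)"
      by (simp add: has_real_derivative_iff_has_vector_derivative)
  qed (auto intro!: continuous_intros mass_continuous[OF z] log_marginal_continuous)
  from has_integral_add[OF has_integral_diff[OF this int_B] int_C]
  have int_A: "(?A has_integral ?F 1 - ?F 0 - integral {0..1} ?B + integral {0..1} ?C) {0..1}"
    by simp
  have I: "0 \<le> ?F 1 - ?F 0 - integral {0..1} ?B + integral {0..1} ?C"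
      "0 \<le> integral {0..1} ?B" "0 \<le> integral {0..1} ?C" "0 \<le> ?F 0" "0 \<le> ?F 1"
    using has_integral_nonneg[OF int_A A] has_integral_nonneg[OF int_B B] has_integral_nonneg[OF int_C C]
    by (auto intro!: mult_nonneg_nonneg mass_nonneg log_marginal_nonneg)
  have "(\<integral>\<^sup>+\<tau>. ennreal (?A \<tau>) \<partial>unit_interval) = ennreal (?F 1 - ?F 0 - integral {0..1} ?B + integral {0..1} ?C)"
    and "(\<integral>\<^sup>+\<tau>. ennreal (?B \<tau>) \<partial>unit_interval) = ennreal (integral {0..1} ?B)"
    and "(\<integral>\<^sup>+\<tau>. ennreal (?C \<tau>) \<partial>unit_interval) = ennreal (integral {0..1} ?C)"
    by (intro nn_integral_unit_interval_has_integral A int_A B int_B C int_C; assumption)+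
  then show ?thesis
    using I by (simp only: ennreal_plus[symmetric] add_nonneg_nonneg) simp
qed

lemma marginal_measurable: "(\<lambda>\<tau>. marginal \<tau> z) \<in> borel_measurable unit_interval"
  by (rule measurable_unit_interval_continuous[OF marginal_continuous])

lemma t'_measurable: "\<nu> \<in> {1..N} \<Longrightarrow> t' \<nu> \<in> borel_measurable unit_interval"
  by (rule measurable_unit_interval_continuous[OF t'_continuous])

lemma mass_measurable: "z \<in> states N m \<Longrightarrow> (\<lambda>\<tau>. mass \<tau> z) \<in> borel_measurable unit_interval"
  by (rule measurable_unit_interval_continuous[OF mass_continuous])

lemma log_marginal_measurable: "(\<lambda>\<tau>. log_marginal \<tau> z) \<in> borel_measurable unit_interval"
  by (rule measurable_unit_interval_continuous[OF log_marginal_continuous])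

lemma decay_measurable: "(\<lambda>\<tau>. decay \<tau> z) \<in> borel_measurable unit_interval"
  unfolding decay_def jump_sum_def
  by (intro borel_measurable_sum borel_measurable_times_ennreal measurable_nn_integral_count_space
      countable_count_vectors measurable_compose[OF t'_measurable measurable_ennreal]
      measurable_compose[OF marginal_measurable measurable_ennreal] borel_measurable_const)

lemma decay_rate_measurable: "(\<lambda>\<tau>. decay_rate \<tau> z) \<in> borel_measurable unit_interval"
  unfolding decay_rate_def
  by (intro borel_measurable_divide marginal_measurable borel_measurable_enn2real decay_measurable)

lemma expect_measurable:
  assumes "\<And>z. z \<in> states N m \<Longrightarrow> (\<lambda>\<tau>. F \<tau> z) \<in> borel_measurable unit_interval"
  shows "(\<lambda>\<tau>. expect \<tau> (F \<tau>)) \<in> borel_measurable unit_interval"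
  unfolding expect_def
  by (intro measurable_nn_integral_count_space countable_states borel_measurable_times_ennreal assms
      measurable_compose[OF mass_measurable measurable_ennreal])

lemma jump_sum_measurable:
  assumes "\<And>w. w \<in> count_vectors (m \<nu>) \<Longrightarrow> (\<lambda>\<tau>. F \<tau> w) \<in> borel_measurable M"
  shows "(\<lambda>\<tau>. jump_sum \<nu> (F \<tau>)) \<in> borel_measurable M"
  unfolding jump_sum_def
  by (intro measurable_nn_integral_count_space countable_count_vectors borel_measurable_times_ennreal
      borel_measurable_const assms)

lemma jump_sum_add: "jump_sum \<nu> (\<lambda>w. F w + G w) = jump_sum \<nu> F + jump_sum \<nu> G"
  by (simp add: jump_sum_def distrib_left nn_integral_add)

lemma jump_sum_multc: "jump_sum \<nu> (\<lambda>w. F w * c) = jump_sum \<nu> F * c"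
  by (simp add: jump_sum_def nn_integral_multc mult.assoc[symmetric])

lemma jump_sum_mpow: "\<nu> \<in> {1..N} \<Longrightarrow> jump_sum \<nu> (\<lambda>w. ennreal (mpow (m \<nu>) (p \<nu>) w)) = ennreal (jump_rate \<nu> p)"
  unfolding jump_sum_def jump_rate_def by (rule levy_total_mass[OF simplex[OF p_space]])

lemma expect_jump_sum:
  "expect \<tau> (\<lambda>z. jump_sum \<nu> (F z)) = jump_sum \<nu> (\<lambda>w. expect \<tau> (\<lambda>z. F z w))"
proof -
  have "expect \<tau> (\<lambda>z. jump_sum \<nu> (F z)) = (\<integral>\<^sup>+z. \<integral>\<^sup>+w. ennreal (mass \<tau> z) * (ennreal (levy_coeff (m \<nu>) w) * F z w)
      \<partial>count_space (count_vectors (m \<nu>)) \<partial>count_space (states N m))"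
    by (simp add: expect_def jump_sum_def nn_integral_cmult)
  also have "\<dots> = (\<integral>\<^sup>+w. \<integral>\<^sup>+z. ennreal (mass \<tau> z) * (ennreal (levy_coeff (m \<nu>) w) * F z w)
      \<partial>count_space (states N m) \<partial>count_space (count_vectors (m \<nu>)))"
    by (rule nn_integral_count_space_nn_integral[OF countable_count_vectors]) simp
  also have "\<dots> = jump_sum \<nu> (\<lambda>w. expect \<tau> (\<lambda>z. F z w))"
    by (simp add: expect_def jump_sum_def nn_integral_cmult[symmetric] mult.left_commute)
  finally show ?thesis .
qed

text \<open>
  The identities for single counts, summed over all counts. The expectation of \<open>log_marginal\<close> changes
  by its own derivative, by the gain from jumps, and by the outflow.
\<close>

lemma dynkin:
  "(\<integral>\<^sup>+\<tau>. expect \<tau> (\<lambda>z. ennreal (decay_rate \<tau> z)) \<partial>unit_interval)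
    + (\<integral>\<^sup>+\<tau>. (\<Sum>\<nu>=1..N. ennreal (t' \<nu> \<tau>) * jump_sum \<nu> (\<lambda>w. ennreal (mpow (m \<nu>) (p \<nu>) w)
          * expect \<tau> (\<lambda>z. ennreal (log_marginal \<tau> (z + block \<nu> w))))) \<partial>unit_interval)
    + expect 0 (\<lambda>z. ennreal (log_marginal 0 z))
  = expect 1 (\<lambda>z. ennreal (log_marginal 1 z))
    + (\<integral>\<^sup>+\<tau>. ennreal (outflow_rate \<tau>) * expect \<tau> (\<lambda>z. ennreal (log_marginal \<tau> z)) \<partial>unit_interval)"
proof -
  let ?S = "count_space (states N m)"
  let ?A = "\<lambda>\<tau> z. ennreal (mass \<tau> z * decay_rate \<tau> z)"
  let ?B = "\<lambda>\<tau> z. ennreal ((\<Sum>\<nu>=1..N. t' \<nu> \<tau> * inflow \<nu> \<tau> z) * log_marginal \<tau> z)"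
  let ?C = "\<lambda>\<tau> z. ennreal (outflow_rate \<tau> * (mass \<tau> z * log_marginal \<tau> z))"
  have swap: "(\<integral>\<^sup>+z. \<integral>\<^sup>+\<tau>. G \<tau> z \<partial>unit_interval \<partial>?S) = (\<integral>\<^sup>+\<tau>. \<integral>\<^sup>+z. G \<tau> z \<partial>?S \<partial>unit_interval)"
    if "\<And>z. z \<in> states N m \<Longrightarrow> (\<lambda>\<tau>. G \<tau> z) \<in> borel_measurable unit_interval" for G :: "real \<Rightarrow> _ \<Rightarrow> ennreal"
    by (rule nn_integral_count_space_nn_integral[OF countable_states that, symmetric])
  have sum: "(\<integral>\<^sup>+z. \<integral>\<^sup>+\<tau>. ?A \<tau> z \<partial>unit_interval \<partial>?S) + (\<integral>\<^sup>+z. \<integral>\<^sup>+\<tau>. ?B \<tau> z \<partial>unit_interval \<partial>?S)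
      + (\<integral>\<^sup>+z. ennreal (mass 0 z * log_marginal 0 z) \<partial>?S)
    = (\<integral>\<^sup>+z. ennreal (mass 1 z * log_marginal 1 z) \<partial>?S) + (\<integral>\<^sup>+z. \<integral>\<^sup>+\<tau>. ?C \<tau> z \<partial>unit_interval \<partial>?S)"
  proof -
    have add: "(\<integral>\<^sup>+z. f z \<partial>?S) + (\<integral>\<^sup>+z. g z \<partial>?S) = (\<integral>\<^sup>+z. f z + g z \<partial>?S)" for f g
      by (simp add: nn_integral_add)
    show ?thesis
      unfolding add by (intro nn_integral_cong mass_log_marginal_identity) simp
  qed
  have E: "(\<integral>\<^sup>+z. ennreal (mass \<tau> z * F z) \<partial>?S) = expect \<tau> (\<lambda>z. ennreal (F z))" if "\<tau> \<in> {0..1}" for \<tau> F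
    unfolding expect_def using mass_nonneg[OF that] by (simp add: ennreal_mult')
  have "(\<integral>\<^sup>+z. \<integral>\<^sup>+\<tau>. ?A \<tau> z \<partial>unit_interval \<partial>?S) = (\<integral>\<^sup>+\<tau>. expect \<tau> (\<lambda>z. ennreal (decay_rate \<tau> z)) \<partial>unit_interval)"
  proof (subst swap)
    show "(\<lambda>\<tau>. ?A \<tau> z) \<in> borel_measurable unit_interval" if "z \<in> states N m" for z
      using mass_measurable[OF that] decay_rate_measurable by measurable
  qed (auto intro!: nn_integral_cong E simp: space_restrict_space)
  moreover have "(\<integral>\<^sup>+z. \<integral>\<^sup>+\<tau>. ?C \<tau> z \<partial>unit_interval \<partial>?S)
      = (\<integral>\<^sup>+\<tau>. ennreal (outflow_rate \<tau>) * expect \<tau> (\<lambda>z. ennreal (log_marginal \<tau> z)) \<partial>unit_interval)"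
  proof (subst swap)
    show "(\<lambda>\<tau>. ?C \<tau> z) \<in> borel_measurable unit_interval" if "z \<in> states N m" for z
      using mass_measurable[OF that] log_marginal_measurable[of z]
        measurable_unit_interval_continuous[OF outflow_rate_continuous] by measurable
    show "(\<integral>\<^sup>+\<tau>. \<integral>\<^sup>+z. ?C \<tau> z \<partial>?S \<partial>unit_interval)
      = (\<integral>\<^sup>+\<tau>. ennreal (outflow_rate \<tau>) * expect \<tau> (\<lambda>z. ennreal (log_marginal \<tau> z)) \<partial>unit_interval)"
    proof (intro nn_integral_cong)
      fix \<tau> assume "\<tau> \<in> space unit_interval"
      then have \<tau>: "\<tau> \<in> {0..1}" by (simp add: space_restrict_space)
      show "(\<integral>\<^sup>+z. ?C \<tau> z \<partial>?S) = ennreal (outflow_rate \<tau>) * expect \<tau> (\<lambda>z. ennreal (log_marginal \<tau> z))"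
        unfolding E[OF \<tau>, symmetric] using outflow_rate_nonneg[OF \<tau>]
        by (simp add: ennreal_mult' nn_integral_cmult)
    qed
  qed
  moreover have "(\<integral>\<^sup>+z. \<integral>\<^sup>+\<tau>. ?B \<tau> z \<partial>unit_interval \<partial>?S)
      = (\<integral>\<^sup>+\<tau>. (\<Sum>\<nu>=1..N. ennreal (t' \<nu> \<tau>) * jump_sum \<nu> (\<lambda>w. ennreal (mpow (m \<nu>) (p \<nu>) w)
          * expect \<tau> (\<lambda>z. ennreal (log_marginal \<tau> (z + block \<nu> w))))) \<partial>unit_interval)"
  proof (subst swap)
    show "(\<lambda>\<tau>. ?B \<tau> z) \<in> borel_measurable unit_interval" if "z \<in> states N m" for z
      by (intro measurable_compose[OF _ measurable_ennreal] measurable_unit_interval_continuous continuous_intros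
          t'_continuous inflow_continuous that log_marginal_continuous) auto
    show "(\<integral>\<^sup>+\<tau>. \<integral>\<^sup>+z. ?B \<tau> z \<partial>?S \<partial>unit_interval)
      = (\<integral>\<^sup>+\<tau>. (\<Sum>\<nu>=1..N. ennreal (t' \<nu> \<tau>) * jump_sum \<nu> (\<lambda>w. ennreal (mpow (m \<nu>) (p \<nu>) w)
          * expect \<tau> (\<lambda>z. ennreal (log_marginal \<tau> (z + block \<nu> w))))) \<partial>unit_interval)"
    proof (intro nn_integral_cong)
      fix \<tau> assume "\<tau> \<in> space unit_interval"
      then have \<tau>: "\<tau> \<in> {0..1}" by (simp add: space_restrict_space)
      have "(\<integral>\<^sup>+z. ?B \<tau> z \<partial>?S)
        = (\<integral>\<^sup>+z. (\<Sum>\<nu>=1..N. ennreal (t' \<nu> \<tau>) * (ennreal (inflow \<nu> \<tau> z) * ennreal (log_marginal \<tau> z))) \<partial>?S)"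
      proof (intro nn_integral_cong)
        fix z
        have "?B \<tau> z = ennreal (\<Sum>\<nu>=1..N. t' \<nu> \<tau> * (inflow \<nu> \<tau> z * log_marginal \<tau> z))"
          by (simp add: sum_distrib_right mult.assoc)
        also have "\<dots> = (\<Sum>\<nu>=1..N. ennreal (t' \<nu> \<tau> * (inflow \<nu> \<tau> z * log_marginal \<tau> z)))"
          using \<tau> by (intro sum_ennreal[symmetric] mult_nonneg_nonneg t'_nonneg inflow_nonneg log_marginal_nonneg)
        also have "\<dots> = (\<Sum>\<nu>=1..N. ennreal (t' \<nu> \<tau>) * (ennreal (inflow \<nu> \<tau> z) * ennreal (log_marginal \<tau> z)))"
          using \<tau> by (intro sum.cong refl)
            (simp add: ennreal_mult t'_nonneg inflow_nonneg log_marginal_nonneg)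
        finally show "?B \<tau> z = (\<Sum>\<nu>=1..N. ennreal (t' \<nu> \<tau>) * (ennreal (inflow \<nu> \<tau> z) * ennreal (log_marginal \<tau> z)))" .
      qed
      also have "\<dots> = (\<Sum>\<nu>=1..N. ennreal (t' \<nu> \<tau>) * (\<integral>\<^sup>+z. ennreal (inflow \<nu> \<tau> z) * ennreal (log_marginal \<tau> z) \<partial>?S))"
        by (simp add: nn_integral_sum nn_integral_cmult)
      also have "\<dots> = (\<Sum>\<nu>=1..N. ennreal (t' \<nu> \<tau>) * jump_sum \<nu> (\<lambda>w. ennreal (mpow (m \<nu>) (p \<nu>) w)
          * expect \<tau> (\<lambda>z. ennreal (log_marginal \<tau> (z + block \<nu> w)))))"
      proof (intro sum.cong refl arg_cong2[where f="(*)"])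
        fix \<nu> assume \<nu>: "\<nu> \<in> {1..N}"
        show "(\<integral>\<^sup>+z. ennreal (inflow \<nu> \<tau> z) * ennreal (log_marginal \<tau> z) \<partial>?S)
          = jump_sum \<nu> (\<lambda>w. ennreal (mpow (m \<nu>) (p \<nu>) w) * expect \<tau> (\<lambda>z. ennreal (log_marginal \<tau> (z + block \<nu> w))))"
          unfolding inflow_def jump_sum_def expect_def mult.assoc[symmetric]
          by (rule nn_integral_inflow[OF \<nu> mass_nonneg[OF \<tau>] p])
      qed
      finally show "(\<integral>\<^sup>+z. ?B \<tau> z \<partial>?S) = (\<Sum>\<nu>=1..N. ennreal (t' \<nu> \<tau>) * jump_sum \<nu> (\<lambda>w. ennreal (mpow (m \<nu>) (p \<nu>) w)
          * expect \<tau> (\<lambda>z. ennreal (log_marginal \<tau> (z + block \<nu> w)))))" .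
    qed
  qed
  moreover have "(0::real) \<in> {0..1}" "(1::real) \<in> {0..1}" by auto
  ultimately show ?thesis
    using sum by (simp only: E)
qed


section \<open>The posterior loss\<close>

text \<open>
  The mean of \<open>- ln p\<^bsup>y\<^esup>\<close> for a negative multinomial vector \<open>y\<close>, per unit of its size.
\<close>

definition entropy_rate :: "nat \<Rightarrow> real" where
  "entropy_rate \<nu> = (\<Sum>i=1..m \<nu>. p \<nu> i / p0 (m \<nu>) (p \<nu>) * - ln (p \<nu> i))"

lemma minus_ln_mpow:
  assumes "\<nu> \<in> {1..N}"
  shows "ennreal (- ln (mpow (m \<nu>) (p \<nu>) w)) = (\<Sum>i=1..m \<nu>. ennreal (real (w i)) * ennreal (- ln (p \<nu> i)))"
proof -
  note bounds = open_simplex_bounds(3,4)[OF simplex[OF p_space assms]]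
  have "- ln (mpow (m \<nu>) (p \<nu>) w) = (\<Sum>i=1..m \<nu>. real (w i) * - ln (p \<nu> i))"
  proof -
    have "ln (mpow (m \<nu>) (p \<nu>) w) = (\<Sum>i=1..m \<nu>. ln (p \<nu> i ^ w i))"
      unfolding mpow_def by (intro ln_prod power_not_zero less_imp_neq[OF bounds(1), symmetric] finite_atLeastAtMost)
    also have "\<dots> = (\<Sum>i=1..m \<nu>. real (w i) * ln (p \<nu> i))"
      using bounds(1) by (intro sum.cong refl ln_realpow)
    finally show ?thesis
      by (simp add: sum_negf)
  qed
  moreover have "ennreal (\<Sum>i=1..m \<nu>. real (w i) * - ln (p \<nu> i)) = (\<Sum>i=1..m \<nu>. ennreal (real (w i) * - ln (p \<nu> i)))"
    using bounds by (intro sum_ennreal[symmetric] mult_nonneg_nonneg) auto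
  ultimately show ?thesis
    by (simp only: ennreal_mult'[OF of_nat_0_le_iff])
qed

lemma minus_ln_coordinate_nonneg:
  assumes "\<nu> \<in> {1..N}" "i \<in> {1..m \<nu>}"
  shows "0 \<le> - ln (p \<nu> i)" "0 \<le> p \<nu> i / p0 (m \<nu>) (p \<nu>)"
  using open_simplex_bounds[OF simplex[OF p_space assms(1)]] assms(2) by (auto simp: less_imp_le)

lemma ennreal_entropy_rate:
  assumes "\<nu> \<in> {1..N}"
  shows "ennreal (entropy_rate \<nu>) = (\<Sum>i=1..m \<nu>. ennreal (p \<nu> i / p0 (m \<nu>) (p \<nu>)) * ennreal (- ln (p \<nu> i)))"
proof -
  have "ennreal (entropy_rate \<nu>) = (\<Sum>i=1..m \<nu>. ennreal (p \<nu> i / p0 (m \<nu>) (p \<nu>) * - ln (p \<nu> i)))"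
    unfolding entropy_rate_def
    by (intro sum_ennreal[symmetric] mult_nonneg_nonneg minus_ln_coordinate_nonneg assms)
  also have "\<dots> = (\<Sum>i=1..m \<nu>. ennreal (p \<nu> i / p0 (m \<nu>) (p \<nu>)) * ennreal (- ln (p \<nu> i)))"
    by (intro sum.cong refl ennreal_mult' minus_ln_coordinate_nonneg assms)
  finally show ?thesis .
qed

text \<open>
  The function \<open>- ln p\<^bsup>w\<^esup>\<close> is linear in \<open>w\<close>, so \<open>levy_mean\<close> applies coordinate by coordinate.
\<close>

lemma jump_sum_entropy:
  assumes \<nu>: "\<nu> \<in> {1..N}"
  shows "jump_sum \<nu> (\<lambda>w. ennreal (mpow (m \<nu>) (p \<nu>) w) * ennreal (- ln (mpow (m \<nu>) (p \<nu>) w))) = ennreal (entropy_rate \<nu>)"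
proof -
  have "jump_sum \<nu> (\<lambda>w. ennreal (mpow (m \<nu>) (p \<nu>) w) * ennreal (- ln (mpow (m \<nu>) (p \<nu>) w)))
     = (\<integral>\<^sup>+w. (\<Sum>i=1..m \<nu>. ennreal (levy_coeff (m \<nu>) w) * ennreal (mpow (m \<nu>) (p \<nu>) w) * ennreal (real (w i))
          * ennreal (- ln (p \<nu> i))) \<partial>count_space (count_vectors (m \<nu>)))"
    unfolding jump_sum_def minus_ln_mpow[OF \<nu>] by (simp add: sum_distrib_left mult.assoc)
  also have "\<dots> = (\<Sum>i=1..m \<nu>. (\<integral>\<^sup>+w. ennreal (levy_coeff (m \<nu>) w) * ennreal (mpow (m \<nu>) (p \<nu>) w) * ennreal (real (w i))
          \<partial>count_space (count_vectors (m \<nu>))) * ennreal (- ln (p \<nu> i)))"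
    by (simp add: nn_integral_sum nn_integral_multc)
  also have "\<dots> = ennreal (entropy_rate \<nu>)"
    unfolding ennreal_entropy_rate[OF \<nu>]
    by (intro sum.cong refl) (simp add: levy_mean[OF simplex[OF p_space \<nu>]])
  finally show ?thesis .
qed

lemma expect_log_marginal_bounded:
  obtains M where "\<And>\<tau>. \<tau> \<in> {0..1} \<Longrightarrow> expect \<tau> (\<lambda>z. ennreal (log_marginal \<tau> z)) \<le> ennreal M"
proof -
  obtain A B where AB: "0 \<le> A" "0 \<le> B"
    "\<And>\<tau> z. \<tau> \<in> {0..1} \<Longrightarrow> log_marginal \<tau> z \<le> A + B * real (\<Sum>\<nu>=1..N. deg (m \<nu>) (z \<nu>))"
    using log_marginal_upper_bound by blast
  let ?M = "ennreal A + ennreal B * (\<Sum>\<nu>=1..N. \<Sum>i=1..m \<nu>. ennreal (t \<nu> 1 * p \<nu> i / p0 (m \<nu>) (p \<nu>)))"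
  have "expect \<tau> (\<lambda>z. ennreal (log_marginal \<tau> z)) \<le> ?M" if \<tau>: "\<tau> \<in> {0..1}" for \<tau>
  proof -
    have a: "\<forall>\<nu>\<in>{1..N}. 0 < t \<nu> \<tau>"
      by (intro ballI t_pos \<tau>)
    have count: "expect \<tau> (\<lambda>z. ennreal (real (z \<nu> i))) \<le> ennreal (t \<nu> 1 * p \<nu> i / p0 (m \<nu>) (p \<nu>))"
      if \<nu>: "\<nu> \<in> {1..N}" and i: "i \<in> {1..m \<nu>}" for \<nu> i
    proof -
      have "t \<nu> \<tau> \<le> t \<nu> 1"
        using \<tau> by (intro mono_onD[OF t_mono[OF \<nu>]]) auto
      then have "t \<nu> \<tau> * (p \<nu> i / p0 (m \<nu>) (p \<nu>)) \<le> t \<nu> 1 * (p \<nu> i / p0 (m \<nu>) (p \<nu>))"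
        by (intro mult_right_mono minus_ln_coordinate_nonneg[OF \<nu> i])
      then show ?thesis
        by (simp add: expect_eq[OF \<tau>, symmetric] neg_multinomials_mean[OF a p \<nu> i] ennreal_leI)
    qed
    have "expect \<tau> (\<lambda>z. ennreal (log_marginal \<tau> z))
        \<le> expect \<tau> (\<lambda>z. ennreal A + ennreal B * (\<Sum>\<nu>=1..N. \<Sum>i=1..m \<nu>. ennreal (real (z \<nu> i))))"
      unfolding expect_def
    proof (intro nn_integral_mono mult_left_mono)
      fix z
      have "ennreal (log_marginal \<tau> z) \<le> ennreal (A + B * real (\<Sum>\<nu>=1..N. deg (m \<nu>) (z \<nu>)))"
        by (intro ennreal_leI AB \<tau>)
      also have "\<dots> = ennreal A + ennreal B * ennreal (\<Sum>\<nu>=1..N. \<Sum>i=1..m \<nu>. real (z \<nu> i))"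
        unfolding deg_def of_nat_sum using AB(1,2) by (simp only: ennreal_plus ennreal_mult sum_nonneg
            of_nat_0_le_iff mult_nonneg_nonneg)
      also have "ennreal (\<Sum>\<nu>=1..N. \<Sum>i=1..m \<nu>. real (z \<nu> i)) = (\<Sum>\<nu>=1..N. \<Sum>i=1..m \<nu>. ennreal (real (z \<nu> i)))"
        by (simp add: sum_nonneg)
      finally show "ennreal (log_marginal \<tau> z) \<le> ennreal A + ennreal B * (\<Sum>\<nu>=1..N. \<Sum>i=1..m \<nu>. ennreal (real (z \<nu> i)))" .
    qed simp
    also have "\<dots> = ennreal A + ennreal B * (\<Sum>\<nu>=1..N. \<Sum>i=1..m \<nu>. expect \<tau> (\<lambda>z. ennreal (real (z \<nu> i))))"
      by (simp only: expect_add[OF \<tau>] expect_const[OF \<tau>] expect_cmult[OF \<tau>] expect_sum[OF \<tau>])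
    also have "\<dots> \<le> ?M"
      by (intro add_mono mult_left_mono sum_mono count order_refl zero_le)
    finally show ?thesis .
  qed
  moreover have "?M = ennreal (enn2real ?M)"
    by (rule ennreal_enn2real[symmetric]) (simp add: ennreal_mult_less_top)
  ultimately show ?thesis
    by (intro that[of "enn2real ?M"]) simp
qed

lemma outflow_finite:
  "(\<integral>\<^sup>+\<tau>. ennreal (outflow_rate \<tau>) * expect \<tau> (\<lambda>z. ennreal (log_marginal \<tau> z)) \<partial>unit_interval) < \<infinity>"
proof -
  obtain M where M: "\<And>\<tau>. \<tau> \<in> {0..1} \<Longrightarrow> expect \<tau> (\<lambda>z. ennreal (log_marginal \<tau> z)) \<le> ennreal M"
    using expect_log_marginal_bounded by blast
  have "(\<integral>\<^sup>+\<tau>. ennreal (outflow_rate \<tau>) * expect \<tau> (\<lambda>z. ennreal (log_marginal \<tau> z)) \<partial>unit_interval)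
     \<le> (\<integral>\<^sup>+\<tau>. ennreal (outflow_rate \<tau>) * ennreal M \<partial>unit_interval)"
    by (intro nn_integral_mono mult_left_mono M) (auto simp: space_restrict_space)
  also have "\<dots> = (\<integral>\<^sup>+\<tau>. ennreal (outflow_rate \<tau>) \<partial>unit_interval) * ennreal M"
    using measurable_unit_interval_continuous[OF outflow_rate_continuous]
    by (intro nn_integral_multc) simp
  also have "(\<integral>\<^sup>+\<tau>. ennreal (outflow_rate \<tau>) \<partial>unit_interval) = ennreal (integral {0..1} outflow_rate)"
    by (intro nn_integral_unit_interval_has_integral outflow_rate_nonneg integrable_integral
        integrable_continuous_real outflow_rate_continuous)
  finally show ?thesis
    by (rule order_le_less_trans) (simp add: ennreal_mult_less_top)
qed

definition posterior_loss :: "real \<Rightarrow> ennreal" where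
  "posterior_loss \<tau> = (\<Sum>\<nu>=1..N. ennreal (t' \<nu> \<tau>) * jump_sum \<nu> (\<lambda>w. expect \<tau> (\<lambda>z.
      ennreal (L_KL (marginal \<tau> (z + block \<nu> w) / marginal \<tau> z) (mpow (m \<nu>) (p \<nu>) w)))))"

lemma posterior_loss_measurable: "posterior_loss \<in> borel_measurable unit_interval"
  unfolding posterior_loss_def[abs_def]
proof (intro borel_measurable_sum borel_measurable_times_ennreal jump_sum_measurable expect_measurable)
  fix \<nu> w and z :: "nat \<Rightarrow> nat \<Rightarrow> nat"
  show "(\<lambda>\<tau>. ennreal (L_KL (marginal \<tau> (z + block \<nu> w) / marginal \<tau> z) (mpow (m \<nu>) (p \<nu>) w))) \<in> borel_measurable unit_interval"
    unfolding L_KL_def using marginal_measurable[of z] marginal_measurable[of "z + block \<nu> w"] by measurable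
qed (use t'_measurable in auto)

lemma expect_decay_rate:
  assumes \<tau>: "\<tau> \<in> {0<..<1} - departure_times"
  shows "expect \<tau> (\<lambda>z. ennreal (decay_rate \<tau> z))
    = (\<Sum>\<nu>=1..N. ennreal (t' \<nu> \<tau>) * jump_sum \<nu> (\<lambda>w. expect \<tau> (\<lambda>z. ennreal (marginal \<tau> (z + block \<nu> w) / marginal \<tau> z))))"
proof -
  have \<tau>': "\<tau> \<in> {0..1}" using \<tau> by auto
  have "ennreal (decay_rate \<tau> z)
      = (\<Sum>\<nu>=1..N. ennreal (t' \<nu> \<tau>) * jump_sum \<nu> (\<lambda>w. ennreal (marginal \<tau> (z + block \<nu> w) / marginal \<tau> z)))" for z
  proof -
    have pos: "marginal \<tau> x > 0" for x
      using marginal_pos[OF \<tau>'] .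
    have "ennreal (decay_rate \<tau> z) = ennreal (enn2real (decay \<tau> z)) * ennreal (1 / marginal \<tau> z)"
      using pos[of z] by (simp add: decay_rate_def ennreal_mult'[symmetric])
    also have "\<dots> = decay \<tau> z * ennreal (1 / marginal \<tau> z)"
      using marginal_has_derivative(2)[OF \<tau>, of z] by simp
    also have "\<dots> = (\<Sum>\<nu>=1..N. ennreal (t' \<nu> \<tau>) * jump_sum \<nu> (\<lambda>w. ennreal (marginal \<tau> (z + block \<nu> w)) * ennreal (1 / marginal \<tau> z)))"
      by (simp only: decay_def sum_distrib_right mult.assoc jump_sum_multc)
    also have "\<dots> = (\<Sum>\<nu>=1..N. ennreal (t' \<nu> \<tau>) * jump_sum \<nu> (\<lambda>w. ennreal (marginal \<tau> (z + block \<nu> w) / marginal \<tau> z)))"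
      using pos by (simp add: ennreal_mult'[symmetric] less_imp_le)
    finally show ?thesis .
  qed
  then show ?thesis
    by (simp only: expect_sum[OF \<tau>'] expect_cmult[OF \<tau>'] expect_jump_sum)
qed

text \<open>
  \<open>L_KL_balance\<close>, averaged over the observation \<open>Z(\<tau>)\<close> and summed over the jumps. By \<open>expect_decay_rate\<close> the
  posterior estimates add up to the derivative of \<open>log_marginal\<close>.
\<close>

lemma loss_balance:
  assumes \<tau>: "\<tau> \<in> {0<..<1} - departure_times"
  shows "posterior_loss \<tau> + (\<Sum>\<nu>=1..N. ennreal (t' \<nu> \<tau>) * (ennreal (jump_rate \<nu> p) + ennreal (entropy_rate \<nu>)))
      + ennreal (outflow_rate \<tau>) * expect \<tau> (\<lambda>z. ennreal (log_marginal \<tau> z))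
    = expect \<tau> (\<lambda>z. ennreal (decay_rate \<tau> z))
      + (\<Sum>\<nu>=1..N. ennreal (t' \<nu> \<tau>) * jump_sum \<nu> (\<lambda>w. ennreal (mpow (m \<nu>) (p \<nu>) w)
          * expect \<tau> (\<lambda>z. ennreal (log_marginal \<tau> (z + block \<nu> w)))))"
proof -
  have \<tau>': "\<tau> \<in> {0..1}" using \<tau> by auto
  let ?E = "expect \<tau> (\<lambda>z. ennreal (log_marginal \<tau> z))"
  let ?L = "\<lambda>\<nu> w z. ennreal (L_KL (marginal \<tau> (z + block \<nu> w) / marginal \<tau> z) (mpow (m \<nu>) (p \<nu>) w))"
  let ?d = "\<lambda>\<nu> w z. ennreal (marginal \<tau> (z + block \<nu> w) / marginal \<tau> z)"
  let ?lm = "\<lambda>\<nu> w z. ennreal (log_marginal \<tau> (z + block \<nu> w))"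
  let ?\<theta> = "\<lambda>\<nu> w. mpow (m \<nu>) (p \<nu>) w"
  have block: "jump_sum \<nu> (\<lambda>w. expect \<tau> (?L \<nu> w)) + ennreal (jump_rate \<nu> p) + ennreal (jump_rate \<nu> p) * ?E + ennreal (entropy_rate \<nu>)
      = jump_sum \<nu> (\<lambda>w. expect \<tau> (?d \<nu> w)) + jump_sum \<nu> (\<lambda>w. ennreal (?\<theta> \<nu> w) * expect \<tau> (?lm \<nu> w))"
    if \<nu>: "\<nu> \<in> {1..N}" for \<nu>
  proof -
    have \<theta>: "0 < ?\<theta> \<nu> w" "?\<theta> \<nu> w \<le> 1" for w
      using mpow_pos[OF simplex[OF p_space \<nu>]] mpow_le_1[OF simplex[OF p_space \<nu>]] by auto
    have w: "expect \<tau> (?L \<nu> w) + ennreal (?\<theta> \<nu> w) + ennreal (?\<theta> \<nu> w) * ?E + ennreal (?\<theta> \<nu> w) * ennreal (- ln (?\<theta> \<nu> w))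
        = expect \<tau> (?d \<nu> w) + ennreal (?\<theta> \<nu> w) * expect \<tau> (?lm \<nu> w)" for w
    proof -
      have "?L \<nu> w z + ennreal (?\<theta> \<nu> w) + ennreal (?\<theta> \<nu> w) * ennreal (log_marginal \<tau> z) + ennreal (?\<theta> \<nu> w) * ennreal (- ln (?\<theta> \<nu> w))
          = ?d \<nu> w z + ennreal (?\<theta> \<nu> w) * ?lm \<nu> w z" for z
      proof (rule L_KL_balance[OF _ \<theta>])
        have pos: "marginal \<tau> (z + block \<nu> w) > 0" "marginal \<tau> z > 0" "marginal 0 0 > 0"
          using marginal_pos[of \<tau>] marginal_pos[of 0] \<tau>' by auto
        then show "marginal \<tau> (z + block \<nu> w) / marginal \<tau> z > 0" by simp
        show "log_marginal \<tau> (z + block \<nu> w) - log_marginal \<tau> z = - ln (marginal \<tau> (z + block \<nu> w) / marginal \<tau> z)"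
          using pos by (simp add: log_marginal_def ln_div)
      qed (use \<tau>' in \<open>auto intro: log_marginal_nonneg\<close>)
      then have "expect \<tau> (\<lambda>z. ?L \<nu> w z + ennreal (?\<theta> \<nu> w) + ennreal (?\<theta> \<nu> w) * ennreal (log_marginal \<tau> z) + ennreal (?\<theta> \<nu> w) * ennreal (- ln (?\<theta> \<nu> w)))
          = expect \<tau> (\<lambda>z. ?d \<nu> w z + ennreal (?\<theta> \<nu> w) * ?lm \<nu> w z)"
        by (simp only:)
      then show ?thesis
        by (simp only: expect_add[OF \<tau>'] expect_const[OF \<tau>'] expect_cmult[OF \<tau>'])
    qed
    then have "jump_sum \<nu> (\<lambda>w. expect \<tau> (?L \<nu> w) + ennreal (?\<theta> \<nu> w) + ennreal (?\<theta> \<nu> w) * ?E + ennreal (?\<theta> \<nu> w) * ennreal (- ln (?\<theta> \<nu> w)))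
        = jump_sum \<nu> (\<lambda>w. expect \<tau> (?d \<nu> w) + ennreal (?\<theta> \<nu> w) * expect \<tau> (?lm \<nu> w))"
      by (simp only:)
    then show ?thesis
      by (simp only: jump_sum_add jump_sum_multc jump_sum_mpow[OF \<nu>] jump_sum_entropy[OF \<nu>])
  qed
  have out: "ennreal (outflow_rate \<tau>) * ?E = (\<Sum>\<nu>=1..N. ennreal (t' \<nu> \<tau>) * (ennreal (jump_rate \<nu> p) * ?E))"
  proof -
    have "ennreal (outflow_rate \<tau>) = (\<Sum>\<nu>=1..N. ennreal (t' \<nu> \<tau> * jump_rate \<nu> p))"
      unfolding outflow_rate_def using \<tau>'
      by (intro sum_ennreal[symmetric] mult_nonneg_nonneg t'_nonneg jump_rate_nonneg p_space)
    also have "\<dots> = (\<Sum>\<nu>=1..N. ennreal (t' \<nu> \<tau>) * ennreal (jump_rate \<nu> p))"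
      using \<tau>' by (intro sum.cong refl ennreal_mult t'_nonneg jump_rate_nonneg p_space)
    finally show ?thesis
      by (simp add: sum_distrib_right mult.assoc)
  qed
  have "posterior_loss \<tau> + (\<Sum>\<nu>=1..N. ennreal (t' \<nu> \<tau>) * (ennreal (jump_rate \<nu> p) + ennreal (entropy_rate \<nu>)))
      + ennreal (outflow_rate \<tau>) * ?E
    = (\<Sum>\<nu>=1..N. ennreal (t' \<nu> \<tau>) * (jump_sum \<nu> (\<lambda>w. expect \<tau> (?L \<nu> w)) + ennreal (jump_rate \<nu> p) + ennreal (jump_rate \<nu> p) * ?E + ennreal (entropy_rate \<nu>)))"
    unfolding out posterior_loss_def sum.distrib[symmetric] distrib_left[symmetric]
    by (simp only: ac_simps)
  also have "\<dots> = (\<Sum>\<nu>=1..N. ennreal (t' \<nu> \<tau>) * (jump_sum \<nu> (\<lambda>w. expect \<tau> (?d \<nu> w)) + jump_sum \<nu> (\<lambda>w. ennreal (?\<theta> \<nu> w) * expect \<tau> (?lm \<nu> w))))"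
    by (intro sum.cong refl arg_cong2[where f="(*)"] block)
  also have "\<dots> = expect \<tau> (\<lambda>z. ennreal (decay_rate \<tau> z))
      + (\<Sum>\<nu>=1..N. ennreal (t' \<nu> \<tau>) * jump_sum \<nu> (\<lambda>w. ennreal (?\<theta> \<nu> w) * expect \<tau> (?lm \<nu> w)))"
    unfolding expect_decay_rate[OF \<tau>] by (simp only: distrib_left sum.distrib)
  finally show ?thesis .
qed

lemma nn_integral_t':
  assumes \<nu>: "\<nu> \<in> {1..N}"
  shows "(\<integral>\<^sup>+\<tau>. ennreal (t' \<nu> \<tau>) \<partial>unit_interval) = ennreal (t \<nu> 1 - t \<nu> 0)"
proof (intro nn_integral_unit_interval_has_integral t'_nonneg \<nu>)
  show "(t' \<nu> has_integral t \<nu> 1 - t \<nu> 0) {0..1}"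
    using t_deriv[OF \<nu>]
    by (intro fundamental_theorem_of_calculus) (auto simp: has_real_derivative_iff_has_vector_derivative)
qed

text \<open>
  Integrating \<open>loss_balance\<close> over \<open>\<tau>\<close> and inserting \<open>dynkin\<close>; the outflow occurs in both and is
  finite, hence cancels.
\<close>

theorem posterior_loss_integral:
  "(\<integral>\<^sup>+\<tau>. posterior_loss \<tau> \<partial>unit_interval)
    + (\<Sum>\<nu>=1..N. ennreal (t \<nu> 1 - t \<nu> 0) * (ennreal (jump_rate \<nu> p) + ennreal (entropy_rate \<nu>)))
    + expect 0 (\<lambda>z. ennreal (log_marginal 0 z))
  = expect 1 (\<lambda>z. ennreal (log_marginal 1 z))"
proof -
  let ?I = "\<lambda>F. \<integral>\<^sup>+\<tau>. F \<tau> \<partial>unit_interval"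
  let ?E0 = "expect 0 (\<lambda>z. ennreal (log_marginal 0 z))"
  let ?H = "\<lambda>\<tau>. \<Sum>\<nu>=1..N. ennreal (t' \<nu> \<tau>) * (ennreal (jump_rate \<nu> p) + ennreal (entropy_rate \<nu>))"
  let ?O = "\<lambda>\<tau>. ennreal (outflow_rate \<tau>) * expect \<tau> (\<lambda>z. ennreal (log_marginal \<tau> z))"
  let ?D = "\<lambda>\<tau>. expect \<tau> (\<lambda>z. ennreal (decay_rate \<tau> z))"
  let ?J = "\<lambda>\<tau>. \<Sum>\<nu>=1..N. ennreal (t' \<nu> \<tau>) * jump_sum \<nu> (\<lambda>w. ennreal (mpow (m \<nu>) (p \<nu>) w)
          * expect \<tau> (\<lambda>z. ennreal (log_marginal \<tau> (z + block \<nu> w))))"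
  have t'_meas: "(\<lambda>\<tau>. ennreal (t' \<nu> \<tau>)) \<in> borel_measurable unit_interval" if "\<nu> \<in> {1..N}" for \<nu>
    by (rule measurable_compose[OF t'_measurable[OF that] measurable_ennreal])
  have H_meas: "?H \<in> borel_measurable unit_interval"
    by (intro borel_measurable_sum borel_measurable_times_ennreal t'_meas borel_measurable_const)
  have O_meas: "?O \<in> borel_measurable unit_interval"
    by (intro borel_measurable_times_ennreal expect_measurable
        measurable_compose[OF log_marginal_measurable measurable_ennreal]
        measurable_compose[OF measurable_unit_interval_continuous[OF outflow_rate_continuous] measurable_ennreal])
  have D_meas: "?D \<in> borel_measurable unit_interval"
    by (intro expect_measurable measurable_compose[OF decay_rate_measurable measurable_ennreal])
  have J_meas: "?J \<in> borel_measurable unit_interval"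
    by (intro borel_measurable_sum borel_measurable_times_ennreal t'_meas jump_sum_measurable
        borel_measurable_const expect_measurable measurable_compose[OF log_marginal_measurable measurable_ennreal])
  have H: "?I ?H
      = (\<Sum>\<nu>=1..N. ennreal (t \<nu> 1 - t \<nu> 0) * (ennreal (jump_rate \<nu> p) + ennreal (entropy_rate \<nu>)))"
  proof -
    have "?I ?H
        = (\<Sum>\<nu>=1..N. \<integral>\<^sup>+\<tau>. ennreal (t' \<nu> \<tau>) * (ennreal (jump_rate \<nu> p) + ennreal (entropy_rate \<nu>)) \<partial>unit_interval)"
      by (intro nn_integral_sum borel_measurable_times_ennreal t'_meas borel_measurable_const)
    also have "\<dots> = (\<Sum>\<nu>=1..N. ennreal (t \<nu> 1 - t \<nu> 0) * (ennreal (jump_rate \<nu> p) + ennreal (entropy_rate \<nu>)))"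
      by (intro sum.cong refl) (simp only: nn_integral_multc[OF t'_meas] nn_integral_t')
    finally show ?thesis .
  qed
  have "?I posterior_loss + ?I ?H + ?I ?O
      = (\<integral>\<^sup>+\<tau>. posterior_loss \<tau> + ?H \<tau> + ?O \<tau> \<partial>unit_interval)"
    using posterior_loss_measurable H_meas O_meas
    by (simp only: nn_integral_add borel_measurable_add)
  also have "\<dots> = (\<integral>\<^sup>+\<tau>. ?D \<tau> + ?J \<tau> \<partial>unit_interval)"
    by (intro nn_integral_cong_AE AE_unit_interval_finite_exception[OF finite_departure_times] loss_balance)
  also have "\<dots> = ?I ?D + ?I ?J"
    by (intro nn_integral_add D_meas J_meas)
  finally have eq: "?I posterior_loss + ?I ?H + ?I ?O
      = ?I ?D + ?I ?J" .
  have "?I posterior_loss + ?I ?H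
        + ?E0 + ?I ?O
      = ?I posterior_loss + ?I ?H + ?I ?O
        + ?E0"
    by (simp only: ac_simps)
  also have "\<dots> = ?I ?D + ?I ?J + ?E0"
    by (simp only: eq)
  also have "\<dots> = expect 1 (\<lambda>z. ennreal (log_marginal 1 z)) + ?I ?O"
    by (rule dynkin)
  finally show ?thesis
    unfolding H using outflow_finite by (rule ennreal_add_right_imp_eq)
qed

end

section \<open>Prior densities and posteriors\<close>

lemma open_simplex_sets: "open_simplex m \<in> sets (PiM {1..m} (\<lambda>_. lborel))"
proof -
  have c: "(\<lambda>q. q i) \<in> borel_measurable (PiM {1..m} (\<lambda>_. lborel :: real measure))" if "i \<in> {1..m}" for i
    using measurable_component_singleton[OF that, of "\<lambda>_. lborel :: real measure"] by simp
  have "open_simplex m = {q \<in> space (PiM {1..m} (\<lambda>_. lborel)). (\<forall>i\<in>{1..m}. 0 < q i) \<and> (\<Sum>i=1..m. q i) < 1}"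
    by (auto simp: open_simplex_def space_PiM)
  also have "\<dots> \<in> sets (PiM {1..m} (\<lambda>_. lborel))"
    by (intro sets.sets_Collect_conj sets.sets_Collect_finite_All borel_measurable_less borel_measurable_const
        borel_measurable_sum c finite_atLeastAtMost)
  finally show ?thesis .
qed

lemma param_set_sets: "param_set N m \<in> sets (param_measure N m)"
  unfolding param_set_def param_measure_def
  by (intro sets_PiM_I_finite open_simplex_sets finite_atLeastAtMost)

lemma param_set_subset_space: "param_set N m \<inter> space (param_measure N m) = param_set N m"
  using sets.sets_into_space[OF param_set_sets[of N m]] by blast

lemma param_coordinate_measurable:
  assumes "\<nu> \<in> {1..N}" "i \<in> {1..m \<nu>}"
  shows "(\<lambda>q. q \<nu> i) \<in> borel_measurable (param_measure N m)"
proof -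
  have "(\<lambda>q. q \<nu>) \<in> measurable (param_measure N m) (PiM {1..m \<nu>} (\<lambda>_. lborel))"
    unfolding param_measure_def by (rule measurable_component_singleton[OF assms(1)])
  moreover have "(\<lambda>x. x i) \<in> measurable (PiM {1..m \<nu>} (\<lambda>_. lborel)) (lborel :: real measure)"
    by (rule measurable_component_singleton[OF assms(2)])
  ultimately have "(\<lambda>q. q \<nu> i) \<in> measurable (param_measure N m) (lborel :: real measure)"
    by (rule measurable_compose)
  then show ?thesis by simp
qed

definition prior_measure ::
  "nat \<Rightarrow> (nat \<Rightarrow> nat) \<Rightarrow> ((nat \<Rightarrow> nat \<Rightarrow> real) \<Rightarrow> real) \<Rightarrow> (nat \<Rightarrow> nat \<Rightarrow> real) measure" where
  "prior_measure N m prior = density (restrict_space (param_measure N m) (param_set N m)) (\<lambda>q. ennreal (prior q))"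

lemma space_prior_measure: "space (prior_measure N m prior) = param_set N m"
  by (simp add: prior_measure_def space_restrict_space param_set_subset_space)

context
  fixes N :: nat and m :: "nat \<Rightarrow> nat" and prior :: "(nat \<Rightarrow> nat \<Rightarrow> real) \<Rightarrow> real"
  assumes prior_measurable: "prior \<in> borel_measurable (restrict_space (param_measure N m) (param_set N m))"
    and prior_nonneg: "\<forall>q\<in>param_set N m. 0 \<le> prior q"
begin

lemma nn_integral_prior_measure:
  assumes "f \<in> borel_measurable (restrict_space (param_measure N m) (param_set N m))"
    "\<And>q. q \<in> param_set N m \<Longrightarrow> 0 \<le> f q"
  shows "(\<integral>\<^sup>+q. ennreal (f q) \<partial>prior_measure N m prior)
       = (\<integral>\<^sup>+q\<in>param_set N m. ennreal (prior q * f q) \<partial>param_measure N m)"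
proof -
  have "(\<integral>\<^sup>+q. ennreal (f q) \<partial>prior_measure N m prior)
     = (\<integral>\<^sup>+q. ennreal (prior q) * ennreal (f q) \<partial>restrict_space (param_measure N m) (param_set N m))"
    unfolding prior_measure_def using assms prior_measurable by (subst nn_integral_density) auto
  also have "\<dots> = (\<integral>\<^sup>+q. ennreal (prior q * f q) \<partial>restrict_space (param_measure N m) (param_set N m))"
    using prior_nonneg assms(2)
    by (intro nn_integral_cong) (simp add: ennreal_mult space_restrict_space)
  also have "\<dots> = (\<integral>\<^sup>+q\<in>param_set N m. ennreal (prior q * f q) \<partial>param_measure N m)"
    by (subst nn_integral_restrict_space) (simp_all add: param_set_subset_space param_set_sets)
  finally show ?thesis .
qed

lemma integral_prior_measure:
  assumes f: "f \<in> borel_measurable (restrict_space (param_measure N m) (param_set N m))"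
  shows "(LINT q|prior_measure N m prior. f q) = (LINT q:param_set N m|param_measure N m. prior q * f q)"
proof -
  have "(LINT q|prior_measure N m prior. f q) = (LINT q|restrict_space (param_measure N m) (param_set N m). prior q *\<^sub>R f q)"
    unfolding prior_measure_def using prior_nonneg
    by (intro integral_density f prior_measurable AE_I2) (simp add: space_restrict_space)
  then show ?thesis
    by (simp add: integral_restrict_space param_set_subset_space param_set_sets set_lebesgue_integral_def)
qed

end

lemma smooth_on_deriv:
  assumes "smooth_on {0..1} f"
  shows "\<And>\<tau>. \<tau> \<in> {0..1} \<Longrightarrow> (f has_real_derivative deriv_within {0..1} f \<tau>) (at \<tau> within {0..1})"
    and "continuous_on {0..1} (deriv_within {0..1} f)"
proof -
  have "f differentiable_on {0..1}"
    using assms[unfolded smooth_on_def, rule_format, of 0] by simp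
  then show "(f has_real_derivative deriv_within {0..1} f \<tau>) (at \<tau> within {0..1})" if "\<tau> \<in> {0..1}" for \<tau>
    using that unfolding deriv_within_def has_real_derivative_iff_has_vector_derivative
    by (auto simp: differentiable_on_def vector_derivative_works[symmetric])
  have "deriv_within {0..1} f differentiable_on {0..1}"
    using assms[unfolded smooth_on_def, rule_format, of 1] by simp
  then show "continuous_on {0..1} (deriv_within {0..1} f)"
    by (rule differentiable_imp_continuous_on)
qed

lemma neg_multinomials_pmf_cong:
  "(\<And>\<nu>. \<nu> \<in> {1..K} \<Longrightarrow> a \<nu> = b \<nu>) \<Longrightarrow> neg_multinomials_pmf K m a p = neg_multinomials_pmf K m b p"
  unfolding neg_multinomials_pmf_def by (intro Pi_pmf_cong) auto

definition joint_coeff :: "nat \<Rightarrow> (nat \<Rightarrow> nat) \<Rightarrow> (nat \<Rightarrow> real) \<Rightarrow> (nat \<Rightarrow> nat \<Rightarrow> nat) \<Rightarrow> real" where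
  "joint_coeff K m a z = (\<Prod>\<nu>=1..K. nm_coeff (m \<nu>) (a \<nu>) (z \<nu>))"

lemma joint_coeff_pos: "\<forall>\<nu>\<in>{1..K}. 0 < a \<nu> \<Longrightarrow> 0 < joint_coeff K m a z"
  unfolding joint_coeff_def by (intro prod_pos nm_coeff_pos) auto

lemma joint_mass_eq:
  assumes "\<forall>\<nu>\<in>{1..K}. 0 < a \<nu>"
  shows "joint_mass K m a q z
    = joint_coeff K m a z * (\<Prod>\<nu>=1..K. p0 (m \<nu>) (q \<nu>) powr a \<nu> * mpow (m \<nu>) (q \<nu>) (z \<nu>))"
  unfolding joint_mass_def joint_coeff_def prod.distrib[symmetric]
  using assms by (intro prod.cong refl) (simp add: neg_multinomial_mass_eq mult.assoc)

lemma param_set_restrict: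
  "n \<le> N \<Longrightarrow> q \<in> param_set N m \<Longrightarrow> restrict q {1..n} \<in> param_set n m"
  by (auto simp: param_set_def)

lemma pmf_neg_multinomials':
  assumes n: "n \<le> N" and s: "\<forall>\<nu>\<in>{1..n}. s \<nu> > 0" and q: "q \<in> param_set N m"
  shows "pmf (neg_multinomials_pmf n m s q) y = (if y \<in> states n m then joint_mass n m s q y else 0)"
proof -
  have "neg_multinomials_pmf n m s q = neg_multinomials_pmf n m s (restrict q {1..n})"
    unfolding neg_multinomials_pmf_def by (intro Pi_pmf_cong) auto
  moreover have "joint_mass n m s (restrict q {1..n}) y = joint_mass n m s q y"
    unfolding joint_mass_def by (intro prod.cong) auto
  ultimately show ?thesis
    using pmf_neg_multinomials[OF s param_set_restrict[OF n q], of y] by simp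
qed

text \<open>
  The factor \<open>joint_coeff\<close> of the likelihood is free of the parameter and cancels. The function \<open>h'\<close>
  stands for \<open>h\<close> on the parameter set, which allows \<open>h\<close> to be rewritten there before measurability is discussed.
\<close>

lemma posterior_expectation_eq:
  assumes prior: "prior \<in> borel_measurable (restrict_space (param_measure N m) (param_set N m))"
      "\<forall>q\<in>param_set N m. 0 \<le> prior q"
    and a: "\<forall>\<nu>\<in>{1..N}. 0 < a \<nu>" and z: "z \<in> states N m"
    and k: "\<And>q. k q = (\<Prod>\<nu>=1..N. p0 (m \<nu>) (q \<nu>) powr a \<nu> * mpow (m \<nu>) (q \<nu>) (z \<nu>))"
      "k \<in> borel_measurable (restrict_space (param_measure N m) (param_set N m))"
    and h: "\<And>q. q \<in> param_set N m \<Longrightarrow> h q = h' q"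
      "h' \<in> borel_measurable (restrict_space (param_measure N m) (param_set N m))"
  shows "posterior_expectation N m prior a z h
    = (LINT q|prior_measure N m prior. h' q * k q) / (LINT q|prior_measure N m prior. k q)"
proof -
  let ?C = "joint_coeff N m a z"
  have C: "?C \<noteq> 0" using joint_coeff_pos[OF a, of m z] by simp
  have pmf: "pmf (neg_multinomials_pmf N m a q) z = ?C * k q" if "q \<in> param_set N m" for q
    using z by (simp add: pmf_neg_multinomials[OF a that] joint_mass_eq[OF a] k(1))
  have "(LINT q:param_set N m|param_measure N m. h q * (prior q * pmf (neg_multinomials_pmf N m a q) z))
      = (LINT q:param_set N m|param_measure N m. ?C * (prior q * (h' q * k q)))"
    by (intro set_lebesgue_integral_cong param_set_sets) (auto simp: pmf h(1))
  also have "\<dots> = ?C * (LINT q|prior_measure N m prior. h' q * k q)"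
    using h(2) k(2) by (simp add: integral_prior_measure[OF prior])
  finally have num: "(LINT q:param_set N m|param_measure N m. h q * (prior q * pmf (neg_multinomials_pmf N m a q) z))
      = ?C * (LINT q|prior_measure N m prior. h' q * k q)" .
  have "(LINT q:param_set N m|param_measure N m. prior q * pmf (neg_multinomials_pmf N m a q) z)
      = (LINT q:param_set N m|param_measure N m. ?C * (prior q * k q))"
    by (intro set_lebesgue_integral_cong param_set_sets) (auto simp: pmf)
  also have "\<dots> = ?C * (LINT q|prior_measure N m prior. k q)"
    using k(2) by (simp add: integral_prior_measure[OF prior])
  finally show ?thesis
    unfolding posterior_expectation_def num using C by simp
qed

section \<open>The risk of the Bayesian predictive mass\<close>

theorem theorem5p1:
  fixes N n :: nat and m :: "nat \<Rightarrow> nat" and r s :: "nat \<Rightarrow> real"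
    and t :: "nat \<Rightarrow> real \<Rightarrow> real"
    and prior :: "(nat \<Rightarrow> nat \<Rightarrow> real) \<Rightarrow> real"
    and p :: "nat \<Rightarrow> nat \<Rightarrow> real"
  assumes "1 \<le> N" and "n \<in> {1..N}"
    and "\<forall>\<nu>\<in>{1..N}. 1 \<le> m \<nu>"
    and "\<forall>\<nu>\<in>{1..N}. 0 < r \<nu>"
    and "\<forall>\<nu>\<in>{1..n}. 0 < s \<nu>"
    and "\<forall>\<nu>\<in>{1..N}. \<forall>\<tau>\<in>{0..1}. 0 < t \<nu> \<tau>"
    and "\<forall>\<nu>\<in>{1..N}. smooth_on {0..1} (t \<nu>)"
    and "\<forall>\<nu>\<in>{1..N}. mono_on {0..1} (t \<nu>)"
    and "\<forall>\<nu>\<in>{1..N}. t \<nu> 0 = r \<nu>"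
    and "\<forall>\<nu>\<in>{1..N}. t \<nu> 1 = (if \<nu> \<le> n then r \<nu> + s \<nu> else r \<nu>)"
    and "prior \<in> borel_measurable (restrict_space (param_measure N m) (param_set N m))"
    and "\<forall>q\<in>param_set N m. 0 \<le> prior q"
    and "\<forall>x :: nat \<Rightarrow> nat \<Rightarrow> nat.
           (\<integral>\<^sup>+q\<in>param_set N m. ennreal (prior q *
              (\<Prod>\<nu>=1..N. p0 (m \<nu>) (q \<nu>) powr r \<nu> * (\<Prod>i=1..m \<nu>. q \<nu> i ^ x \<nu> i)))
              \<partial>param_measure N m) \<in> {0<..<\<infinity>}"
    and "p \<in> param_set N m"
  shows "integrable (measure_pmf (XY_pmf N n m r s p)) (log_ratio N n m prior r s p) \<and>
    ereal (risk N n m prior r s p) = enn2ereal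
      (\<integral>\<^sup>+\<tau>\<in>{0..1}.
         (\<Sum>\<nu>=1..n. ennreal (deriv_within {0..1} (t \<nu>) \<tau>) *
           (\<Sum>k. ennreal (1 / real (Suc k)) *
             (\<Sum>w\<in>\<W> (m \<nu>) (Suc k). ennreal (fact (Suc k) / (\<Prod>i=1..m \<nu>. fact (w i))) *
               (\<integral>\<^sup>+z. ennreal
                  (L_KL
                    (posterior_expectation N m prior (\<lambda>\<mu>. t \<mu> \<tau>) z (\<lambda>q. \<Prod>i=1..m \<nu>. q \<nu> i ^ w i))
                    (\<Prod>i=1..m \<nu>. p \<nu> i ^ w i))
                \<partial>measure_pmf (neg_multinomials_pmf N m (\<lambda>\<mu>. t \<mu> \<tau>) p)))))
       \<partial>lborel)"
proof -
  note N = assms(1) and n = assms(2) and r = assms(4) and s = assms(5) and t_pos = assms(6)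
    and smooth = assms(7) and mono = assms(8) and t0 = assms(9) and t1 = assms(10)
    and prior = assms(11,12) and proper = assms(13) and p = assms(14)
  let ?R = "restrict_space (param_measure N m) (param_set N m)"
  let ?Q = "prior_measure N m prior"
  let ?t' = "\<lambda>\<nu>. deriv_within {0..1} (t \<nu>)"
  have nN: "n \<le> N" and sub: "{1..n} \<subseteq> {1..N}" using n by auto
  have Q_borel: "borel_measurable ?Q = (borel_measurable ?R :: (_ \<Rightarrow> real) set)"
    by (intro measurable_cong_sets) (simp_all add: prior_measure_def)
  have coord: "(\<lambda>q. q \<nu> i) \<in> borel_measurable ?R" if "\<nu> \<in> {1..N}" "i \<in> {1..m \<nu>}" for \<nu> i
    by (intro measurable_restrict_space1 param_coordinate_measurable that)
  have base_meas: "(\<lambda>q. \<Prod>\<nu>=1..N. p0 (m \<nu>) (q \<nu>) powr t \<nu> 0) \<in> borel_measurable ?R"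
    unfolding p0_def
    by (intro borel_measurable_prod powr_real_measurable borel_measurable_diff borel_measurable_sum
        borel_measurable_const coord)
  \<comment> \<open>Zero counts in the properness assumption bound the kernel at time 0.\<close>
  have base: "(\<integral>\<^sup>+q. ennreal (\<Prod>\<nu>=1..N. p0 (m \<nu>) (q \<nu>) powr t \<nu> 0) \<partial>?Q) \<in> {0<..<\<infinity>}"
  proof -
    have "(\<integral>\<^sup>+q. ennreal (\<Prod>\<nu>=1..N. p0 (m \<nu>) (q \<nu>) powr t \<nu> 0) \<partial>?Q)
       = (\<integral>\<^sup>+q\<in>param_set N m. ennreal (prior q * (\<Prod>\<nu>=1..N. p0 (m \<nu>) (q \<nu>) powr t \<nu> 0)) \<partial>param_measure N m)"
      by (intro nn_integral_prior_measure[OF prior base_meas] prod_nonneg) simp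
    also have "\<dots> = (\<integral>\<^sup>+q\<in>param_set N m. ennreal (prior q *
              (\<Prod>\<nu>=1..N. p0 (m \<nu>) (q \<nu>) powr r \<nu> * (\<Prod>i=1..m \<nu>. q \<nu> i ^ (\<lambda>_ _. 0 :: nat) \<nu> i)))
              \<partial>param_measure N m)"
      using t0 by (auto intro!: nn_integral_cong prod.cong arg_cong2[where f = "(*)"] arg_cong[where f = ennreal])
    finally show ?thesis
      using proper[rule_format, of "\<lambda>_ _. 0"] by simp
  qed
  interpret negative_multinomial_path N m p ?Q t ?t'
  proof
    show "emeasure ?Q (space ?Q) \<noteq> 0"
    proof
      assume "emeasure ?Q (space ?Q) = 0"
      then have "(\<integral>\<^sup>+q. ennreal (\<Prod>\<nu>=1..N. p0 (m \<nu>) (q \<nu>) powr t \<nu> 0) \<partial>?Q) = 0"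
        by (intro nn_integral_0_iff_AE[THEN iffD2] AE_I[where N = "space ?Q"])
           (use measurable_compose[OF base_meas[folded Q_borel] measurable_ennreal] in auto)
      with base show False by simp
    qed
  qed (use t_pos mono smooth p base coord in \<open>auto simp: space_prior_measure Q_borel smooth_on_deriv\<close>)
  have kernel_R: "(\<lambda>q. kernel \<tau> q z) \<in> borel_measurable ?R" for \<tau> z
    using kernel_measurable Q_borel by blast
  have posterior: "posterior_expectation N m prior (\<lambda>\<mu>. t \<mu> \<tau>) z (\<lambda>q. \<Prod>i=1..m \<nu>. q \<nu> i ^ w i)
      = marginal \<tau> (z + block \<nu> w) / marginal \<tau> z"
    if "\<tau> \<in> {0..1}" "z \<in> states N m" "\<nu> \<in> {1..N}" for \<tau> z \<nu> w
  proof -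
    have mp: "(\<lambda>q. mpow (m \<nu>) (q \<nu>) w) \<in> borel_measurable ?R"
      using mpow_measurable[OF that(3)] Q_borel by blast
    have tp: "\<forall>\<mu>\<in>{1..N}. 0 < t \<mu> \<tau>" by (intro ballI assms(6)[rule_format] that(1))
    have "posterior_expectation N m prior (\<lambda>\<mu>. t \<mu> \<tau>) z (\<lambda>q. \<Prod>i=1..m \<nu>. q \<nu> i ^ w i)
      = (LINT q|?Q. mpow (m \<nu>) (q \<nu>) w * kernel \<tau> q z) / (LINT q|?Q. kernel \<tau> q z)"
      by (rule posterior_expectation_eq[OF prior tp that(2) kernel_def kernel_R _ mp]) (simp add: mpow_def)
    then show ?thesis
      by (simp add: marginal_def kernel_add_block[OF that(3)] mult.commute)
  qed
  define B where "B y q = (\<Prod>\<nu>=1..n. p0 (m \<nu>) (q \<nu>) powr s \<nu> * mpow (m \<nu>) (q \<nu>) (y \<nu>))" for y q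
  have states_sub: "y \<in> states N m" if "y \<in> states n m" for y
    unfolding states_def
  proof (intro CollectI conjI ballI allI impI)
    fix \<nu> assume \<nu>: "\<nu> \<in> {1..N}"
    show "y \<nu> \<in> count_vectors (m \<nu>)"
      using that \<nu> by (cases "\<nu> \<in> {1..n}") (auto simp: states_def)
  next
    fix \<nu> assume "\<nu> \<notin> {1..N}"
    then have "\<nu> \<notin> {1..n}" using sub by blast
    then show "y \<nu> = 0"
      using that by (simp add: states_def)
  qed
  \<comment> \<open>The kernels of \<open>X\<close> and \<open>Y\<close> multiply to that of \<open>X + Y\<close>; beyond block \<open>n\<close> the size stays put and \<open>y\<close> vanishes.\<close>
  have B_kernel: "B y q * kernel 0 q x = kernel 1 q (x + y)" if y: "y \<in> states n m" for x y q
  proof -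
    have "B y q = (\<Prod>\<nu>=1..N. if \<nu> \<le> n then p0 (m \<nu>) (q \<nu>) powr s \<nu> * mpow (m \<nu>) (q \<nu>) (y \<nu>) else 1)"
      unfolding B_def using nN by (intro prod.mono_neutral_cong_left) auto
    then have "B y q * kernel 0 q x = (\<Prod>\<nu>=1..N. (if \<nu> \<le> n then p0 (m \<nu>) (q \<nu>) powr s \<nu> * mpow (m \<nu>) (q \<nu>) (y \<nu>) else 1)
        * (p0 (m \<nu>) (q \<nu>) powr t \<nu> 0 * mpow (m \<nu>) (q \<nu>) (x \<nu>)))"
      by (simp only: kernel_def prod.distrib)
    also have "\<dots> = kernel 1 q (x + y)"
      unfolding kernel_def
    proof (intro prod.cong refl)
      fix \<nu> assume \<nu>: "\<nu> \<in> {1..N}"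
      have "y \<nu> = 0" if "\<not> \<nu> \<le> n"
        using y that by (simp add: states_def)
      then show "(if \<nu> \<le> n then p0 (m \<nu>) (q \<nu>) powr s \<nu> * mpow (m \<nu>) (q \<nu>) (y \<nu>) else 1)
          * (p0 (m \<nu>) (q \<nu>) powr t \<nu> 0 * mpow (m \<nu>) (q \<nu>) (x \<nu>))
        = p0 (m \<nu>) (q \<nu>) powr t \<nu> 1 * mpow (m \<nu>) (q \<nu>) ((x + y) \<nu>)"
        using t0 t1 \<nu> by (simp add: powr_add mpow_add)
    qed
    finally show ?thesis .
  qed
  have predictive: "predictive_mass N n m prior r s y x = joint_coeff n m s y * (marginal 1 (x + y) / marginal 0 x)"
    if x: "x \<in> states N m" and y: "y \<in> states n m" for x y
  proof -
    have k: "kernel 0 q x = (\<Prod>\<nu>=1..N. p0 (m \<nu>) (q \<nu>) powr r \<nu> * mpow (m \<nu>) (q \<nu>) (x \<nu>))" for q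
      unfolding kernel_def using t0 by (intro prod.cong) auto
    have h: "pmf (neg_multinomials_pmf n m s q) y = joint_coeff n m s y * B y q" if "q \<in> param_set N m" for q
      using y by (simp add: pmf_neg_multinomials'[OF nN s that] joint_mass_eq[OF s] B_def)
    have "B y \<in> borel_measurable ?Q"
      unfolding B_def[abs_def] using sub
      by (intro borel_measurable_prod borel_measurable_times powr_real_measurable p0_measurable mpow_measurable
          borel_measurable_const) auto
    then have h_meas: "(\<lambda>q. joint_coeff n m s y * B y q) \<in> borel_measurable ?R"
      by (simp add: Q_borel)
    have "predictive_mass N n m prior r s y x
        = (LINT q|?Q. joint_coeff n m s y * B y q * kernel 0 q x) / (LINT q|?Q. kernel 0 q x)"
      unfolding predictive_mass_def by (rule posterior_expectation_eq[OF prior r x k kernel_R h h_meas])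
    then show ?thesis
      by (simp add: mult.assoc B_kernel[OF y] marginal_def)
  qed
  let ?P = "XY_pmf N n m r s p"
  \<comment> \<open>The log ratio is split into two nonnegative functions, each integrable by itself.\<close>
  define U where "U = (\<lambda>(x, y). log_marginal 1 (x + y))"
  define V where "V = (\<lambda>(x, y). log_marginal 0 x + (\<Sum>\<nu>=1..n. s \<nu> * jump_rate \<nu> p + - ln (mpow (m \<nu>) (p \<nu>) (y \<nu>))))"
  have log_ratio: "log_ratio N n m prior r s p (x, y) = U (x, y) - V (x, y)"
    if x: "x \<in> states N m" and y: "y \<in> states n m" for x y
  proof -
    have C: "joint_coeff n m s y > 0"
      by (rule joint_coeff_pos[OF s])
    have pos: "marginal 1 (x + y) > 0" "marginal 0 x > 0" "marginal 0 0 > 0"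
      by (simp_all add: marginal_pos)
    have Bpos: "0 < p0 (m \<nu>) (p \<nu>) powr s \<nu> * mpow (m \<nu>) (p \<nu>) (y \<nu>)" "0 < p0 (m \<nu>) (p \<nu>)" "0 < mpow (m \<nu>) (p \<nu>) (y \<nu>)"
      if "\<nu> \<in> {1..n}" for \<nu>
    proof -
      have "p \<nu> \<in> open_simplex (m \<nu>)"
        using that sub by (intro simplex p_space) auto
      then show "0 < p0 (m \<nu>) (p \<nu>)" "0 < mpow (m \<nu>) (p \<nu>) (y \<nu>)"
        by (rule open_simplex_bounds(1), rule mpow_pos)
      then show "0 < p0 (m \<nu>) (p \<nu>) powr s \<nu> * mpow (m \<nu>) (p \<nu>) (y \<nu>)" by simp
    qed
    have "ln (B y p) = (\<Sum>\<nu>=1..n. ln (p0 (m \<nu>) (p \<nu>) powr s \<nu> * mpow (m \<nu>) (p \<nu>) (y \<nu>)))"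
      unfolding B_def by (intro ln_prod finite_atLeastAtMost less_imp_neq[OF Bpos(1), symmetric])
    also have "\<dots> = (\<Sum>\<nu>=1..n. - (s \<nu> * jump_rate \<nu> p + - ln (mpow (m \<nu>) (p \<nu>) (y \<nu>))))"
    proof (intro sum.cong refl)
      fix \<nu> assume "\<nu> \<in> {1..n}"
      from Bpos(2,3)[OF this]
      show "ln (p0 (m \<nu>) (p \<nu>) powr s \<nu> * mpow (m \<nu>) (p \<nu>) (y \<nu>)) = - (s \<nu> * jump_rate \<nu> p + - ln (mpow (m \<nu>) (p \<nu>) (y \<nu>)))"
        by (simp add: ln_mult ln_powr jump_rate_def)
    qed
    finally have lnB: "ln (B y p) = - (\<Sum>\<nu>=1..n. s \<nu> * jump_rate \<nu> p + - ln (mpow (m \<nu>) (p \<nu>) (y \<nu>)))"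
      by (simp only: sum_negf)
    have BB: "B y p > 0"
      unfolding B_def by (intro prod_pos Bpos(1))
    have "pmf (neg_multinomials_pmf n m s p) y / predictive_mass N n m prior r s y x = B y p * marginal 0 x / marginal 1 (x + y)"
      using y C pos by (simp add: pmf_neg_multinomials'[OF nN s p] joint_mass_eq[OF s] predictive[OF x y] B_def)
    then have "log_ratio N n m prior r s p (x, y) = ln (B y p * marginal 0 x / marginal 1 (x + y))"
      by (simp add: log_ratio_def)
    also have "\<dots> = ln (B y p) + ln (marginal 0 x) - ln (marginal 1 (x + y))"
      using BB pos by (simp add: ln_div ln_mult)
    finally show ?thesis
      using pos by (simp add: lnB U_def V_def log_marginal_def ln_div)
  qed
  have support: "AE \<omega> in measure_pmf ?P. fst \<omega> \<in> states N m \<and> snd \<omega> \<in> states n m"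
    by (auto simp: AE_measure_pmf_iff XY_pmf_def set_pmf_eq pmf_pair pmf_neg_multinomials[OF r p]
        pmf_neg_multinomials'[OF nN s p] split: if_splits)
  then have log_ratio_AE: "AE \<omega> in measure_pmf ?P. log_ratio N n m prior r s p \<omega> = U \<omega> - V \<omega>"
    by eventually_elim (metis log_ratio prod.collapse)
  have U_nonneg: "U \<omega> \<ge> 0" for \<omega>
    by (simp add: U_def log_marginal_nonneg split: prod.split)
  have term_nonneg: "0 \<le> s \<nu> * jump_rate \<nu> p" "0 \<le> - ln (mpow (m \<nu>) (p \<nu>) w)" if "\<nu> \<in> {1..n}" for \<nu> w
  proof -
    have \<nu>: "\<nu> \<in> {1..N}" using that sub by auto
    show "0 \<le> s \<nu> * jump_rate \<nu> p"
      using s that jump_rate_nonneg[OF p_space \<nu>] by (simp add: less_imp_le)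
    show "0 \<le> - ln (mpow (m \<nu>) (p \<nu>) w)"
      using mpow_pos[OF simplex[OF p_space \<nu>], of w] mpow_le_1[OF simplex[OF p_space \<nu>], of w] by simp
  qed
  have sum_nonneg': "0 \<le> (\<Sum>\<nu>=1..n. s \<nu> * jump_rate \<nu> p + - ln (mpow (m \<nu>) (p \<nu>) (y \<nu>)))" for y
    by (intro sum_nonneg add_nonneg_nonneg term_nonneg)
  have V_nonneg: "V \<omega> \<ge> 0" for \<omega>
    using sum_nonneg' by (auto simp: V_def intro!: add_nonneg_nonneg log_marginal_nonneg split: prod.split)
  have nn_U: "(\<integral>\<^sup>+\<omega>. ennreal (U \<omega>) \<partial>measure_pmf ?P) = expect 1 (\<lambda>z. ennreal (log_marginal 1 z))"
  proof -
    have "neg_multinomials_pmf N m (\<lambda>\<nu>. t \<nu> 1) p = map_pmf (\<lambda>(x, y). x + y) ?P"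
      unfolding neg_multinomials_convolution[OF nN r s p]
      using t1 by (intro neg_multinomials_pmf_cong) auto
    then show ?thesis
      by (simp add: expect_eq[symmetric] U_def case_prod_beta')
  qed
  have nn_X: "(\<integral>\<^sup>+\<omega>. ennreal (log_marginal 0 (fst \<omega>)) \<partial>measure_pmf ?P) = expect 0 (\<lambda>z. ennreal (log_marginal 0 z))"
  proof -
    have "neg_multinomials_pmf N m (\<lambda>\<nu>. t \<nu> 0) p = map_pmf fst ?P"
      unfolding XY_pmf_def map_fst_pair_pmf using t0 by (intro neg_multinomials_pmf_cong) auto
    then show ?thesis
      by (simp add: expect_eq[symmetric])
  qed
  have nn_Y: "(\<integral>\<^sup>+\<omega>. ennreal (- ln (mpow (m \<nu>) (p \<nu>) (snd \<omega> \<nu>))) \<partial>measure_pmf ?P) = ennreal (s \<nu>) * ennreal (entropy_rate \<nu>)"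
    if \<nu>: "\<nu> \<in> {1..n}" for \<nu>
  proof -
    have \<nu>N: "\<nu> \<in> {1..N}" using \<nu> sub by auto
    have "neg_multinomials_pmf n m s (restrict p {1..n}) = map_pmf snd ?P"
      unfolding XY_pmf_def map_snd_pair_pmf neg_multinomials_pmf_def by (intro Pi_pmf_cong) auto
    then have "(\<integral>\<^sup>+\<omega>. ennreal (- ln (mpow (m \<nu>) (p \<nu>) (snd \<omega> \<nu>))) \<partial>measure_pmf ?P)
        = (\<integral>\<^sup>+y. ennreal (- ln (mpow (m \<nu>) (p \<nu>) (y \<nu>))) \<partial>measure_pmf (neg_multinomials_pmf n m s (restrict p {1..n})))"
      by simp
    also have "\<dots> = (\<Sum>i=1..m \<nu>. (\<integral>\<^sup>+y. ennreal (real (y \<nu> i)) \<partial>measure_pmf (neg_multinomials_pmf n m s (restrict p {1..n})))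
          * ennreal (- ln (p \<nu> i)))"
      unfolding minus_ln_mpow[OF \<nu>N] by (simp add: nn_integral_sum nn_integral_multc)
    also have "\<dots> = (\<Sum>i=1..m \<nu>. ennreal (s \<nu>) * (ennreal (p \<nu> i / p0 (m \<nu>) (p \<nu>)) * ennreal (- ln (p \<nu> i))))"
    proof (intro sum.cong refl)
      fix i assume i: "i \<in> {1..m \<nu>}"
      have "(\<integral>\<^sup>+y. ennreal (real (y \<nu> i)) \<partial>measure_pmf (neg_multinomials_pmf n m s (restrict p {1..n})))
          = ennreal (s \<nu> * (p \<nu> i / p0 (m \<nu>) (p \<nu>)))"
        using neg_multinomials_mean[OF s param_set_restrict[OF nN p] \<nu> i] \<nu> by simp
      also have "\<dots> = ennreal (s \<nu>) * ennreal (p \<nu> i / p0 (m \<nu>) (p \<nu>))"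
        using s \<nu> by (intro ennreal_mult minus_ln_coordinate_nonneg(2)[OF \<nu>N i]) (auto intro: less_imp_le)
      finally show "(\<integral>\<^sup>+y. ennreal (real (y \<nu> i)) \<partial>measure_pmf (neg_multinomials_pmf n m s (restrict p {1..n}))) * ennreal (- ln (p \<nu> i))
          = ennreal (s \<nu>) * (ennreal (p \<nu> i / p0 (m \<nu>) (p \<nu>)) * ennreal (- ln (p \<nu> i)))"
        by (simp only: mult.assoc)
    qed
    finally show ?thesis
      unfolding ennreal_entropy_rate[OF \<nu>N] by (simp only: sum_distrib_left)
  qed
  have nn_V: "(\<integral>\<^sup>+\<omega>. ennreal (V \<omega>) \<partial>measure_pmf ?P)
      = (\<Sum>\<nu>=1..N. ennreal (t \<nu> 1 - t \<nu> 0) * (ennreal (jump_rate \<nu> p) + ennreal (entropy_rate \<nu>)))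
        + expect 0 (\<lambda>z. ennreal (log_marginal 0 z))"
  proof -
    have "ennreal (V \<omega>) = ennreal (log_marginal 0 (fst \<omega>))
        + (\<Sum>\<nu>=1..n. ennreal (s \<nu> * jump_rate \<nu> p) + ennreal (- ln (mpow (m \<nu>) (p \<nu>) (snd \<omega> \<nu>))))" for \<omega>
    proof -
      have "ennreal (V \<omega>) = ennreal (log_marginal 0 (fst \<omega>))
          + ennreal (\<Sum>\<nu>=1..n. s \<nu> * jump_rate \<nu> p + - ln (mpow (m \<nu>) (p \<nu>) (snd \<omega> \<nu>)))"
        unfolding V_def case_prod_beta' by (intro ennreal_plus sum_nonneg' log_marginal_nonneg) simp
      also have "ennreal (\<Sum>\<nu>=1..n. s \<nu> * jump_rate \<nu> p + - ln (mpow (m \<nu>) (p \<nu>) (snd \<omega> \<nu>)))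
          = (\<Sum>\<nu>=1..n. ennreal (s \<nu> * jump_rate \<nu> p + - ln (mpow (m \<nu>) (p \<nu>) (snd \<omega> \<nu>))))"
        by (intro sum_ennreal[symmetric] add_nonneg_nonneg term_nonneg)
      also have "\<dots> = (\<Sum>\<nu>=1..n. ennreal (s \<nu> * jump_rate \<nu> p) + ennreal (- ln (mpow (m \<nu>) (p \<nu>) (snd \<omega> \<nu>))))"
        by (intro sum.cong refl ennreal_plus term_nonneg)
      finally show ?thesis .
    qed
    then have "(\<integral>\<^sup>+\<omega>. ennreal (V \<omega>) \<partial>measure_pmf ?P) = expect 0 (\<lambda>z. ennreal (log_marginal 0 z))
        + (\<Sum>\<nu>=1..n. ennreal (s \<nu> * jump_rate \<nu> p) + (\<integral>\<^sup>+\<omega>. ennreal (- ln (mpow (m \<nu>) (p \<nu>) (snd \<omega> \<nu>))) \<partial>measure_pmf ?P))"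
      by (simp add: nn_integral_add nn_integral_sum nn_X measure_pmf.emeasure_space_1[simplified])
    also have "(\<Sum>\<nu>=1..n. ennreal (s \<nu> * jump_rate \<nu> p) + (\<integral>\<^sup>+\<omega>. ennreal (- ln (mpow (m \<nu>) (p \<nu>) (snd \<omega> \<nu>))) \<partial>measure_pmf ?P))
        = (\<Sum>\<nu>=1..n. ennreal (s \<nu>) * (ennreal (jump_rate \<nu> p) + ennreal (entropy_rate \<nu>)))"
    proof (intro sum.cong refl)
      fix \<nu> assume \<nu>: "\<nu> \<in> {1..n}"
      have "ennreal (s \<nu> * jump_rate \<nu> p) = ennreal (s \<nu>) * ennreal (jump_rate \<nu> p)"
        using s \<nu> sub by (intro ennreal_mult jump_rate_nonneg p_space) (auto intro: less_imp_le)
      then show "ennreal (s \<nu> * jump_rate \<nu> p) + (\<integral>\<^sup>+\<omega>. ennreal (- ln (mpow (m \<nu>) (p \<nu>) (snd \<omega> \<nu>))) \<partial>measure_pmf ?P)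
          = ennreal (s \<nu>) * (ennreal (jump_rate \<nu> p) + ennreal (entropy_rate \<nu>))"
        by (simp only: nn_Y[OF \<nu>] distrib_left)
    qed
    also have "\<dots> = (\<Sum>\<nu>=1..N. ennreal (t \<nu> 1 - t \<nu> 0) * (ennreal (jump_rate \<nu> p) + ennreal (entropy_rate \<nu>)))"
      using nN t0 t1 by (intro sum.mono_neutral_cong_left) auto
    finally show ?thesis
      by (simp only: add.commute)
  qed
  let ?integrand = "\<lambda>\<tau>.
         (\<Sum>\<nu>=1..n. ennreal (?t' \<nu> \<tau>) *
           (\<Sum>k. ennreal (1 / real (Suc k)) *
             (\<Sum>w\<in>\<W> (m \<nu>) (Suc k). ennreal (fact (Suc k) / (\<Prod>i=1..m \<nu>. fact (w i))) *
               (\<integral>\<^sup>+z. ennreal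
                  (L_KL
                    (posterior_expectation N m prior (\<lambda>\<mu>. t \<mu> \<tau>) z (\<lambda>q. \<Prod>i=1..m \<nu>. q \<nu> i ^ w i))
                    (\<Prod>i=1..m \<nu>. p \<nu> i ^ w i))
                \<partial>measure_pmf (neg_multinomials_pmf N m (\<lambda>\<mu>. t \<mu> \<tau>) p)))))"
  let ?rhs = "\<integral>\<^sup>+\<tau>\<in>{0..1}. ?integrand \<tau> \<partial>lborel"
  have rhs: "?rhs = (\<integral>\<^sup>+\<tau>. posterior_loss \<tau> \<partial>unit_interval)"
  proof -
    have "?rhs = (\<integral>\<^sup>+\<tau>. ?integrand \<tau> \<partial>unit_interval)"
      by (rule nn_integral_restrict_space[symmetric]) simp
    also have "\<dots> = (\<integral>\<^sup>+\<tau>. posterior_loss \<tau> \<partial>unit_interval)"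
    proof (intro nn_integral_cong_AE AE_unit_interval_finite_exception[OF finite_departure_times])
      fix \<tau> assume \<tau>: "\<tau> \<in> {0<..<1} - departure_times"
      then have \<tau>': "\<tau> \<in> {0..1}" by auto
      have tp: "\<forall>\<mu>\<in>{1..N}. 0 < t \<mu> \<tau>" by (intro ballI assms(6)[rule_format] \<tau>')
      have inner: "(\<integral>\<^sup>+z. ennreal (L_KL (posterior_expectation N m prior (\<lambda>\<mu>. t \<mu> \<tau>) z (\<lambda>q. \<Prod>i=1..m \<nu>. q \<nu> i ^ w i))
                    (\<Prod>i=1..m \<nu>. p \<nu> i ^ w i)) \<partial>measure_pmf (neg_multinomials_pmf N m (\<lambda>\<mu>. t \<mu> \<tau>) p))
          = expect \<tau> (\<lambda>z. ennreal (L_KL (marginal \<tau> (z + block \<nu> w) / marginal \<tau> z) (mpow (m \<nu>) (p \<nu>) w)))"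
        if "\<nu> \<in> {1..N}" for \<nu> w
        unfolding expect_eq[OF \<tau>', symmetric]
      proof (intro nn_integral_cong_AE, unfold AE_measure_pmf_iff, intro ballI)
        fix z assume "z \<in> set_pmf (neg_multinomials_pmf N m (\<lambda>\<mu>. t \<mu> \<tau>) p)"
        then have z: "z \<in> states N m"
          by (auto simp: set_pmf_eq pmf_neg_multinomials[OF tp p] split: if_splits)
        show "ennreal (L_KL (posterior_expectation N m prior (\<lambda>\<mu>. t \<mu> \<tau>) z (\<lambda>q. \<Prod>i=1..m \<nu>. q \<nu> i ^ w i))
              (\<Prod>i=1..m \<nu>. p \<nu> i ^ w i))
          = ennreal (L_KL (marginal \<tau> (z + block \<nu> w) / marginal \<tau> z) (mpow (m \<nu>) (p \<nu>) w))"
          by (simp only: posterior[OF \<tau>' z that] mpow_def)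
      qed
      \<comment> \<open>The integrand of the theorem runs over the predicted blocks only; the others have constant size.\<close>
      have still: "?t' \<nu> \<tau> = 0" if "\<nu> \<in> {1..N}" "\<not> \<nu> \<le> n" for \<nu>
      proof -
        have "t \<nu> \<tau> \<le> t \<nu> 1"
          using \<tau>' by (intro mono_onD[OF t_mono[OF that(1)]]) auto
        then have "\<not> t \<nu> 0 < t \<nu> \<tau>"
          using t0 t1 that by simp
        then show ?thesis
          using t_locally[OF that(1) \<tau>] by simp
      qed
      have "posterior_loss \<tau> = (\<Sum>\<nu>=1..n. ennreal (?t' \<nu> \<tau>) * jump_sum \<nu> (\<lambda>w. expect \<tau> (\<lambda>z.
          ennreal (L_KL (marginal \<tau> (z + block \<nu> w) / marginal \<tau> z) (mpow (m \<nu>) (p \<nu>) w)))))"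
        unfolding posterior_loss_def using nN still by (intro sum.mono_neutral_right) auto
      then show "?integrand \<tau> = posterior_loss \<tau>"
        unfolding jump_sum_def nn_integral_levy
        using sub by (simp only:) (intro sum.cong refl, subst inner, auto)
    qed
    finally show ?thesis .
  qed
  have total: "(\<integral>\<^sup>+\<omega>. ennreal (U \<omega>) \<partial>measure_pmf ?P) = ?rhs + (\<integral>\<^sup>+\<omega>. ennreal (V \<omega>) \<partial>measure_pmf ?P)"
    unfolding rhs nn_U nn_V posterior_loss_integral[symmetric] by (simp only: add.assoc)
  have "(\<integral>\<^sup>+\<omega>. ennreal (U \<omega>) \<partial>measure_pmf ?P) < \<infinity>"
  proof -
    obtain M where "expect 1 (\<lambda>z. ennreal (log_marginal 1 z)) \<le> ennreal M"
      using expect_log_marginal_bounded by (metis atLeastAtMost_iff order_refl zero_le_one)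
    then show ?thesis
      unfolding nn_U by (rule order_le_less_trans) simp
  qed
  then have finite: "?rhs < \<infinity>" "(\<integral>\<^sup>+\<omega>. ennreal (V \<omega>) \<partial>measure_pmf ?P) < \<infinity>"
    "(\<integral>\<^sup>+\<omega>. ennreal (U \<omega>) \<partial>measure_pmf ?P) < \<infinity>"
    unfolding total by simp_all
  have int_U: "integrable (measure_pmf ?P) U" and int_V: "integrable (measure_pmf ?P) V"
    using finite U_nonneg V_nonneg by (auto intro!: integrableI_nonneg)
  obtain l where l: "0 \<le> l" "?rhs = ennreal l"
    using finite(1) by (cases ?rhs rule: ennreal_cases) auto
  have int_nonneg: "0 \<le> integral\<^sup>L (measure_pmf ?P) U" "0 \<le> integral\<^sup>L (measure_pmf ?P) V"
    using U_nonneg V_nonneg by (auto intro!: Bochner_Integration.integral_nonneg)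
  have "ennreal (integral\<^sup>L (measure_pmf ?P) U) = ennreal (l + integral\<^sup>L (measure_pmf ?P) V)"
    using total nn_integral_eq_integral[OF int_U] nn_integral_eq_integral[OF int_V] U_nonneg V_nonneg l int_nonneg
    by simp
  then have "integral\<^sup>L (measure_pmf ?P) U = l + integral\<^sup>L (measure_pmf ?P) V"
    by (simp only: ennreal_inj[OF int_nonneg(1) add_nonneg_nonneg[OF l(1) int_nonneg(2)]])
  then have "integral\<^sup>L (measure_pmf ?P) U - integral\<^sup>L (measure_pmf ?P) V = l"
    by linarith
  moreover have "integrable (measure_pmf ?P) (log_ratio N n m prior r s p)"
    using integrable_cong_AE[THEN iffD2, OF _ _ log_ratio_AE] int_U int_V by simp
  moreover have "risk N n m prior r s p = integral\<^sup>L (measure_pmf ?P) U - integral\<^sup>L (measure_pmf ?P) V"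
    unfolding risk_def using integral_cong_AE[OF _ _ log_ratio_AE] int_U int_V by simp
  ultimately show ?thesis
    using l by (simp add: enn2ereal_ennreal)
qed

end
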